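(* Let $\Omega\subset\mathbb{R}^N$ be a bounded open set with Lipschitz boundary satisfying a uniform exterior sphere condition, fix $k\in\mathbb{N}$, and for $s\in(0,\frac14]$ let $\phi_s$ be an $L^2$-normalized Dirichlet eigenfunction of $(-\Delta)^s$ in $\Omega$ corresponding to $\lambda_{k,s}$. Then $\lim_{\delta\to0^+}\sup_{s\in(0,\frac14]}\|\phi_s\|_{L^\infty(\Omega^\delta)}=0$, where $\Omega^\delta=\{x\in\Omega:\delta_\Omega(x)<\delta\}$. That is, for every $\varepsilon>0$ there is $\delta_\varepsilon>0$ such that $|\phi_s(x)|\le\varepsilon$ for all $s\in(0,\frac14]$ and $x\in\Omega^{\delta_\varepsilon}$.
   Context: $\delta_\Omega(x)=\operatorname{dist}(x,\mathbb{R}^N\setminus\Omega)$. Uniform exterior sphere condition: there is $R_0>0$ such that for every $x_*\in\partial\Omega$ there is a ball $B$ of radius $R_0$ with $B\subset\mathbb{R}^N\setminus\overline\Omega$ and $\overline B\cap\overline\Omega=\{x_*\}$. For $s\in(0,1)$: $C_{N,s}=s4^s\frac{\Gamma(\frac N2+s)}{\pi^{N/2}\Gamma(1-s)}$, $\mathcal{H}^s_0(\Omega)=\{u\in H^s(\mathbb{R}^N): u\equiv0\text{ on }\mathbb{R}^N\setminus\Omega\}$, $\mathcal{E}_s(u,v)=\frac{C_{N,s}}2\iint\frac{(u(x)-u(y))(v(x)-v(y))}{|x-y|^{N+2s}}dxdy$; a Dirichlet eigenfunction of $(-\Delta)^s$ with eigenvalue $\lambda$ is $\phi\in\mathcal{H}^s_0(\Omega)\setminus\{0\}$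 with $\mathcal{E}_s(\phi,v)=\lambda\int_\Omega\phi v$ for all $v\in\mathcal{H}^s_0(\Omega)$; $\lambda_{k,s}$ is the $k$-th eigenvalue counted with multiplicity. *)

theory Defs
  imports "HOL-Analysis.Analysis"
begin

text \<open>Ambient space: R^N is a Euclidean space type 'a with N = DIM('a).
  Functions are real-valued on 'a; elements of L^2 / H^s are understood
  up to Lebesgue-a.e. equality.\<close>

definition dist_compl :: "'a::euclidean_space set \<Rightarrow> 'a \<Rightarrow> real" where
  "dist_compl \<Omega> x = infdist x (- \<Omega>)"

definition lipschitz_boundary :: "'a::euclidean_space set \<Rightarrow> bool" where
  "lipschitz_boundary \<Omega> \<longleftrightarrow>
     (\<forall>p\<in>frontier \<Omega>. \<exists>(e::'a) (r::real) (g::'a \<Rightarrow> real) (L::real).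
        norm e = 1 \<and> r > 0 \<and>
        (\<forall>y z. y \<bullet> e = 0 \<longrightarrow> z \<bullet> e = 0 \<longrightarrow> \<bar>g y - g z\<bar> \<le> L * norm (y - z)) \<and>
        (\<forall>x\<in>ball p r. x \<in> \<Omega> \<longleftrightarrow> x \<bullet> e > g (x - (x \<bullet> e) *\<^sub>R e)))"

definition uniform_exterior_sphere :: "'a::euclidean_space set \<Rightarrow> bool" where
  "uniform_exterior_sphere \<Omega> \<longleftrightarrow>
     (\<exists>R0>0. \<forall>x\<in>frontier \<Omega>. \<exists>c.
        ball c R0 \<subseteq> - closure \<Omega> \<and> cball c R0 \<inter> closure \<Omega> = {x})"

definition frac_const :: "nat \<Rightarrow> real \<Rightarrow> real" where
  "frac_const N s = s * 4 powr s * Gamma (real N / 2 + s) / (pi powr (real N / 2) * Gamma (1 - s))"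

definition frac_Hs :: "real \<Rightarrow> ('a::euclidean_space \<Rightarrow> real) set" where
  "frac_Hs s = {u. u \<in> borel_measurable lebesgue \<and>
      integrable lebesgue (\<lambda>x. (u x)\<^sup>2) \<and>
      integrable (lebesgue \<Otimes>\<^sub>M lebesgue)
        (\<lambda>(x,y). (u x - u y)\<^sup>2 / norm (x - y) powr (real DIM('a) + 2 * s))}"

definition frac_H0s :: "real \<Rightarrow> 'a::euclidean_space set \<Rightarrow> ('a \<Rightarrow> real) set" where
  "frac_H0s s \<Omega> = {u \<in> frac_Hs s. AE x in lebesgue. x \<notin> \<Omega> \<longrightarrow> u x = 0}"

definition frac_form :: "real \<Rightarrow> ('a::euclidean_space \<Rightarrow> real) \<Rightarrow> ('a \<Rightarrow> real) \<Rightarrow> real" where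
  "frac_form s u v = frac_const DIM('a) s / 2 *
     integral\<^sup>L (lebesgue \<Otimes>\<^sub>M lebesgue)
       (\<lambda>(x,y). (u x - u y) * (v x - v y) / norm (x - y) powr (real DIM('a) + 2 * s))"

definition frac_eigenfunction ::
    "real \<Rightarrow> 'a::euclidean_space set \<Rightarrow> real \<Rightarrow> ('a \<Rightarrow> real) \<Rightarrow> bool" where
  "frac_eigenfunction s \<Omega> lam \<phi> \<longleftrightarrow>
     \<phi> \<in> frac_H0s s \<Omega> \<and> \<not> (AE x in lebesgue. \<phi> x = 0) \<and>
     (\<forall>v\<in>frac_H0s s \<Omega>. frac_form s \<phi> v = lam * (LINT x:\<Omega>|lebesgue. \<phi> x * v x))"

definition frac_eigenvalue :: "real \<Rightarrow> 'a::euclidean_space set \<Rightarrow> real \<Rightarrow> bool" where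
  "frac_eigenvalue s \<Omega> lam \<longleftrightarrow> (\<exists>\<phi>. frac_eigenfunction s \<Omega> lam \<phi>)"

definition ae_lin_indep :: "('a::euclidean_space \<Rightarrow> real) set \<Rightarrow> bool" where
  "ae_lin_indep F \<longleftrightarrow> finite F \<and>
     (\<forall>c. (AE x in lebesgue. (\<Sum>f\<in>F. c f * f x) = 0) \<longrightarrow> (\<forall>f\<in>F. c f = 0))"

text \<open>The k-th eigenvalue counted with multiplicity: the least eigenvalue \<lambda> such that
  the eigenspaces of eigenvalues \<le> \<lambda> together have dimension at least k.\<close>
definition frac_kth_eigenvalue :: "real \<Rightarrow> 'a::euclidean_space set \<Rightarrow> nat \<Rightarrow> real" where
  "frac_kth_eigenvalue s \<Omega> k = (LEAST lam. frac_eigenvalue s \<Omega> lam \<and>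
     (\<exists>F. card F = k \<and> ae_lin_indep F \<and>
          (\<forall>f\<in>F. \<exists>\<mu>\<le>lam. frac_eigenfunction s \<Omega> \<mu> f)))"

end

theory Submission
  imports Defs "HOL-Library.Diagonal_Subsequence"
begin

text \<open>Let \<open>C\<close> be the normalisation constant and \<open>\<mu> = \<lambda> / C\<close>. Testing \<open>\<lambda>\<^sub>k\<close> with \<open>k\<close> disjoint bumps supported
  in a ball of diameter at most 1 gives \<open>\<mu> \<le> tail s 1 + A\<close>, where \<open>tail s r\<close> is the integral of
  \<open>\<bar>z\<bar> powr -(N + 2s)\<close> over \<open>\<bar>z\<bar> \<ge> r\<close> and \<open>A\<close> does not depend on \<open>s\<close>. Since every dyadic shell of radius
  at most 1 carries kernel mass at least \<open>c > 0\<close>, \<open>tail s r\<close> exceeds \<open>\<mu> + 1\<close> for a small radius \<open>r\<close> that is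
  uniform in \<open>s\<close>. Replacing the interactions at distance at least \<open>r\<close> by the zero-order term
  \<open>tail s r * \<phi>\<close> then yields a comparison principle with constants independent of \<open>s\<close>.
  Constant barriers give a uniform sup bound. If \<open>\<phi> \<le> a\<close> near the boundary, then a barrier rising
  from \<open>(1 - \<gamma>) a\<close> to \<open>a\<close> over the distance \<open>2 ^ - (m + 3)\<close> improves this to \<open>\<phi> \<le> (1 - \<gamma> / 2) a\<close> in a
  thinner layer: on each dyadic scale the exterior ball contributes a fixed share of the kernel
  mass, and the number of scales grows with \<open>m\<close>. As \<open>\<gamma>\<close> depends only on \<open>N\<close>, iteration gives
  the decay.

  The eigenvalue \<open>\<lambda>\<^sub>k\<close> is a \<open>LEAST\<close>, meaningless unless attained; its existence comes from successive
  minimisation of the Rayleigh quotient, using compactness of the energy space in \<open>L\<^sup>2\<close>.\<close>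

section \<open>Variational characterisation of eigenvalues\<close>

text \<open>The difficulty is uniformity as s tends to 0. There \<open>frac_const\<close> vanishes
  like s while \<open>tail s 1\<close> grows like 1/s, so \<mu> itself has no bound independent of
  s; only the difference between \<open>tail s r\<close> and \<mu> can be controlled. Hence the
  estimate of \<mu> has to carry \<open>tail s 1\<close> with coefficient exactly 1, and in the
  barrier estimate gain and loss are measured by the same sum of dyadic powers before anything is
  said about the size of that sum. The restriction s <= 1/4 enters through the integral of the
  distance times the kernel near the singularity, whose dyadic ratio
  \<open>2 powr - (1 - 2 * s)\<close> then stays away from 1, so that Lipschitz barriers lose a
  bounded amount. The barrier keeps a positive value \<open>b\<close> outside \<Omega>, where \<phi>
  is 0: this gap, multiplied by the exterior kernel mass, is the gain that drives the decay.
  Eigenfunctions are determined only up to null sets, so comparison is done by testing with a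
  truncation and not at a maximum point.\<close>

lemma homogeneous_system_nontrivial:
  fixes a :: "nat \<Rightarrow> 'i \<Rightarrow> real"
  assumes "finite I" "m < card I"
  shows "\<exists>c. (\<exists>i\<in>I. c i \<noteq> 0) \<and> (\<forall>j<m. (\<Sum>i\<in>I. c i * a j i) = 0)"
  using assms
proof (induction m arbitrary: I a)
  case 0
  then obtain i where "i \<in> I" by fastforce
  then show ?case by (intro exI[of _ "\<lambda>_. 1"]) auto
next
  case (Suc m)
  show ?case
  proof (cases "\<forall>i\<in>I. a m i = 0")
    case True
    obtain c where "\<exists>i\<in>I. c i \<noteq> 0" "\<forall>j<m. (\<Sum>i\<in>I. c i * a j i) = 0"
      using Suc.IH[of I a] Suc.prems by auto
    with True show ?thesis by (intro exI[of _ c]) (auto simp: less_Suc_eq)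
  next
    case False
    then obtain p where p: "p \<in> I" "a m p \<noteq> 0" by auto
    define J where "J = I - {p}"
    have J: "finite J" "m < card J" "p \<notin> J" "I = insert p J"
      using Suc.prems p by (auto simp: J_def)
    obtain c where c: "\<exists>i\<in>J. c i \<noteq> 0"
      "\<forall>j<m. (\<Sum>i\<in>J. c i * (a j i - a j p * a m i / a m p)) = 0"
      using Suc.IH[OF J(1,2), of "\<lambda>j i. a j i - a j p * a m i / a m p"] by auto
    \<comment> \<open>Equation \<open>m\<close> solved for the pivot unknown \<open>p\<close>; the
      reduced system arises by substituting this value into the other equations.\<close>
    define t where "t = - (\<Sum>i\<in>J. c i * a m i) / a m p"
    have e: "(\<Sum>i\<in>I. (c(p := t)) i * a j i) = t * a j p + (\<Sum>i\<in>J. c i * a j i)" for j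
    proof -
      have "(\<Sum>i\<in>J. (c(p := t)) i * a j i) = (\<Sum>i\<in>J. c i * a j i)" using J by (intro sum.cong) auto
      then show ?thesis using J by simp
    qed
    have "(\<Sum>i\<in>I. (c(p := t)) i * a j i) = 0" if "j < Suc m" for j
    proof (cases "j = m")
      case True
      then show ?thesis using p e[of j] by (simp add: t_def)
    next
      case False
      then have "0 = (\<Sum>i\<in>J. c i * (a j i - a j p * a m i / a m p))" using c that by auto
      also have "\<dots> = (\<Sum>i\<in>J. c i * a j i) - (\<Sum>i\<in>J. c i * a m i) / a m p * a j p"
        by (simp add: right_diff_distrib sum_subtractf sum_divide_distrib sum_distrib_left mult_ac)
      finally show ?thesis using e[of j] by (simp add: t_def)
    qed
    moreover have "\<exists>i\<in>I. (c(p := t)) i \<noteq> 0" using c(1) J by (metis fun_upd_other insertCI)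
    ultimately show ?thesis by (intro exI[of _ "c(p := t)"]) blast
  qed
qed

text \<open>\<open>H\<close> is a set of plain functions that are not identified up to null sets.
  Hence even the L2 product is only semidefinite on it, and nontriviality has to be phrased through
  the value of the form.\<close>

locale psd_form =
  fixes H :: "('b \<Rightarrow> real) set" and B :: "('b \<Rightarrow> real) \<Rightarrow> ('b \<Rightarrow> real) \<Rightarrow> real"
  assumes zero_mem: "(\<lambda>x. 0) \<in> H"
    and add_mem: "\<And>u v. u \<in> H \<Longrightarrow> v \<in> H \<Longrightarrow> (\<lambda>x. u x + v x) \<in> H"
    and scale_mem: "\<And>a u. u \<in> H \<Longrightarrow> (\<lambda>x. a * u x) \<in> H"
    and form_add: "\<And>u v w. u \<in> H \<Longrightarrow> v \<in> H \<Longrightarrow> w \<in> H \<Longrightarrow> B (\<lambda>x. u x + v x) w = B u w + B v w"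
    and form_scale: "\<And>a u w. u \<in> H \<Longrightarrow> w \<in> H \<Longrightarrow> B (\<lambda>x. a * u x) w = a * B u w"
    and form_sym: "\<And>u v. u \<in> H \<Longrightarrow> v \<in> H \<Longrightarrow> B u v = B v u"
    and form_nonneg: "\<And>u. u \<in> H \<Longrightarrow> 0 \<le> B u u"
begin

lemma diff_mem: "u \<in> H \<Longrightarrow> v \<in> H \<Longrightarrow> (\<lambda>x. u x - v x) \<in> H"
  using add_mem[OF _ scale_mem[of v "-1"], of u] by simp

lemma form_diff: "u \<in> H \<Longrightarrow> v \<in> H \<Longrightarrow> w \<in> H \<Longrightarrow> B (\<lambda>x. u x - v x) w = B u w - B v w"
  using form_add[OF _ scale_mem[of v "-1"], of u w] form_scale[of v w "-1"] by simp

lemma form_zero: "w \<in> H \<Longrightarrow> B (\<lambda>x. 0) w = 0"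
  using form_scale[of "\<lambda>x. 0" w 0] zero_mem by simp

lemma sum_mem: "finite I \<Longrightarrow> (\<And>i. i \<in> I \<Longrightarrow> f i \<in> H) \<Longrightarrow> (\<lambda>x. \<Sum>i\<in>I. c i * f i x) \<in> H"
  by (induction I rule: finite_induct) (auto intro!: zero_mem add_mem scale_mem)

lemma form_sum:
  "finite I \<Longrightarrow> (\<And>i. i \<in> I \<Longrightarrow> f i \<in> H) \<Longrightarrow> w \<in> H \<Longrightarrow>
    B (\<lambda>x. \<Sum>i\<in>I. c i * f i x) w = (\<Sum>i\<in>I. c i * B (f i) w)"
  by (induction I rule: finite_induct) (auto simp: form_zero form_add form_scale scale_mem sum_mem)

lemma form_sum_sum:
  assumes "finite I" "\<And>i. i \<in> I \<Longrightarrow> f i \<in> H"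
  shows "B (\<lambda>x. \<Sum>i\<in>I. c i * f i x) (\<lambda>x. \<Sum>i\<in>I. d i * f i x) = (\<Sum>i\<in>I. \<Sum>j\<in>I. c i * d j * B (f i) (f j))"
proof -
  have "B (f i) (\<lambda>x. \<Sum>i\<in>I. d i * f i x) = (\<Sum>j\<in>I. d j * B (f i) (f j))" if "i \<in> I" for i
    using assms that by (subst form_sym) (auto intro!: sum_mem sum.cong simp: form_sum form_sym[of _ "f i"])
  then show ?thesis
    using assms by (simp add: form_sum sum_mem sum_distrib_left mult.assoc)
qed

lemma form_diff_diff:
  assumes "u \<in> H" "v \<in> H"
  shows "B (\<lambda>x. u x - v x) (\<lambda>x. u x - v x) = B u u - 2 * B u v + B v v"
  using assms form_diff[of u v "\<lambda>x. u x - v x"] diff_mem[of u v]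
    form_diff[of u v u] form_diff[of u v v] form_sym[of u "\<lambda>x. u x - v x"]
    form_sym[of v "\<lambda>x. u x - v x"] form_sym[of u v] by simp

lemma form_Cauchy_Schwarz:
  assumes u: "u \<in> H" and v: "v \<in> H"
  shows "(B u v)\<^sup>2 \<le> B u u * B v v"
proof -
  have q: "0 \<le> B u u - 2 * t * B u v + t\<^sup>2 * B v v" for t
    using form_nonneg[OF diff_mem[OF u scale_mem[OF v, of t]]]
      form_diff_diff[OF u scale_mem[OF v, of t]] form_scale[OF v u, of t]
      form_scale[OF v scale_mem[OF v, of t], of t] form_scale[OF v v, of t]
      form_sym[OF u v] form_sym[OF u scale_mem[OF v, of t]] form_sym[OF v scale_mem[OF v, of t]]
    by (simp add: power2_eq_square)
  show ?thesis
  proof (cases "B v v = 0")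
    case True
    have "B u v = 0"
    proof (rule ccontr)
      assume "B u v \<noteq> 0"
      \<comment> \<open>With \<open>B v v = 0\<close> the expression in \<open>q\<close> is affine
        in \<open>t\<close>; this \<open>t\<close> gives it the value -1.\<close>
      then show False using q[of "(B u u + 1) / (2 * B u v)"] True by (simp add: field_simps)
    qed
    then show ?thesis using True by simp
  next
    case False
    then have "B v v > 0" using form_nonneg[OF v] by simp
    moreover have "0 \<le> (B u u - 2 * (B u v / B v v) * B u v + (B u v / B v v)\<^sup>2 * B v v) * B v v"
      using q[of "B u v / B v v"] calculation by simp
    ultimately show ?thesis by (simp add: field_simps power2_eq_square)
  qed
qed

lemma form_zero_imp: "u \<in> H \<Longrightarrow> v \<in> H \<Longrightarrow> B u u = 0 \<Longrightarrow> B u v = 0"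
  using form_Cauchy_Schwarz[of u v] by simp

end

text \<open>\<open>G\<close> stands for the L2 product and \<open>E\<close> for the energy. The
  assumption \<open>compact\<close> joins Rellich compactness to lower semicontinuity of
  \<open>E\<close>, as the direct method consumes them; convergence of the energies is what a
  minimising sequence supplies.\<close>

locale compact_form_pair = G: psd_form H G + E: psd_form H E
  for H :: "('b \<Rightarrow> real) set" and G E +
  assumes compact:
    "\<And>u b e. (\<And>n. u n \<in> H) \<Longrightarrow> (\<And>n. G (u n) (u n) \<le> b) \<Longrightarrow> (\<lambda>n. E (u n) (u n)) \<longlonglongrightarrow> e \<Longrightarrow>
      \<exists>r w. strict_mono (r :: nat \<Rightarrow> nat) \<and> w \<in> H \<and>
        (\<lambda>n. G (\<lambda>x. u (r n) x - w x) (\<lambda>x. u (r n) x - w x)) \<longlonglongrightarrow> 0 \<and> E w w \<le> e"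
begin

definition eigen :: "real \<Rightarrow> ('b \<Rightarrow> real) \<Rightarrow> bool" where
  "eigen lam u \<longleftrightarrow> u \<in> H \<and> G u u \<noteq> 0 \<and> (\<forall>v\<in>H. E u v = lam * G u v)"

definition indep :: "('b \<Rightarrow> real) set \<Rightarrow> bool" where
  "indep F \<longleftrightarrow> finite F \<and>
     (\<forall>c. G (\<lambda>x. \<Sum>f\<in>F. c f * f x) (\<lambda>x. \<Sum>f\<in>F. c f * f x) = 0 \<longrightarrow> (\<forall>f\<in>F. c f = 0))"

text \<open>The predicate under \<open>LEAST\<close> in \<open>frac_kth_eigenvalue\<close>, with
  functions vanishing almost everywhere replaced by null vectors of \<open>G\<close>.\<close>

definition kth :: "nat \<Rightarrow> real \<Rightarrow> bool" where
  "kth k lam \<longleftrightarrow> (\<exists>u. eigen lam u) \<and>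
     (\<exists>F. card F = k \<and> indep F \<and> (\<forall>f\<in>F. \<exists>\<mu>\<le>lam. eigen \<mu> f))"

definition perp :: "nat \<Rightarrow> (nat \<Rightarrow> 'b \<Rightarrow> real) \<Rightarrow> ('b \<Rightarrow> real) set" where
  "perp j f = {u\<in>H. \<forall>i<j. G u (f i) = 0}"

lemma minimiser_exists:
  assumes f: "\<And>i. i < j \<Longrightarrow> f i \<in> H" and u0: "u0 \<in> perp j f" "G u0 u0 \<noteq> 0"
  shows "\<exists>w \<nu>. w \<in> perp j f \<and> G w w = 1 \<and> E w w = \<nu> \<and> (\<forall>u\<in>perp j f. E u u \<ge> \<nu> * G u u)"
proof -
  define S where "S = {E u u | u. u \<in> perp j f \<and> G u u = 1}"
  have normalise: "E u u / G u u \<in> S" if u: "u \<in> perp j f" "G u u \<noteq> 0" for u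
  proof -
    have uH: "u \<in> H" and p: "G u u > 0" using u G.form_nonneg[of u] by (auto simp: perp_def)
    let ?a = "1 / sqrt (G u u)" let ?v = "\<lambda>x. ?a * u x"
    have vH: "?v \<in> H" using uH by (rule G.scale_mem)
    have sc: "?a * ?a = 1 / G u u" using p by simp
    have "G ?v ?v = ?a * ?a * G u u" 
      by (subst G.form_scale[OF uH vH], subst G.form_sym[OF uH vH], subst G.form_scale[OF uH uH]) simp
    moreover have "E ?v ?v = ?a * ?a * E u u"
      by (subst E.form_scale[OF uH vH], subst E.form_sym[OF uH vH], subst E.form_scale[OF uH uH]) simp
    moreover have "?v \<in> perp j f" using u vH f uH G.form_scale[OF uH, of _ ?a] by (simp add: perp_def)
    ultimately show ?thesis unfolding S_def using p sc by (intro CollectI exI[of _ ?v]) auto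
  qed
  have bdd: "bdd_below S" unfolding S_def by (rule bdd_belowI[of _ 0]) (auto simp: perp_def E.form_nonneg)
  have ne: "S \<noteq> {}" using normalise[OF u0] by auto
  define \<nu> where "\<nu> = Inf S"
  have "\<exists>u. u \<in> perp j f \<and> G u u = 1 \<and> E u u < \<nu> + 1 / Suc n" for n
  proof -
    have "Inf S < \<nu> + 1 / Suc n" by (simp add: \<nu>_def)
    then obtain x where "x \<in> S" "x < \<nu> + 1 / Suc n" using cInf_lessD[OF ne] by blast
    then show ?thesis by (auto simp: S_def)
  qed
  then obtain u where u: "\<And>n. u n \<in> perp j f" "\<And>n. G (u n) (u n) = 1" "\<And>n. E (u n) (u n) < \<nu> + 1 / Suc n"
    by metis
  have uH: "u n \<in> H" for n using u(1)[of n] by (simp add: perp_def)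
  have lower: "\<nu> \<le> E (u n) (u n)" for n
    unfolding \<nu>_def using u by (intro cInf_lower[OF _ bdd]) (auto simp: S_def)
  have lim: "(\<lambda>n. E (u n) (u n)) \<longlonglongrightarrow> \<nu>"
  proof (rule tendsto_sandwich[of "\<lambda>n. \<nu>" _ _ "\<lambda>n. \<nu> + 1 / real (Suc n)"])
    show "(\<lambda>n. \<nu> + 1 / real (Suc n)) \<longlonglongrightarrow> \<nu>"
      using tendsto_add[OF tendsto_const LIMSEQ_Suc[OF lim_1_over_n], of \<nu>] by simp
    show "\<forall>\<^sub>F n in sequentially. E (u n) (u n) \<le> \<nu> + 1 / real (Suc n)"
      using u(3) by (intro always_eventually allI less_imp_le)
  qed (use lower in auto)
  from compact[of u 1, OF uH _ lim] u(2) obtain r w where w: "strict_mono (r :: nat \<Rightarrow> nat)" "w \<in> H"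
    "(\<lambda>n. G (\<lambda>x. u (r n) x - w x) (\<lambda>x. u (r n) x - w x)) \<longlonglongrightarrow> 0" "E w w \<le> \<nu>" by auto
  \<comment> \<open>Convergence in the seminorm of \<open>G\<close> passes to every functional
    \<open>G _ g\<close> by Cauchy-Schwarz, so \<open>w\<close> inherits the orthogonality to the
    \<open>f i\<close>.\<close>
  have to0: "(\<lambda>n. G (\<lambda>x. u (r n) x - w x) g) \<longlonglongrightarrow> 0" if g: "g \<in> H" for g
  proof -
    have "(\<lambda>n. (G (\<lambda>x. u (r n) x - w x) g)\<^sup>2) \<longlonglongrightarrow> 0"
    proof (rule tendsto_sandwich[OF _ _ tendsto_const])
      show "(\<lambda>n. G (\<lambda>x. u (r n) x - w x) (\<lambda>x. u (r n) x - w x) * G g g) \<longlonglongrightarrow> 0"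
        using tendsto_mult_right[OF w(3), of "G g g"] by simp
    qed (use g w uH in \<open>auto intro!: always_eventually G.form_Cauchy_Schwarz G.diff_mem\<close>)
    then have "(\<lambda>n. sqrt ((G (\<lambda>x. u (r n) x - w x) g)\<^sup>2)) \<longlonglongrightarrow> sqrt 0" by (intro tendsto_real_sqrt)
    then show ?thesis by (simp add: tendsto_rabs_zero_iff)
  qed
  \<comment> \<open>The expansion of \<open>G (u - w) (u - w)\<close>, with \<open>G u w\<close>
    written as \<open>G (u - w) w + G w w\<close> so that \<open>to0\<close> applies; comparing
    limits leaves \<open>1 - G w w = 0\<close>.\<close>
  have "(\<lambda>n. 1 - 2 * (G (\<lambda>x. u (r n) x - w x) w + G w w) + G w w) \<longlonglongrightarrow> 1 - 2 * (0 + G w w) + G w w"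
    by (intro tendsto_intros to0 w)
  moreover have "1 - 2 * (G (\<lambda>x. u (r n) x - w x) w + G w w) + G w w
      = G (\<lambda>x. u (r n) x - w x) (\<lambda>x. u (r n) x - w x)" for n
    using G.form_diff_diff[OF uH w(2)] G.form_diff[OF uH w(2) w(2)] u(2) by simp
  ultimately have "1 - 2 * (0 + G w w) + G w w = 0"
    using LIMSEQ_unique[OF w(3), of "1 - 2 * (0 + G w w) + G w w"] by simp
  then have Gw: "G w w = 1" by simp
  have "G w (f i) = 0" if "i < j" for i
  proof -
    have "(\<lambda>n. - G w (f i)) \<longlonglongrightarrow> 0"
      using to0[OF f[OF that]] G.form_diff[OF uH w(2) f[OF that]] u(1) that by (simp add: perp_def)
    then show ?thesis by (simp add: LIMSEQ_const_iff)
  qed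
  then have wp: "w \<in> perp j f" using w by (simp add: perp_def)
  have "E w w \<ge> \<nu>" unfolding \<nu>_def using wp Gw by (intro cInf_lower[OF _ bdd]) (auto simp: S_def)
  moreover have "E v v \<ge> \<nu> * G v v" if v: "v \<in> perp j f" for v
  proof (cases "G v v = 0")
    case True
    then show ?thesis using v by (simp add: perp_def E.form_nonneg)
  next
    case False
    then have "G v v > 0" using v G.form_nonneg[of v] by (auto simp: perp_def)
    moreover have "\<nu> \<le> E v v / G v v" unfolding \<nu>_def by (rule cInf_lower[OF normalise[OF v False] bdd])
    ultimately show ?thesis by (simp add: field_simps)
  qed
  ultimately show ?thesis using wp Gw w(4) by (intro exI[of _ w] exI[of _ \<nu>]) auto
qed

text \<open>On \<open>perp j f\<close> the form \<open>E - \<nu> G\<close> is semidefinite and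
  vanishes at \<open>w\<close>, so by Cauchy-Schwarz \<open>w\<close> lies in its radical: this is
  the Euler-Lagrange equation without a derivative. In the directions \<open>f i\<close> both forms
  vanish against \<open>w\<close>, because the \<open>f i\<close> are eigenfunctions orthogonal to
  \<open>w\<close>. By projection the two kinds of directions exhaust \<open>H\<close>.\<close>

lemma minimiser_eigen:
  assumes f: "\<And>i. i < j \<Longrightarrow> eigen (\<nu>s i) (f i)" and orth: "\<And>i l. i < j \<Longrightarrow> l < j \<Longrightarrow> G (f i) (f l) = of_bool (i = l)"
    and w: "w \<in> perp j f" "G w w = 1" "E w w = \<nu>"
    and min: "\<And>u. u \<in> perp j f \<Longrightarrow> E u u \<ge> \<nu> * G u u"
  shows "eigen \<nu> w"
proof -
  have fH: "f i \<in> H" if "i < j" for i using f[OF that] by (simp add: eigen_def)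
  interpret Q: psd_form "perp j f" "\<lambda>u v. E u v - \<nu> * G u v"
  proof
    show "(\<lambda>x. 0) \<in> perp j f" by (simp add: perp_def G.zero_mem G.form_zero fH)
    show "0 \<le> E u u - \<nu> * G u u" if "u \<in> perp j f" for u using min[OF that] by simp
    fix u v assume uv: "u \<in> perp j f" "v \<in> perp j f"
    then have H: "u \<in> H" "v \<in> H" by (auto simp: perp_def)
    show "(\<lambda>x. u x + v x) \<in> perp j f" using uv H by (simp add: perp_def G.add_mem G.form_add fH)
    show "E u v - \<nu> * G u v = E v u - \<nu> * G v u"
      using E.form_sym[OF H] G.form_sym[OF H] by simp
    show "(\<lambda>x. a * u x) \<in> perp j f" for a
      using uv H by (simp add: perp_def G.scale_mem G.form_scale fH)
    show "E (\<lambda>x. a * u x) v - \<nu> * G (\<lambda>x. a * u x) v = a * (E u v - \<nu> * G u v)" for a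
      using H by (simp add: E.form_scale G.form_scale right_diff_distrib)
    show "E (\<lambda>x. u x + v x) w - \<nu> * G (\<lambda>x. u x + v x) w = E u w - \<nu> * G u w + (E v w - \<nu> * G v w)"
      if "w \<in> perp j f" for w
      using H that by (simp add: perp_def E.form_add G.form_add distrib_left)
  qed
  have wH: "w \<in> H" using w by (simp add: perp_def)
  have perp_case: "E w v = \<nu> * G w v" if "v \<in> perp j f" for v
    using Q.form_zero_imp[OF w(1) that] w by simp
  have Ewf: "E w (f i) = 0" if "i < j" for i
    using f[OF that] wH w(1) that fH[OF that] E.form_sym[of w "f i"] G.form_sym[of w "f i"] by (simp add: eigen_def perp_def)
  have "E w v = \<nu> * G w v" if v: "v \<in> H" for v
  proof -
    define p where "p = (\<lambda>x. \<Sum>i\<in>{..<j}. G v (f i) * f i x)"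
    have pH: "p \<in> H" unfolding p_def by (rule G.sum_mem) (auto simp: fH)
    have "G p (f l) = G v (f l)" if "l < j" for l
    proof -
      have "G p (f l) = (\<Sum>i\<in>{..<j}. G v (f i) * of_bool (i = l))"
        unfolding p_def using that fH orth by (subst G.form_sum) auto
      also have "\<dots> = G v (f l)" using that by (simp add: of_bool_def if_distrib sum.delta cong: if_cong)
      finally show ?thesis .
    qed
    then have dp: "(\<lambda>x. v x - p x) \<in> perp j f"
      using v pH fH by (simp add: perp_def G.diff_mem G.form_diff)
    have "E (f i) w = 0" "G (f i) w = 0" if "i < j" for i
      using E.form_sym[OF wH fH[OF that]] G.form_sym[OF wH fH[OF that]] Ewf[OF that] w(1) that
      by (simp_all add: perp_def)
    then have "E p w = 0" "G p w = 0"
      unfolding p_def using wH fH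
      by (subst E.form_sum, auto, subst G.form_sum, auto)
    then show ?thesis
      using perp_case[OF dp] E.form_sym[OF wH G.diff_mem[OF v pH]] G.form_sym[OF wH G.diff_mem[OF v pH]]
        E.form_diff[OF v pH wH] G.form_diff[OF v pH wH] E.form_sym[OF v wH] G.form_sym[OF v wH] by simp
  qed
  then show ?thesis using wH w by (simp add: eigen_def)
qed

text \<open>Members of \<open>F\<close> may fail to be orthogonal within one eigenspace, but for
  distinct eigenvalues they are orthogonal. Hence the factor \<open>lam - \<mu> f\<close> in front
  of \<open>G f g\<close> may be split into two square roots, one for \<open>f\<close> and one for
  \<open>g\<close>, and \<open>lam * G - E\<close> on the span becomes the square
  \<open>G h h\<close>.\<close>

lemma eigen_span_le:
  assumes "finite F" "\<And>f. f \<in> F \<Longrightarrow> \<exists>\<mu>\<le>lam. eigen \<mu> f"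
  shows "E (\<lambda>x. \<Sum>f\<in>F. c f * f x) (\<lambda>x. \<Sum>f\<in>F. c f * f x)
    \<le> lam * G (\<lambda>x. \<Sum>f\<in>F. c f * f x) (\<lambda>x. \<Sum>f\<in>F. c f * f x)"
proof -
  obtain \<mu> where \<mu>: "\<And>f. f \<in> F \<Longrightarrow> \<mu> f \<le> lam \<and> eigen (\<mu> f) f" using assms(2) by metis
  have FH: "f \<in> H" if "f \<in> F" for f using \<mu>[OF that] by (simp add: eigen_def)
  define h where "h = (\<lambda>x. \<Sum>f\<in>F. (sqrt (lam - \<mu> f) * c f) * f x)"
  have term_eq: "c f * c g * (lam * G f g - E f g) = (sqrt (lam - \<mu> f) * c f) * (sqrt (lam - \<mu> g) * c g) * G f g"
    if fg: "f \<in> F" "g \<in> F" for f g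
  proof -
    have "E f g = \<mu> f * G f g" "E g f = \<mu> g * G g f" using \<mu> fg FH by (auto simp: eigen_def)
    moreover have "G f g = G g f" "E f g = E g f" using fg FH by (auto intro: G.form_sym E.form_sym)
    ultimately have "G f g = 0 \<or> \<mu> f = \<mu> g" by auto
    moreover have "sqrt (lam - \<mu> f) * sqrt (lam - \<mu> f) = lam - \<mu> f" using \<mu>[OF fg(1)] by simp
    ultimately show ?thesis using \<open>E f g = \<mu> f * G f g\<close> by (auto simp: algebra_simps)
  qed
  have "lam * G (\<lambda>x. \<Sum>f\<in>F. c f * f x) (\<lambda>x. \<Sum>f\<in>F. c f * f x) - E (\<lambda>x. \<Sum>f\<in>F. c f * f x) (\<lambda>x. \<Sum>f\<in>F. c f * f x)
     = (\<Sum>f\<in>F. \<Sum>g\<in>F. c f * c g * (lam * G f g - E f g))"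
    using G.form_sum_sum[of F "\<lambda>f. f" c c] E.form_sum_sum[of F "\<lambda>f. f" c c] assms(1) FH
    by (simp add: sum_distrib_left sum_subtractf algebra_simps)
  also have "\<dots> = G h h"
    unfolding h_def using G.form_sum_sum[of F "\<lambda>f. f" "\<lambda>f. sqrt (lam - \<mu> f) * c f" "\<lambda>f. sqrt (lam - \<mu> f) * c f"] assms(1) FH
    by (simp add: term_eq cong: sum.cong)
  also have "\<dots> \<ge> 0" unfolding h_def by (rule G.form_nonneg, rule G.sum_mem) (use assms FH in auto)
  finally show ?thesis by simp
qed

lemma perp_combination:
  assumes "finite I" "j < card I" "\<And>i. i \<in> I \<Longrightarrow> g i \<in> H" "\<And>i. i < j \<Longrightarrow> f i \<in> H"
  shows "\<exists>c. (\<exists>i\<in>I. c i \<noteq> 0) \<and> (\<lambda>x. \<Sum>i\<in>I. c i * g i x) \<in> perp j f"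
proof -
  obtain c where "\<exists>i\<in>I. c i \<noteq> 0" "\<forall>l<j. (\<Sum>i\<in>I. c i * G (g i) (f l)) = 0"
    using homogeneous_system_nontrivial[OF assms(1,2), of "\<lambda>l i. G (g i) (f l)"] by blast
  then show ?thesis using assms by (intro exI[of _ c]) (auto simp: perp_def G.sum_mem G.form_sum)
qed

text \<open>Successive minimisation yields orthonormal eigenfunctions with nondecreasing values
  \<open>\<nu> i\<close>. That \<open>\<nu> (k - 1)\<close> is the least number with
  \<open>kth k\<close>, and that it is at most \<open>X\<close>, both follow from one dimension
  count: a k-dimensional span contains a nonzero vector orthogonal to the first k - 1 minimisers,
  and its Rayleigh quotient is at least \<open>\<nu> (k - 1)\<close>.\<close>

theorem kth_eigenvalue_le:
  assumes k: "k \<ge> 1" and g: "\<And>i. i < k \<Longrightarrow> g i \<in> H"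
    and g_bound: "\<And>c. E (\<lambda>x. \<Sum>i<k. c i * g i x) (\<lambda>x. \<Sum>i<k. c i * g i x)
       \<le> X * G (\<lambda>x. \<Sum>i<k. c i * g i x) (\<lambda>x. \<Sum>i<k. c i * g i x)"
    and g_indep: "\<And>c. \<exists>i<k. c i \<noteq> 0 \<Longrightarrow> G (\<lambda>x. \<Sum>i<k. c i * g i x) (\<lambda>x. \<Sum>i<k. c i * g i x) \<noteq> 0"
  shows "(LEAST lam. kth k lam) \<le> X"
proof -
  define good where "good j f \<nu> \<longleftrightarrow> (\<forall>i<j. eigen (\<nu> i) (f i) \<and> f i \<in> perp i f \<and> G (f i) (f i) = 1 \<and>
      (\<forall>u\<in>perp i f. E u u \<ge> \<nu> i * G u u))" for j and f :: "nat \<Rightarrow> 'b \<Rightarrow> real" and \<nu> :: "nat \<Rightarrow> real"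
  have orth: "G (f i) (f l) = of_bool (i = l)" if "good j f \<nu>" "i < j" "l < j" for j f \<nu> i l
    using that G.form_sym[of "f i" "f l"]
    by (cases i l rule: linorder_cases) (auto simp: good_def perp_def)
  have ex: "\<exists>f \<nu>. good j f \<nu>" if "j \<le> k" for j
    using that
  proof (induction j)
    case 0
    then show ?case by (simp add: good_def)
  next
    case (Suc j)
    then obtain f \<nu> where f: "good j f \<nu>" by auto
    have fH: "f i \<in> H" if "i < j" for i using f that by (simp add: good_def eigen_def)
    \<comment> \<open>The span of the \<open>g i\<close> has more dimensions than there are
      constraints, which provides the competitor that \<open>minimiser_exists\<close>
      requires.\<close>
    obtain c where "\<exists>i<k. c i \<noteq> 0" and u0: "(\<lambda>x. \<Sum>i<k. c i * g i x) \<in> perp j f"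
      using perp_combination[of "{..<k}" j g f] Suc.prems g fH by auto
    then have "G (\<lambda>x. \<Sum>i<k. c i * g i x) (\<lambda>x. \<Sum>i<k. c i * g i x) \<noteq> 0" using g_indep by simp
    from minimiser_exists[of j f, OF fH u0 this] obtain w \<nu>' where
      w: "w \<in> perp j f" "G w w = 1" "E w w = \<nu>'" "\<forall>u\<in>perp j f. E u u \<ge> \<nu>' * G u u" by blast
    have "eigen \<nu>' w"
      using minimiser_eigen[of j \<nu> f w \<nu>'] f orth[OF f] w by (simp add: good_def)
    moreover have "perp i (f(j := w)) = perp i f" if "i \<le> j" for i using that by (auto simp: perp_def)
    ultimately have "good (Suc j) (f(j := w)) (\<nu>(j := \<nu>'))"
      using f w by (auto simp: good_def less_Suc_eq)
    then show ?case by blast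
  qed
  obtain f \<nu> where f: "good k f \<nu>" using ex[of k] by auto
  have fH: "f i \<in> H" if "i < k" for i using f that by (simp add: good_def eigen_def)
  have E\<nu>: "E (f i) (f i) = \<nu> i" if "i < k" for i using f that fH[OF that] by (simp add: good_def eigen_def)
  define K where "K = k - 1"
  have K: "K < k" "k = Suc K" using k by (auto simp: K_def)
  have le: "\<nu> i \<le> \<nu> K" if "i < k" for i
  proof -
    \<comment> \<open>\<open>f K\<close> competes in the i-th minimisation, whose constraints are
      among those of the K-th.\<close>
    have "f K \<in> perp i f" using f K that by (auto simp: good_def perp_def)
    then have "\<nu> i * G (f K) (f K) \<le> E (f K) (f K)" using f that by (auto simp: good_def)
    then show ?thesis using E\<nu> K f by (simp add: good_def)
  qed
  have inj: "inj_on f {..<k}"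
  proof (rule inj_onI)
    fix i l assume "i \<in> {..<k}" "l \<in> {..<k}" "f i = f l"
    then show "i = l" using orth[OF f, of i l] orth[OF f, of l l] by (auto split: if_splits)
  qed
  have "kth k (\<nu> K)"
    unfolding kth_def
  proof (intro conjI exI[of _ "f ` {..<k}"] exI[of _ "f K"])
    show "eigen (\<nu> K) (f K)" using f K by (simp add: good_def)
    show "card (f ` {..<k}) = k" using inj by (simp add: card_image)
    show "\<forall>h\<in>f ` {..<k}. \<exists>\<mu>\<le>\<nu> K. eigen \<mu> h" using f le by (auto simp: good_def)
    show "indep (f ` {..<k})"
      unfolding indep_def
    proof (intro conjI allI impI)
      fix c
      let ?u = "\<lambda>x. \<Sum>h\<in>f ` {..<k}. c h * h x"
      have u: "?u = (\<lambda>x. \<Sum>i<k. c (f i) * f i x)" using inj by (simp add: sum.reindex)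
      have "G ?u ?u = (\<Sum>i<k. \<Sum>l<k. c (f i) * c (f l) * of_bool (i = l))"
        unfolding u using fH orth[OF f] by (subst G.form_sum_sum) auto
      also have "\<dots> = (\<Sum>i<k. (c (f i))\<^sup>2)"
        by (intro sum.cong refl) (simp add: of_bool_def if_distrib sum.delta power2_eq_square cong: if_cong)
      finally have "G ?u ?u = (\<Sum>i<k. (c (f i))\<^sup>2)" .
      moreover assume "G ?u ?u = 0"
      ultimately show "\<forall>h\<in>f ` {..<k}. c h = 0" by (simp add: sum_nonneg_eq_0_iff)
    qed simp
  qed
  moreover have "\<nu> K \<le> lam" if kl: "kth k lam" for lam
  proof -
    obtain F where F: "card F = k" "indep F" "\<And>h. h \<in> F \<Longrightarrow> \<exists>\<mu>\<le>lam. eigen \<mu> h" using kl by (auto simp: kth_def)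
    have FH: "h \<in> H" if "h \<in> F" for h using F(3)[OF that] by (auto simp: eigen_def)
    have fin: "finite F" using F by (simp add: indep_def)
    obtain c where c: "\<exists>h\<in>F. c h \<noteq> 0" "(\<lambda>x. \<Sum>h\<in>F. c h * h x) \<in> perp K f" (is "?u \<in> _")
      using perp_combination[of F K "\<lambda>h. h" f] fin F FH fH K by auto
    have uH: "?u \<in> H" using c by (simp add: perp_def)
    have "G ?u ?u \<noteq> 0" using c F by (auto simp: indep_def)
    then have "G ?u ?u > 0" using G.form_nonneg[OF uH] by simp
    moreover have "\<nu> K * G ?u ?u \<le> E ?u ?u" using f K c by (simp add: good_def)
    ultimately show ?thesis using eigen_span_le[OF fin F(3), of c] by (smt (verit) mult_le_cancel_right)
  qed
  ultimately have "(LEAST lam. kth k lam) = \<nu> K" by (intro Least_equality)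
  moreover have "\<nu> K \<le> X"
  proof -
    obtain c where c: "\<exists>i<k. c i \<noteq> 0" and u0: "(\<lambda>x. \<Sum>i<k. c i * g i x) \<in> perp K f" (is "?u \<in> _")
      using perp_combination[of "{..<k}" K g f] K g fH by auto
    have uH: "?u \<in> H" using u0 by (simp add: perp_def)
    have "G ?u ?u > 0" using G.form_nonneg[OF uH] g_indep[of c] c by (auto simp: less_le)
    moreover have "\<nu> K * G ?u ?u \<le> E ?u ?u" using f K u0 by (simp add: good_def)
    ultimately show ?thesis using g_bound[of c] by (smt (verit) mult_le_cancel_right)
  qed
  ultimately show ?thesis by simp
qed

end

section \<open>The kernel\<close>

text \<open>At the origin \<open>0 powr _\<close> and division by 0 give the value 0, so the
  diagonal contributes nothing; lower bounds therefore require \<open>0 < norm z\<close>.\<close>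

definition frac_ker :: "real \<Rightarrow> 'a::euclidean_space \<Rightarrow> real" where
  "frac_ker s z = 1 / norm z powr (real DIM('a) + 2 * s)"

lemma frac_ker_nonneg [simp]: "0 \<le> frac_ker s z"
  by (simp add: frac_ker_def)

lemma frac_ker_minus: "frac_ker s (x - y) = frac_ker s (y - x)"
  by (simp add: frac_ker_def norm_minus_commute)

lemma borel_measurable_frac_ker [measurable]: "frac_ker s \<in> borel_measurable borel"
  unfolding frac_ker_def by measurable

lemma borel_imp_lebesgue [simp]: "f \<in> borel_measurable borel \<Longrightarrow> f \<in> borel_measurable lebesgue"
  by (rule measurable_completion) simp

lemma frac_ker_le:
  fixes z :: "'a::euclidean_space"
  assumes "0 < r" "r \<le> norm z" "0 \<le> s"
  shows "frac_ker s z \<le> r powr - (real DIM('a) + 2 * s)"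
proof -
  have "r powr (real DIM('a) + 2 * s) \<le> norm z powr (real DIM('a) + 2 * s)"
    using assms by (intro powr_mono2) auto
  then show ?thesis
    using assms unfolding frac_ker_def powr_minus_divide by (intro frac_le) auto
qed

lemma frac_ker_ge:
  fixes z :: "'a::euclidean_space"
  assumes "norm z \<le> r" "0 < norm z" "0 \<le> s"
  shows "r powr - (real DIM('a) + 2 * s) \<le> frac_ker s z"
proof -
  have "norm z powr (real DIM('a) + 2 * s) \<le> r powr (real DIM('a) + 2 * s)"
    using assms by (intro powr_mono2) auto
  then show ?thesis
    using assms unfolding frac_ker_def powr_minus_divide by (intro frac_le) auto
qed

text \<open>Half-open, so that the shells of radii t, t / 2, t / 4, ... are disjoint and fill the
  punctured ball.\<close>

definition shell :: "'a::euclidean_space \<Rightarrow> real \<Rightarrow> 'a set" where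
  "shell x t = {y. t / 2 \<le> norm (x - y) \<and> norm (x - y) < t}"

lemma shell_borel [measurable, simp]: "shell x t \<in> sets borel"
  unfolding shell_def by measurable

lemma sets_lebesgue_borel [simp]: "A \<in> sets borel \<Longrightarrow> A \<in> sets lebesgue"
  by (simp add: sets_completionI_sets)

lemma emeasure_shell_le:
  fixes x :: "'a::euclidean_space"
  assumes "0 \<le> t"
  shows "emeasure lborel (shell x t) \<le> ennreal (unit_ball_vol (real DIM('a)) * t ^ DIM('a))"
proof -
  have "emeasure lborel (shell x t) \<le> emeasure lborel (ball x t)"
    by (intro emeasure_mono) (auto simp: shell_def dist_norm)
  then show ?thesis using emeasure_ball[of t x] assms by simp
qed

text \<open>Overlaps of the cover are harmless for an upper bound. The cover will consist of dyadic
  shells, on which bound times measure is dominated by a geometric sequence.\<close>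

lemma nn_integral_cover_le:
  fixes f :: "'a \<Rightarrow> ennreal" and a m :: "nat \<Rightarrow> real"
  assumes [measurable]: "\<And>j. S j \<in> sets M"
    and cover: "\<And>x. x \<in> space M \<Longrightarrow> f x \<noteq> 0 \<Longrightarrow> \<exists>j. x \<in> S j \<and> f x \<le> ennreal (a j)"
    and m: "\<And>j. emeasure M (S j) \<le> ennreal (m j)"
    and le: "\<And>j. 0 \<le> a j" "\<And>j. 0 \<le> m j" "\<And>j. a j * m j \<le> b * q ^ j" and q: "0 \<le> q" "q < 1"
  shows "(\<integral>\<^sup>+x. f x \<partial>M) \<le> ennreal (b / (1 - q))"
proof -
  have "0 \<le> a 0 * m 0" by (intro mult_nonneg_nonneg le)
  then have b: "0 \<le> b" using le(3)[of 0] by simp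
  have "(\<integral>\<^sup>+x. f x \<partial>M) \<le> (\<integral>\<^sup>+x. (\<Sum>j. ennreal (a j) * indicator (S j) x) \<partial>M)"
  proof (intro nn_integral_mono)
    fix x assume x: "x \<in> space M"
    show "f x \<le> (\<Sum>j. ennreal (a j) * indicator (S j) x)"
    proof (cases "f x = 0")
      case False
      then obtain j where j: "x \<in> S j" "f x \<le> ennreal (a j)" using cover x by blast
      have "f x \<le> (\<Sum>i\<in>{j}. ennreal (a i) * indicator (S i) x)" using j by simp
      also have "\<dots> \<le> (\<Sum>j. ennreal (a j) * indicator (S j) x)" by (intro sum_le_suminf) auto
      finally show ?thesis .
    qed simp
  qed
  also have "\<dots> = (\<Sum>j. ennreal (a j) * emeasure M (S j))"
    by (subst nn_integral_suminf) (auto simp: nn_integral_cmult_indicator)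
  also have "\<dots> \<le> (\<Sum>j. ennreal (b * q ^ j))"
  proof (intro suminf_le summableI)
    fix j
    have "ennreal (a j) * emeasure M (S j) \<le> ennreal (a j) * ennreal (m j)" by (intro mult_left_mono m) auto
    also have "\<dots> \<le> ennreal (b * q ^ j)" using le by (simp flip: ennreal_mult add: ennreal_leI)
    finally show "ennreal (a j) * emeasure M (S j) \<le> ennreal (b * q ^ j)" .
  qed
  also have "\<dots> = ennreal (b / (1 - q))"
    using b q sums_mult[OF geometric_sums[of q], of b]
    by (intro suminf_ennreal_eq) (auto simp: divide_inverse)
  finally show ?thesis .
qed

lemma integrable_le_of_nn_integral_le:
  fixes f :: "'a \<Rightarrow> real"
  assumes "f \<in> borel_measurable M" "AE x in M. 0 \<le> f x" "(\<integral>\<^sup>+x. f x \<partial>M) \<le> ennreal b" "0 \<le> b"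
  shows "integrable M f" "(\<integral>x. f x \<partial>M) \<le> b"
proof -
  show i: "integrable M f"
    using assms by (intro integrableI_nonneg) (auto simp: order_le_less_trans[OF _ ennreal_less_top])
  show "(\<integral>x. f x \<partial>M) \<le> b"
    using assms nn_integral_eq_integral[OF i assms(2)] by simp
qed

text \<open>The largest kernel value on a shell times the volume of its ball: the powers of order n
  cancel, and only \<open>t powr (- 2 * s)\<close> survives.\<close>

lemma shell_mass_bound:
  assumes t: "0 < t"
  shows "(t / 2) powr - (real n + 2 * s) * (V * t ^ n) = V * 2 powr (real n + 2 * s) * t powr (- 2 * s)"
proof -
  have "(t / 2) powr - (real n + 2 * s) = t powr - real n * t powr (-2 * s) * 2 powr (real n + 2 * s)"
    using t by (simp add: powr_divide powr_minus_divide flip: powr_add) (simp add: powr_minus_divide field_simps flip: powr_add)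
  moreover have "t powr - real n * t ^ n = 1"
    using t by (simp add: powr_minus powr_realpow)
  ultimately show ?thesis by (simp add: mult_ac)
qed

text \<open>Shells of growing radius have masses in geometric progression with ratio
  \<open>2 powr (- 2 * s)\<close>. This ratio tends to 1 as s tends to 0, so the resulting bound is
  not uniform and only integrability is recorded.\<close>

lemma frac_ker_outer:
  fixes x :: "'a::euclidean_space"
  assumes r: "0 < r" and s: "0 < s"
  shows "set_integrable lebesgue {y. r \<le> norm (x - y)} (\<lambda>y. frac_ker s (x - y))"
proof -
  define V where "V = unit_ball_vol (real DIM('a))"
  define \<tau> where "\<tau> j = r * 2 ^ Suc j" for j :: nat
  have V: "0 \<le> V" by (simp add: V_def less_imp_le)
  have \<tau>: "0 < \<tau> j" for j using r by (simp add: \<tau>_def)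
  have exj: "\<exists>j. r * 2 ^ j \<le> d \<and> d < r * 2 ^ Suc j" if d: "r \<le> d" for d
  proof -
    obtain n where "d / r < 2 ^ n" using real_arch_pow[of 2 "d / r"] by auto
    then have ex: "\<exists>n. d < r * 2 ^ n" using r by (auto simp: field_simps)
    define j where "j = (LEAST n. d < r * 2 ^ n)"
    have "d < r * 2 ^ j" unfolding j_def by (rule LeastI_ex[OF ex])
    moreover from this obtain i where "j = Suc i" using d by (cases j) auto
    moreover have "\<not> d < r * 2 ^ i" using calculation(2) not_less_Least[of i "\<lambda>n. d < r * 2 ^ n"] by (simp add: j_def)
    ultimately show ?thesis by (intro exI[of _ i]) auto
  qed
  have "(\<integral>\<^sup>+y. ennreal (indicator {y. r \<le> norm (x - y)} y * frac_ker s (x - y)) \<partial>lborel)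
     \<le> ennreal (V * 2 powr (real DIM('a) + 2 * s) * (2 * r) powr (- 2 * s) / (1 - 2 powr (- 2 * s)))"
  proof (rule nn_integral_cover_le)
    show "shell x (\<tau> j) \<in> sets lborel" for j by simp
    show "emeasure lborel (shell x (\<tau> j)) \<le> ennreal (V * \<tau> j ^ DIM('a))" for j
      unfolding V_def using \<tau>[of j] by (intro emeasure_shell_le) simp
    show "0 \<le> (\<tau> j / 2) powr - (real DIM('a) + 2 * s)" for j by simp
    show "0 \<le> V * \<tau> j ^ DIM('a)" for j using V \<tau>[of j] by simp
    show "(\<tau> j / 2) powr - (real DIM('a) + 2 * s) * (V * \<tau> j ^ DIM('a))
        \<le> V * 2 powr (real DIM('a) + 2 * s) * (2 * r) powr (- 2 * s) * (2 powr (- 2 * s)) ^ j" for j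
    proof -
      have "\<tau> j powr (- 2 * s) = (2 * r) powr (- 2 * s) * (2 powr (- 2 * s)) ^ j"
        unfolding \<tau>_def using r
        by (simp add: powr_mult flip: powr_realpow) (simp add: powr_powr powr_mult mult_ac flip: powr_add)
      then show ?thesis unfolding shell_mass_bound[OF \<tau>] by simp
    qed
    show "0 \<le> 2 powr (- 2 * s)" by simp
    show "2 powr (- 2 * s) < 1" using s by (simp add: powr_less_one)
    fix y assume "ennreal (indicator {y. r \<le> norm (x - y)} y * frac_ker s (x - y)) \<noteq> 0"
    then have "r \<le> norm (x - y)" by (auto simp: indicator_def split: if_splits)
    from exj[OF this] obtain j where j: "r * 2 ^ j \<le> norm (x - y)" "norm (x - y) < r * 2 ^ Suc j" by auto
    have "frac_ker s (x - y) \<le> (\<tau> j / 2) powr - (real DIM('a) + 2 * s)"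
      by (rule frac_ker_le) (use j s r in \<open>auto simp: \<tau>_def\<close>)
    then show "\<exists>j. y \<in> shell x (\<tau> j) \<and>
        ennreal (indicator {y. r \<le> norm (x - y)} y * frac_ker s (x - y)) \<le> ennreal ((\<tau> j / 2) powr - (real DIM('a) + 2 * s))"
      using j by (intro exI[of _ j]) (auto simp: shell_def \<tau>_def indicator_def intro!: ennreal_leI)
  qed
  then show ?thesis
    unfolding set_integrable_def
    by (intro integrable_le_of_nn_integral_le(1)[where b = "V * 2 powr (real DIM('a) + 2 * s) * (2 * r) powr (- 2 * s) / (1 - 2 powr (- 2 * s))"])
      (use V s in \<open>auto simp: nn_integral_completion powr_less_one less_imp_le intro!: mult_nonneg_nonneg divide_nonneg_nonneg\<close>)
qed

text \<open>The factor \<open>norm (x - y)\<close> turns the ratio of shrinking shells into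
  \<open>2 powr - (1 - 2 * s)\<close>, bounded away from 1 for s at most 1/4. In the constant 8, a
  factor 4 comes from \<open>1 / (1 - q)\<close> and a factor 2 from
  \<open>2 powr (2 * s)\<close>.\<close>

lemma frac_ker_inner:
  fixes x :: "'a::euclidean_space"
  assumes t: "0 < t" and s: "0 < s" "s \<le> 1/4"
  shows "set_integrable lebesgue {y. norm (x - y) < t} (\<lambda>y. norm (x - y) * frac_ker s (x - y))" (is ?A)
    and "(LINT y:{y. norm (x - y) < t}|lebesgue. norm (x - y) * frac_ker s (x - y))
      \<le> 8 * unit_ball_vol (real DIM('a)) * 2 ^ DIM('a) * t powr (1 - 2 * s)" (is ?B)
proof -
  define V where "V = unit_ball_vol (real DIM('a))"
  define \<tau> where "\<tau> j = t / 2 ^ j" for j :: nat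
  define q where "q = 2 powr - (1 - 2 * s)"
  define b where "b = V * 2 powr (real DIM('a) + 2 * s) * t powr (1 - 2 * s)"
  have V: "0 \<le> V" by (simp add: V_def less_imp_le)
  have \<tau>: "0 < \<tau> j" for j using t by (simp add: \<tau>_def)
  have q1: "q \<le> 1 / sqrt 2"
  proof -
    have "q \<le> 2 powr - (1/2)" unfolding q_def using s by (intro powr_mono) auto
    also have "\<dots> = 1 / sqrt 2" by (simp add: powr_minus_divide powr_half_sqrt)
    finally show ?thesis .
  qed
  have "7/5 \<le> sqrt 2" by (rule real_le_rsqrt) (simp add: power2_eq_square)
  then have "1 / sqrt 2 \<le> 5/7" by (simp add: field_simps)
  then have q: "0 \<le> q" "q \<le> 3/4" using q1 by (auto simp: q_def)
  have exj: "\<exists>j. t / 2 ^ Suc j \<le> d \<and> d < t / 2 ^ j" if d: "0 < d" "d < t" for d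
  proof -
    obtain n where "t / d < 2 ^ n" using real_arch_pow[of 2 "t / d"] by auto
    then have ex: "\<exists>n. t / 2 ^ n \<le> d" using d by (auto simp: field_simps intro: less_imp_le)
    define j where "j = (LEAST n. t / 2 ^ n \<le> d)"
    have "t / 2 ^ j \<le> d" unfolding j_def by (rule LeastI_ex[OF ex])
    moreover from this obtain i where "j = Suc i" using d by (cases j) auto
    moreover have "\<not> t / 2 ^ i \<le> d" using calculation(2) not_less_Least[of i "\<lambda>n. t / 2 ^ n \<le> d"] by (simp add: j_def)
    ultimately show ?thesis by (intro exI[of _ i]) auto
  qed
  have "(\<integral>\<^sup>+y. ennreal (indicator {y. norm (x - y) < t} y * (norm (x - y) * frac_ker s (x - y))) \<partial>lborel)
     \<le> ennreal (b / (1 - q))"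
  proof (rule nn_integral_cover_le)
    show "shell x (\<tau> j) \<in> sets lborel" for j by simp
    show "emeasure lborel (shell x (\<tau> j)) \<le> ennreal (V * \<tau> j ^ DIM('a))" for j
      unfolding V_def using \<tau>[of j] by (intro emeasure_shell_le) simp
    show "0 \<le> \<tau> j * (\<tau> j / 2) powr - (real DIM('a) + 2 * s)" for j using \<tau>[of j] by simp
    show "0 \<le> V * \<tau> j ^ DIM('a)" for j using V \<tau>[of j] by simp
    show "\<tau> j * (\<tau> j / 2) powr - (real DIM('a) + 2 * s) * (V * \<tau> j ^ DIM('a)) \<le> b * q ^ j" for j
    proof -
      have "\<tau> j * \<tau> j powr (- 2 * s) = \<tau> j powr (1 - 2 * s)"
        using \<tau>[of j] powr_add[of "\<tau> j" 1 "- 2 * s"] by simp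
      also have "\<dots> = t powr (1 - 2 * s) * q ^ j"
        unfolding \<tau>_def q_def using t
        by (simp add: powr_divide flip: powr_realpow) (simp add: powr_powr powr_minus_divide field_simps flip: powr_add)
      finally have "\<tau> j * \<tau> j powr (- 2 * s) = t powr (1 - 2 * s) * q ^ j" .
      moreover have "x * (v * p * y) = v * p * (x * y)" for x v p y :: real by simp
      then have "\<tau> j * (\<tau> j / 2) powr - (real DIM('a) + 2 * s) * (V * \<tau> j ^ DIM('a))
          = V * 2 powr (real DIM('a) + 2 * s) * (\<tau> j * \<tau> j powr (- 2 * s))"
        unfolding mult.assoc[of "\<tau> j"] shell_mass_bound[OF \<tau>] .
      ultimately show ?thesis by (simp only: b_def mult.assoc order_refl)
    qed
    show "0 \<le> q" "q < 1" using q by auto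
    fix y assume "ennreal (indicator {y. norm (x - y) < t} y * (norm (x - y) * frac_ker s (x - y))) \<noteq> 0"
    then have "norm (x - y) < t" "norm (x - y) > 0" by (auto simp: indicator_def split: if_splits)
    from exj[OF this(2,1)] obtain j where j: "t / 2 ^ Suc j \<le> norm (x - y)" "norm (x - y) < t / 2 ^ j" by auto
    have "frac_ker s (x - y) \<le> (\<tau> j / 2) powr - (real DIM('a) + 2 * s)"
      by (rule frac_ker_le) (use j s t in \<open>auto simp: \<tau>_def\<close>)
    then have "norm (x - y) * frac_ker s (x - y) \<le> \<tau> j * (\<tau> j / 2) powr - (real DIM('a) + 2 * s)"
      using j \<tau>[of j] by (intro mult_mono) (auto simp: \<tau>_def)
    then show "\<exists>j. y \<in> shell x (\<tau> j) \<and>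
        ennreal (indicator {y. norm (x - y) < t} y * (norm (x - y) * frac_ker s (x - y)))
        \<le> ennreal (\<tau> j * (\<tau> j / 2) powr - (real DIM('a) + 2 * s))"
      using j by (intro exI[of _ j]) (auto simp: shell_def \<tau>_def indicator_def intro!: ennreal_leI)
  qed
  moreover have "b / (1 - q) \<le> 8 * V * 2 ^ DIM('a) * t powr (1 - 2 * s)"
  proof -
    have b: "0 \<le> b" using V by (simp add: b_def)
    have "b / (1 - q) \<le> b / (1 / 4)" using q b by (intro divide_left_mono) auto
    also have "b \<le> V * (2 * 2 ^ DIM('a)) * t powr (1 - 2 * s)"
    proof -
      have "2 powr (real DIM('a) + 2 * s) \<le> 2 powr (real DIM('a) + 1)" using s by (intro powr_mono) auto
      then show ?thesis unfolding b_def using V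
        by (intro mult_right_mono mult_left_mono) (auto simp: powr_add powr_realpow)
    qed
    finally show ?thesis by (simp add: mult_ac)
  qed
  ultimately have le: "(\<integral>\<^sup>+y. ennreal (indicator {y. norm (x - y) < t} y * (norm (x - y) * frac_ker s (x - y))) \<partial>lborel)
     \<le> ennreal (8 * V * 2 ^ DIM('a) * t powr (1 - 2 * s))"
    by (meson ennreal_leI order_trans)
  note * = integrable_le_of_nn_integral_le[of "\<lambda>y. indicator {y. norm (x - y) < t} y *\<^sub>R (norm (x - y) * frac_ker s (x - y))" lebesgue
    "8 * V * 2 ^ DIM('a) * t powr (1 - 2 * s)"]
  show ?A unfolding set_integrable_def by (rule *) (use le V in \<open>auto simp: nn_integral_completion\<close>)
  show ?B unfolding set_lebesgue_integral_def V_def[symmetric] by (rule *) (use le V in \<open>auto simp: nn_integral_completion\<close>)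
qed

lemma shell_integrable:
  assumes "0 < t" "0 < s" "A \<in> sets lebesgue" "A \<subseteq> {y. t \<le> norm (x - y)}"
  shows "set_integrable lebesgue A (\<lambda>y. frac_ker s (x - y))"
  using set_integrable_subset[OF frac_ker_outer[of t s x]] assms by simp

lemma set_integral_frac_ker_mono:
  assumes "0 < t" "0 < s" "A \<in> sets lebesgue" "A \<subseteq> {y. t \<le> norm (x - y)}" "C \<in> sets lebesgue" "C \<subseteq> A"
  shows "(LINT y:C|lebesgue. frac_ker s (x - y)) \<le> (LINT y:A|lebesgue. frac_ker s (x - y))"
  unfolding set_lebesgue_integral_def
proof (rule integral_mono)
  show "integrable lebesgue (\<lambda>y. indicat_real C y *\<^sub>R frac_ker s (x - y))"
    "integrable lebesgue (\<lambda>y. indicat_real A y *\<^sub>R frac_ker s (x - y))"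
    using shell_integrable[of t s C x] shell_integrable[of t s A x] assms unfolding set_integrable_def by auto
qed (use assms in \<open>auto simp: indicator_def\<close>)

lemma shell_mass_le:
  fixes x :: "'a::euclidean_space"
  assumes t: "0 < t" and s: "0 < s" "s \<le> 1/4"
  shows "(LINT y:shell x t|lebesgue. frac_ker s (x - y)) \<le> 2 * unit_ball_vol (real DIM('a)) * 2 ^ DIM('a) * t powr (- 2 * s)"
proof -
  define V where "V = unit_ball_vol (real DIM('a))"
  have V: "0 \<le> V" by (simp add: V_def less_imp_le)
  have "(\<integral>\<^sup>+y. ennreal (indicator (shell x t) y *\<^sub>R frac_ker s (x - y)) \<partial>lborel)
     \<le> (\<integral>\<^sup>+y. ennreal ((t / 2) powr - (real DIM('a) + 2 * s)) * indicator (shell x t) y \<partial>lborel)"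
  proof (intro nn_integral_mono)
    fix y
    show "ennreal (indicator (shell x t) y *\<^sub>R frac_ker s (x - y))
        \<le> ennreal ((t / 2) powr - (real DIM('a) + 2 * s)) * indicator (shell x t) y"
      using frac_ker_le[of "t / 2" "x - y" s] t s by (auto simp: shell_def indicator_def intro: ennreal_leI)
  qed
  also have "\<dots> \<le> ennreal ((t / 2) powr - (real DIM('a) + 2 * s)) * ennreal (V * t ^ DIM('a))"
    unfolding V_def using emeasure_shell_le[of t x] t by (simp add: nn_integral_cmult_indicator mult_left_mono)
  also have "\<dots> = ennreal ((t / 2) powr - (real DIM('a) + 2 * s) * (V * t ^ DIM('a)))"
    using V t by (simp add: ennreal_mult)
  also have "\<dots> \<le> ennreal (2 * V * 2 ^ DIM('a) * t powr (- 2 * s))"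
  proof (intro ennreal_leI)
    have "2 powr (real DIM('a) + 2 * s) \<le> 2 powr (real DIM('a) + 1)" using s by (intro powr_mono) auto
    then have "V * 2 powr (real DIM('a) + 2 * s) * t powr (- 2 * s) \<le> V * (2 * 2 ^ DIM('a)) * t powr (- 2 * s)"
      using V by (intro mult_right_mono mult_left_mono) (auto simp: powr_add powr_realpow)
    then show "(t / 2) powr - (real DIM('a) + 2 * s) * (V * t ^ DIM('a)) \<le> 2 * V * 2 ^ DIM('a) * t powr (- 2 * s)"
      unfolding shell_mass_bound[OF t] by (simp add: mult_ac)
  qed
  finally show ?thesis
    unfolding set_lebesgue_integral_def V_def[symmetric]
    by (intro integrable_le_of_nn_integral_le(2)) (use V in \<open>auto simp: nn_integral_completion\<close>)
qed

text \<open>The kernel is at least \<open>t powr - (N + 2 * s)\<close> throughout the shell. As the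
  ball has a radius proportional to t, this matches \<open>shell_mass_le\<close> up to a factor
  depending on the dimension alone: a set containing such a ball holds a fixed share of the mass of
  the shell.\<close>

lemma shell_mass_ge:
  fixes x c :: "'a::euclidean_space"
  assumes t: "0 < t" and s: "0 < s"
    and ball: "ball c (t / 8) \<subseteq> A" and A: "A \<in> sets lebesgue" "A \<subseteq> shell x t"
  shows "unit_ball_vol (real DIM('a)) / 8 ^ DIM('a) * t powr (- 2 * s) \<le> (LINT y:A|lebesgue. frac_ker s (x - y))"
proof -
  have "unit_ball_vol (real DIM('a)) / 8 ^ DIM('a) * t powr (- 2 * s)
      = t powr - (real DIM('a) + 2 * s) * measure lebesgue (ball c (t / 8))"
  proof -
    have "t powr - (real DIM('a) + 2 * s) * t ^ DIM('a) = t powr (- 2 * s)"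
      using t by (simp flip: powr_realpow powr_add)
    then show ?thesis using t by (simp add: content_ball power_divide mult_ac)
  qed
  also have "\<dots> = (LINT y:ball c (t / 8)|lebesgue. t powr - (real DIM('a) + 2 * s))"
    by (simp add: set_lebesgue_integral_def)
  also have "\<dots> \<le> (LINT y:ball c (t / 8)|lebesgue. frac_ker s (x - y))"
  proof (rule set_integral_mono)
    show "set_integrable lebesgue (ball c (t / 8)) (\<lambda>y. t powr - (real DIM('a) + 2 * s))"
      using integrable_real_indicator[of "ball c (t / 8)" lebesgue] fmeasurableD2[OF lmeasurable_ball[of c "t / 8"]]
      by (simp add: set_integrable_def less_top)
    show "set_integrable lebesgue (ball c (t / 8)) (\<lambda>y. frac_ker s (x - y))"
      by (rule shell_integrable[of "t / 2"]) (use t s ball A in \<open>auto simp: shell_def\<close>)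
    fix y assume "y \<in> ball c (t / 8)"
    then have "t / 2 \<le> norm (x - y)" "norm (x - y) < t" using ball A by (auto simp: shell_def)
    then show "t powr - (real DIM('a) + 2 * s) \<le> frac_ker s (x - y)"
      using t s by (intro frac_ker_ge) auto
  qed
  also have "\<dots> \<le> (LINT y:A|lebesgue. frac_ker s (x - y))"
    by (rule set_integral_frac_ker_mono[of "t / 2"]) (use t s A ball in \<open>auto simp: shell_def\<close>)
  finally show ?thesis .
qed

text \<open>The type argument selects the dimension, which \<open>s\<close> and \<open>r\<close> do
  not determine.\<close>

definition tail :: "'a::euclidean_space itself \<Rightarrow> real \<Rightarrow> real \<Rightarrow> real" where
  "tail _ s r = (LINT z:{z. r \<le> norm z}|lebesgue. frac_ker s (z :: 'a))"

lemma tail_eq: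
  fixes x :: "'a::euclidean_space"
  shows "(LINT y:{y. r \<le> norm (x - y)}|lebesgue. frac_ker s (x - y)) = tail TYPE('a) s r"
proof -
  have "tail TYPE('a) s r = (\<integral>z. indicator {z. r \<le> norm z} z * frac_ker s (z :: 'a) \<partial>lborel)"
    unfolding tail_def set_lebesgue_integral_def by (subst integral_completion) auto
  also have "\<dots> = (\<integral>z. indicator {z. r \<le> norm z} z * frac_ker s (z :: 'a) \<partial>distr lborel borel ((+) (- x)))"
    by (simp add: lborel_distr_plus)
  also have "\<dots> = (\<integral>y. indicator {z. r \<le> norm z} (y - x) * frac_ker s (y - x) \<partial>lborel)"
    by (subst integral_distr) auto
  also have "\<dots> = (\<integral>y. indicator {y. r \<le> norm (x - y)} y * frac_ker s (x - y) \<partial>lborel)"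
    by (simp add: indicator_def norm_minus_commute frac_ker_minus[of s _ x])
  also have "\<dots> = (LINT y:{y. r \<le> norm (x - y)}|lebesgue. frac_ker s (x - y))"
    unfolding set_lebesgue_integral_def by (subst integral_completion) auto
  finally show ?thesis by simp
qed

lemma tail_half:
  assumes t: "0 < t" and s: "0 < s"
  shows "tail TYPE('a::euclidean_space) s t + unit_ball_vol (real DIM('a)) / 8 ^ DIM('a) * t powr (- 2 * s) \<le> tail TYPE('a) s (t / 2)"
proof -
  obtain e :: 'a where e: "norm e = 1" using vector_choose_size[of 1] by auto
  \<comment> \<open>The points of this ball have norm between 5t/8 and 7t/8.\<close>
  have "ball ((3 * t / 4) *\<^sub>R e) (t / 8) \<subseteq> shell 0 t"
  proof
    fix y assume "y \<in> ball ((3 * t / 4) *\<^sub>R e) (t / 8)"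
    then have "norm ((3 * t / 4) *\<^sub>R e - y) < t / 8" by (simp add: dist_norm)
    moreover have "norm ((3 * t / 4) *\<^sub>R e) = 3 * t / 4" using e t by simp
    ultimately show "y \<in> shell 0 t"
      using norm_triangle_ineq3[of "(3 * t / 4) *\<^sub>R e" y] by (auto simp: shell_def)
  qed
  from shell_mass_ge[OF t s this _ order_refl]
  have "unit_ball_vol (real DIM('a)) / 8 ^ DIM('a) * t powr (- 2 * s) \<le> (LINT y:shell 0 t|lebesgue. frac_ker s (0 - y :: 'a))"
    by simp
  moreover have "tail TYPE('a) s (t / 2) = (LINT y:shell 0 t \<union> {y. t \<le> norm (0 - y)}|lebesgue. frac_ker s (0 - y :: 'a))"
  proof -
    have "{y. t / 2 \<le> norm (0 - y)} = shell 0 t \<union> {y :: 'a. t \<le> norm (0 - y)}" using t by (auto simp: shell_def)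
    then show ?thesis using tail_eq[of "t / 2" "0 :: 'a" s] by simp
  qed
  moreover have "\<dots> = (LINT y:shell 0 t|lebesgue. frac_ker s (0 - y :: 'a)) + (LINT y:{y. t \<le> norm (0 - y)}|lebesgue. frac_ker s (0 - y :: 'a))"
    using t s by (intro set_integral_Un shell_integrable[of "t / 2"]) (auto simp: shell_def)
  ultimately show ?thesis using tail_eq[of t "0 :: 'a" s] by simp
qed

text \<open>Halving the radius adds a shell of mass at least \<open>t powr (- 2 * s)\<close> times a
  dimensional constant, and this power is at least 1 for t at most 1. The slope in \<open>p\<close>
  is thus free of s, although both tails diverge as s tends to 0.\<close>

lemma tail_dyadic:
  assumes s: "0 < s"
  shows "tail TYPE('a::euclidean_space) s 1 + real p * (unit_ball_vol (real DIM('a)) / 8 ^ DIM('a)) \<le> tail TYPE('a) s (1 / 2 ^ p)"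
proof (induction p)
  case (Suc p)
  define v where "v = unit_ball_vol (real DIM('a)) / 8 ^ DIM('a)"
  have v: "0 \<le> v" by (simp add: v_def less_imp_le)
  have "1 \<le> (1 / 2 ^ p :: real) powr (- 2 * s)"
    using s by (simp add: powr_divide powr_minus_divide ge_one_powr_ge_zero)
  then have "v * 1 \<le> v * (1 / 2 ^ p) powr (- 2 * s)" using v by (rule mult_left_mono)
  then have "tail TYPE('a) s 1 + real p * v + v \<le> tail TYPE('a) s (1 / 2 ^ p / 2)"
    using Suc.IH tail_half[of "1 / 2 ^ p" s, where ?'a = 'a, OF _ s] unfolding v_def[symmetric] by simp
  then show ?case unfolding v_def[symmetric] by (simp add: algebra_simps)
qed simp

section \<open>Double integrals\<close>

lemma sigma_finite_lebesgue: "sigma_finite_measure (lebesgue :: 'a::euclidean_space measure)"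
proof
  obtain A :: "'a set set" where "countable A" "A \<subseteq> sets lborel" "\<Union>A = space lborel" "\<forall>a\<in>A. emeasure lborel a \<noteq> \<infinity>"
    using lborel.sigma_finite_countable by blast
  then show "\<exists>A::'a set set. countable A \<and> A \<subseteq> sets lebesgue \<and> \<Union>A = space lebesgue \<and> (\<forall>a\<in>A. emeasure lebesgue a \<noteq> \<infinity>)"
    by (intro exI[of _ A]) (auto simp: subset_iff)
qed

interpretation lebesgue: sigma_finite_measure lebesgue
  by (rule sigma_finite_lebesgue)

interpretation lebesgue_pair: pair_sigma_finite lebesgue lebesgue ..

text \<open>A product of completed measures is not complete. Measurability of integrands is
  therefore derived from the two coordinates, and null sets of one variable are carried over as
  \<open>N \<times> UNIV\<close> and \<open>UNIV \<times> N\<close>.\<close>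

abbreviation leb2 :: "('a::euclidean_space \<times> 'a) measure" where
  "leb2 \<equiv> lebesgue \<Otimes>\<^sub>M lebesgue"

lemma ident_lebesgue_borel: "(\<lambda>x. x) \<in> lebesgue \<rightarrow>\<^sub>M borel"
  by (rule measurable_completion) simp

lemma fst_leb2_borel [measurable]: "fst \<in> leb2 \<rightarrow>\<^sub>M borel"
  and snd_leb2_borel [measurable]: "snd \<in> leb2 \<rightarrow>\<^sub>M borel"
  using measurable_compose[OF measurable_fst ident_lebesgue_borel]
    measurable_compose[OF measurable_snd ident_lebesgue_borel] by auto

lemma leb2_measurable_diff: "f \<in> borel_measurable borel \<Longrightarrow> (\<lambda>(x, y). f (x - y)) \<in> borel_measurable leb2"
  unfolding split_beta'
  by (rule measurable_compose[of "\<lambda>p. fst p - snd p" leb2 borel f]) (intro borel_measurable_diff fst_leb2_borel snd_leb2_borel)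

lemma leb2_measurable_fst: "f \<in> borel_measurable lebesgue \<Longrightarrow> (\<lambda>(x, y). f x) \<in> borel_measurable leb2"
  and leb2_measurable_snd: "f \<in> borel_measurable lebesgue \<Longrightarrow> (\<lambda>(x, y). f y) \<in> borel_measurable leb2"
  unfolding split_beta'
  by (rule measurable_compose[OF measurable_fst], assumption) (rule measurable_compose[OF measurable_snd], assumption)

lemma AE_leb2_fst:
  assumes "AE x in lebesgue. P x" shows "AE (x, y) in leb2. P x"
proof -
  obtain N where N: "{x. \<not> P x} \<subseteq> N" "N \<in> null_sets lebesgue" 
    using AE_E3[OF assms] by (metis (lifting) DiffI mem_Collect_eq space_completion space_lborel space_borel subsetI UNIV_I)
  then have "N \<times> UNIV \<in> null_sets leb2"
    using lebesgue.emeasure_pair_measure_Times[of N lebesgue UNIV] by (auto simp: null_sets_def)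
  then show ?thesis
  proof (rule AE_I')
    show "{p \<in> space leb2. \<not> (case p of (x, y) \<Rightarrow> P x)} \<subseteq> N \<times> UNIV" using N(1) by (auto split: prod.splits)
  qed
qed

lemma AE_leb2_snd:
  assumes "AE x in lebesgue. P x" shows "AE (x, y) in leb2. P y"
proof -
  obtain N where N: "{x. \<not> P x} \<subseteq> N" "N \<in> null_sets lebesgue" 
    using AE_E3[OF assms] by (metis (lifting) DiffI mem_Collect_eq space_completion space_lborel space_borel subsetI UNIV_I)
  then have "UNIV \<times> N \<in> null_sets leb2"
    using lebesgue.emeasure_pair_measure_Times[of UNIV lebesgue N] by (auto simp: null_sets_def)
  then show ?thesis
  proof (rule AE_I')
    show "{p \<in> space leb2. \<not> (case p of (x, y) \<Rightarrow> P y)} \<subseteq> UNIV \<times> N" using N(1) by (auto split: prod.splits)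
  qed
qed

lemma integrable_leb2_swap:
  fixes f :: "'a::euclidean_space \<Rightarrow> 'a \<Rightarrow> real"
  assumes "integrable leb2 (\<lambda>(x, y). f x y)"
  shows "integrable leb2 (\<lambda>(x, y). f y x)"
    and "(\<integral>(x, y). f y x \<partial>leb2) = (\<integral>(x, y). f x y \<partial>leb2)"
  using lebesgue_pair.integrable_product_swap[OF assms]
    lebesgue_pair.integral_product_swap[OF borel_measurable_integrable[OF assms]] by simp_all

lemma integrable_leb2_weighted:
  fixes k :: "'a::euclidean_space \<Rightarrow> real"
  assumes w: "integrable lebesgue w" and k [measurable]: "k \<in> borel_measurable borel"
    and nonneg: "\<And>z. 0 \<le> k z" and int: "\<And>x. integrable lebesgue (\<lambda>y. k (x - y))"
    and le: "\<And>x. (\<integral>y. k (x - y) \<partial>lebesgue) \<le> A"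
  shows "integrable leb2 (\<lambda>(x, y). w x * k (x - y))"
proof (rule lebesgue_pair.Fubini_integrable)
  have [measurable]: "w \<in> borel_measurable lebesgue" using w by auto
  have m: "(\<lambda>(x, y). k (x - y)) \<in> borel_measurable leb2" by (rule leb2_measurable_diff) measurable
  show "(\<lambda>(x, y). w x * k (x - y)) \<in> borel_measurable leb2"
    using borel_measurable_times[OF leb2_measurable_fst[of w] m] by (simp add: split_beta')
  show "AE x in lebesgue. integrable lebesgue (\<lambda>y. case (x, y) of (x, y) \<Rightarrow> w x * k (x - y))"
    using int by simp
  have "integrable lebesgue (\<lambda>x. \<bar>w x\<bar> * (\<integral>y. k (x - y) \<partial>lebesgue))"
  proof (rule Bochner_Integration.integrable_bound)
    show "integrable lebesgue (\<lambda>x. \<bar>w x\<bar> * A)" using w by simp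
    have "(\<lambda>x. \<integral>y. k (x - y) \<partial>lebesgue) \<in> borel_measurable lebesgue"
      using m by (intro lebesgue.borel_measurable_lebesgue_integral)
    then show "(\<lambda>x. \<bar>w x\<bar> * (\<integral>y. k (x - y) \<partial>lebesgue)) \<in> borel_measurable lebesgue" by measurable
    show "AE x in lebesgue. norm (\<bar>w x\<bar> * (\<integral>y. k (x - y) \<partial>lebesgue)) \<le> norm (\<bar>w x\<bar> * A)"
    proof (rule AE_I2)
      fix x
      have "0 \<le> (\<integral>y. k (x - y) \<partial>lebesgue)" using nonneg by (intro integral_nonneg_AE) auto
      then show "norm (\<bar>w x\<bar> * (\<integral>y. k (x - y) \<partial>lebesgue)) \<le> norm (\<bar>w x\<bar> * A)"
        using le[of x] by (auto simp: abs_mult intro!: mult_left_mono)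
    qed
  qed
  then show "integrable lebesgue (\<lambda>x. \<integral>y. norm (case (x, y) of (x, y) \<Rightarrow> w x * k (x - y)) \<partial>lebesgue)"
    using nonneg by (simp add: abs_mult)
qed

definition far :: "real \<Rightarrow> real \<Rightarrow> 'a::euclidean_space \<Rightarrow> real" where
  "far s r z = indicator {z. r \<le> norm z} z * frac_ker s z"

text \<open>The factor \<open>norm z\<close> is the one contributed by a difference of a Lipschitz
  function; it makes the singularity integrable with a bound uniform in s on balls of radius
  1.\<close>

definition near :: "real \<Rightarrow> real \<Rightarrow> 'a::euclidean_space \<Rightarrow> real" where
  "near s r z = indicator {z. norm z < r} z * (norm z * frac_ker s z)"

lemma far_measurable [measurable]: "far s r \<in> borel_measurable borel"
  and near_measurable [measurable]: "near s r \<in> borel_measurable borel"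
  unfolding far_def near_def by measurable

lemma far_nonneg [simp]: "0 \<le> far s r z" and near_nonneg [simp]: "0 \<le> near s r z"
  by (auto simp: far_def near_def)

lemma far_minus: "far s r (x - y) = far s r (y - x)" and near_minus: "near s r (x - y) = near s r (y - x)"
  by (simp_all add: far_def near_def norm_minus_commute frac_ker_minus indicator_def)

definition near_bound :: "'a::euclidean_space itself \<Rightarrow> real" where
  "near_bound _ = 8 * unit_ball_vol (real DIM('a)) * 2 ^ DIM('a)"

lemma near_bound_pos: "0 < near_bound TYPE('a::euclidean_space)"
  by (simp add: near_bound_def)

lemma far_integrable: "0 < r \<Longrightarrow> 0 < s \<Longrightarrow> integrable lebesgue (\<lambda>y. far s r (x - y))"
  and far_integral: "(\<integral>y. far s r (x - y :: 'a::euclidean_space) \<partial>lebesgue) = tail TYPE('a) s r"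
  using frac_ker_outer[of r s x] tail_eq[of r x s]
  by (simp_all add: far_def set_integrable_def set_lebesgue_integral_def indicator_def)

lemma near_integrable: "0 < r \<Longrightarrow> 0 < s \<Longrightarrow> s \<le> 1/4 \<Longrightarrow> integrable lebesgue (\<lambda>y. near s r (x - y))"
  and near_integral: "0 < r \<Longrightarrow> 0 < s \<Longrightarrow> s \<le> 1/4 \<Longrightarrow>
    (\<integral>y. near s r (x - y :: 'a::euclidean_space) \<partial>lebesgue) \<le> near_bound TYPE('a) * r powr (1 - 2 * s)"
  using frac_ker_inner[of r s x]
  by (simp_all add: near_def near_bound_def set_integrable_def set_lebesgue_integral_def indicator_def)

lemma far_weighted:
  assumes "integrable lebesgue w" "0 < r" "0 < s"
  shows "integrable leb2 (\<lambda>(x, y). w x * far s r (x - y :: 'a::euclidean_space))"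
    and "integrable leb2 (\<lambda>(x, y). w y * far s r (x - y :: 'a::euclidean_space))"
proof -
  show 1: "integrable leb2 (\<lambda>(x, y). w x * far s r (x - y :: 'a))"
    by (rule integrable_leb2_weighted[where A = "tail TYPE('a) s r"])
      (use assms in \<open>auto simp: far_integrable far_integral\<close>)
  show "integrable leb2 (\<lambda>(x, y). w y * far s r (x - y :: 'a))"
    using integrable_leb2_swap(1)[OF 1] by (simp add: far_minus)
qed

lemma near_weighted:
  assumes "integrable lebesgue w" "0 < r" "0 < s" "s \<le> 1/4"
  shows "integrable leb2 (\<lambda>(x, y). w x * near s r (x - y :: 'a::euclidean_space))"
    and "integrable leb2 (\<lambda>(x, y). w y * near s r (x - y :: 'a::euclidean_space))"
proof -
  show 1: "integrable leb2 (\<lambda>(x, y). w x * near s r (x - y :: 'a))"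
    by (rule integrable_leb2_weighted[where A = "near_bound TYPE('a) * r powr (1 - 2 * s)"])
      (use assms in \<open>auto intro: near_integrable near_integral\<close>)
  show "integrable leb2 (\<lambda>(x, y). w y * near s r (x - y :: 'a))"
    using integrable_leb2_swap(1)[OF 1] by (simp add: near_minus)
qed

lemma leb2_measurable_prod_ker:
  fixes f g :: "'a::euclidean_space \<Rightarrow> real"
  assumes "f \<in> borel_measurable lebesgue" "g \<in> borel_measurable lebesgue"
  shows "(\<lambda>(x, y). (f x - f y) * (g x - g y) * frac_ker s (x - y)) \<in> borel_measurable leb2"
  using leb2_measurable_fst[OF assms(1)] leb2_measurable_fst[OF assms(2)]
    leb2_measurable_snd[OF assms(1)] leb2_measurable_snd[OF assms(2)]
    leb2_measurable_diff[OF borel_measurable_frac_ker[of s]]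
  unfolding split_beta' by (intro borel_measurable_times borel_measurable_diff)

section \<open>The energy form\<close>

text \<open>The form without its factor \<open>frac_const / 2\<close>, which vanishes as s tends to
  0; dividing it out leaves an equation in which the kernel alone is compared with \<mu>.\<close>

definition energy :: "real \<Rightarrow> ('a::euclidean_space \<Rightarrow> real) \<Rightarrow> ('a \<Rightarrow> real) \<Rightarrow> real" where
  "energy s u v = (\<integral>(x, y). (u x - u y) * (v x - v y) * frac_ker s (x - y) \<partial>leb2)"

lemma frac_form_eq: "frac_form s u v = frac_const DIM('a) s / 2 * energy s u (v :: 'a::euclidean_space \<Rightarrow> real)"
  unfolding frac_form_def energy_def frac_ker_def by (simp add: split_beta')

lemma frac_Hs_iff:
  fixes u :: "'a::euclidean_space \<Rightarrow> real"
  shows "u \<in> frac_Hs s \<longleftrightarrow> u \<in> borel_measurable lebesgue \<and> integrable lebesgue (\<lambda>x. (u x)\<^sup>2) \<and>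
    integrable leb2 (\<lambda>(x, y). (u x - u y)\<^sup>2 * frac_ker s (x - y))"
  unfolding frac_Hs_def frac_ker_def by (simp add: split_beta')

lemma energy_integrable:
  fixes u v :: "'a::euclidean_space \<Rightarrow> real"
  assumes u: "u \<in> frac_Hs s" and v: "v \<in> frac_Hs s"
  shows "integrable leb2 (\<lambda>(x, y). (u x - u y) * (v x - v y) * frac_ker s (x - y))"
proof (rule Bochner_Integration.integrable_bound)
  show "integrable leb2 (\<lambda>p. (case p of (x, y) \<Rightarrow> (u x - u y)\<^sup>2 * frac_ker s (x - y)) +
      (case p of (x, y) \<Rightarrow> (v x - v y)\<^sup>2 * frac_ker s (x - y)))"
    using u v by (intro Bochner_Integration.integrable_add) (auto simp: frac_Hs_iff)
  show "(\<lambda>(x, y). (u x - u y) * (v x - v y) * frac_ker s (x - y)) \<in> borel_measurable leb2"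
    using u v by (intro leb2_measurable_prod_ker) (auto simp: frac_Hs_iff)
  have "\<bar>a * b * k\<bar> \<le> \<bar>a\<^sup>2 * k + b\<^sup>2 * k\<bar>" if "0 \<le> k" for a b k :: real
  proof -
    have "2 * \<bar>a * b\<bar> \<le> a\<^sup>2 + b\<^sup>2"
      using sum_squares_bound[of "\<bar>a\<bar>" "\<bar>b\<bar>"] by (simp add: abs_mult)
    then have "\<bar>a * b\<bar> \<le> a\<^sup>2 + b\<^sup>2" by linarith
    then have "\<bar>a * b\<bar> * k \<le> (a\<^sup>2 + b\<^sup>2) * k" using that by (rule mult_right_mono)
    then show ?thesis using that by (simp add: abs_mult distrib_right)
  qed
  then show "AE p in leb2. norm (case p of (x, y) \<Rightarrow> (u x - u y) * (v x - v y) * frac_ker s (x - y))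
      \<le> norm ((case p of (x, y) \<Rightarrow> (u x - u y)\<^sup>2 * frac_ker s (x - y)) + (case p of (x, y) \<Rightarrow> (v x - v y)\<^sup>2 * frac_ker s (x - y)))"
    by (intro AE_I2) (auto split: prod.split)
qed

lemma frac_HsI:
  fixes u :: "'a::euclidean_space \<Rightarrow> real"
  assumes "u \<in> borel_measurable lebesgue" "integrable lebesgue (\<lambda>x. (u x)\<^sup>2)"
    and G: "integrable leb2 (\<lambda>(x, y). G x y)" and le: "\<And>x y. (u x - u y)\<^sup>2 * frac_ker s (x - y) \<le> G x y"
  shows "u \<in> frac_Hs s"
  unfolding frac_Hs_iff
proof (intro conjI)
  show "integrable leb2 (\<lambda>(x, y). (u x - u y)\<^sup>2 * frac_ker s (x - y))"
  proof (rule Bochner_Integration.integrable_bound[OF G])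
    show "(\<lambda>(x, y). (u x - u y)\<^sup>2 * frac_ker s (x - y)) \<in> borel_measurable leb2"
      using leb2_measurable_prod_ker[OF assms(1,1), of s] by (simp add: power2_eq_square)
    have "0 \<le> (u x - u y)\<^sup>2 * frac_ker s (x - y)" for x y by simp
    with le have "\<bar>(u x - u y)\<^sup>2 * frac_ker s (x - y)\<bar> \<le> \<bar>G x y\<bar>" for x y
      by (metis abs_ge_self abs_of_nonneg order_trans)
    then show "AE p in leb2. norm (case p of (x, y) \<Rightarrow> (u x - u y)\<^sup>2 * frac_ker s (x - y)) \<le> norm (case p of (x, y) \<Rightarrow> G x y)"
      by (intro AE_I2) (auto split: prod.split)
  qed
qed fact+

lemma frac_Hs_lin:
  fixes u v :: "'a::euclidean_space \<Rightarrow> real"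
  assumes u: "u \<in> frac_Hs s" and v: "v \<in> frac_Hs s"
  shows "(\<lambda>x. a * u x + b * v x) \<in> frac_Hs s"
proof (rule frac_HsI)
  have sq: "(a * p + b * q)\<^sup>2 \<le> 2 * a\<^sup>2 * p\<^sup>2 + 2 * b\<^sup>2 * q\<^sup>2" for p q :: real
    using sum_squares_bound[of "a * p" "b * q"] by (simp add: power2_sum power_mult_distrib)
  show m: "(\<lambda>x. a * u x + b * v x) \<in> borel_measurable lebesgue" using u v by (auto simp: frac_Hs_iff)
  show "integrable lebesgue (\<lambda>x. (a * u x + b * v x)\<^sup>2)"
  proof (rule Bochner_Integration.integrable_bound)
    show "integrable lebesgue (\<lambda>x. 2 * a\<^sup>2 * (u x)\<^sup>2 + 2 * b\<^sup>2 * (v x)\<^sup>2)"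
      using u v by (auto simp: frac_Hs_iff)
    show "AE x in lebesgue. norm ((a * u x + b * v x)\<^sup>2) \<le> norm (2 * a\<^sup>2 * (u x)\<^sup>2 + 2 * b\<^sup>2 * (v x)\<^sup>2)"
      using sq by (intro AE_I2) auto
    show "(\<lambda>x. (a * u x + b * v x)\<^sup>2) \<in> borel_measurable lebesgue" using m by measurable
  qed
  have "integrable leb2 (\<lambda>p. 2 * a\<^sup>2 * (case p of (x, y) \<Rightarrow> (u x - u y)\<^sup>2 * frac_ker s (x - y)) +
      2 * b\<^sup>2 * (case p of (x, y) \<Rightarrow> (v x - v y)\<^sup>2 * frac_ker s (x - y)))"
    using u v by (auto simp: frac_Hs_iff)
  then show "integrable leb2 (\<lambda>(x, y). 2 * a\<^sup>2 * ((u x - u y)\<^sup>2 * frac_ker s (x - y)) + 2 * b\<^sup>2 * ((v x - v y)\<^sup>2 * frac_ker s (x - y)))"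
    by (simp add: split_beta')
  fix x y
  have "(a * u x + b * v x - (a * u y + b * v y))\<^sup>2 * frac_ker s (x - y)
     = (a * (u x - u y) + b * (v x - v y))\<^sup>2 * frac_ker s (x - y)" by (simp add: algebra_simps)
  also have "\<dots> \<le> (2 * a\<^sup>2 * (u x - u y)\<^sup>2 + 2 * b\<^sup>2 * (v x - v y)\<^sup>2) * frac_ker s (x - y)"
    by (intro mult_right_mono sq) auto
  finally show "(a * u x + b * v x - (a * u y + b * v y))\<^sup>2 * frac_ker s (x - y)
     \<le> 2 * a\<^sup>2 * ((u x - u y)\<^sup>2 * frac_ker s (x - y)) + 2 * b\<^sup>2 * ((v x - v y)\<^sup>2 * frac_ker s (x - y))"
    by (simp add: algebra_simps)
qed

text \<open>Below distance 1 the squared increment is at most \<open>L\<^sup>2\<close> times the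
  distance, hence controlled by \<open>near\<close>; above it, boundedness and \<open>far\<close>
  suffice. The second conclusion is exported because the energy of the test bumps is estimated with
  it.\<close>

lemma lipschitz_compact_support_Hs:
  fixes \<eta> :: "'a::euclidean_space \<Rightarrow> real"
  assumes s: "0 < s" "s \<le> 1/4" and lip: "\<And>x y. \<bar>\<eta> x - \<eta> y\<bar> \<le> L * norm (x - y)"
    and S: "S \<in> sets lebesgue" "bounded S" and supp: "\<And>x. x \<notin> S \<Longrightarrow> \<eta> x = 0" and M: "\<And>x. \<bar>\<eta> x\<bar> \<le> M"
  shows "\<eta> \<in> frac_Hs s"
    and "\<And>x y. norm (x - y) < 1 \<Longrightarrow> (\<eta> x - \<eta> y)\<^sup>2 * frac_ker s (x - y) \<le> L\<^sup>2 * ((indicator S x + indicator S y) * near s 1 (x - y))"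
proof -
  have fin: "emeasure lebesgue S < \<infinity>" using S by (metis emeasure_bounded_finite emeasure_completion sets_completionI_sets fmeasurableD2 bounded_set_imp_lmeasurable infinity_ennreal_def less_top)
  have iS: "integrable lebesgue (indicat_real S)" using S fin by simp
  have L: "0 \<le> L"
  proof -
    obtain e :: 'a where "norm e = 1" using vector_choose_size[of 1] by auto
    then show ?thesis using lip[of e 0] by simp
  qed
  have M0: "0 \<le> M" using M[of 0] by simp
  have "continuous_on UNIV \<eta>"
    unfolding continuous_on_iff
  proof (intro ballI allI impI)
    fix x and e :: real assume e: "0 < e"
    have "dist (\<eta> y) (\<eta> x) < e" if "dist y x < e / (L + 1)" for y
    proof -
      have "dist (\<eta> y) (\<eta> x) \<le> L * dist y x" using lip[of y x] by (simp add: dist_norm)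
      also have "\<dots> \<le> (L + 1) * dist y x" using L by (intro mult_right_mono) auto
      also have "\<dots> < (L + 1) * (e / (L + 1))" using L that by (intro mult_strict_left_mono) auto
      finally show ?thesis using L by simp
    qed
    then show "\<exists>d>0. \<forall>x'\<in>UNIV. dist x' x < d \<longrightarrow> dist (\<eta> x') (\<eta> x) < e"
      using L e by (intro exI[of _ "e / (L + 1)"]) auto
  qed
  then have m: "\<eta> \<in> borel_measurable lebesgue" by (simp add: borel_measurable_continuous_onI)
  show near: "(\<eta> x - \<eta> y)\<^sup>2 * frac_ker s (x - y) \<le> L\<^sup>2 * ((indicator S x + indicator S y) * near s 1 (x - y))"
    if d: "norm (x - y) < 1" for x y
  proof (cases "x \<in> S \<or> y \<in> S")
    case True
    have "(\<eta> x - \<eta> y)\<^sup>2 \<le> (L * norm (x - y))\<^sup>2"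
      using lip[of x y] by (metis abs_ge_zero power2_abs power_mono)
    also have "\<dots> = L\<^sup>2 * (norm (x - y) * norm (x - y))" by (simp add: power2_eq_square mult_ac)
    also have "\<dots> \<le> L\<^sup>2 * (norm (x - y) * 1)" using d by (intro mult_left_mono) auto
    finally have "(\<eta> x - \<eta> y)\<^sup>2 * frac_ker s (x - y) \<le> L\<^sup>2 * (norm (x - y) * 1) * frac_ker s (x - y)"
      by (intro mult_right_mono) auto
    also have "\<dots> = L\<^sup>2 * (1 * near s 1 (x - y))" using d by (simp add: near_def indicator_def)
    also have "\<dots> \<le> L\<^sup>2 * ((indicator S x + indicator S y) * near s 1 (x - y))"
      using True by (intro mult_left_mono mult_right_mono) (auto simp: indicator_def)
    finally show ?thesis .
  next
    case False
    then show ?thesis using supp by simp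
  qed
  show "\<eta> \<in> frac_Hs s"
  proof (rule frac_HsI)
    show "integrable lebesgue (\<lambda>x. (\<eta> x)\<^sup>2)"
    proof (rule Bochner_Integration.integrable_bound)
      show "integrable lebesgue (\<lambda>x. M\<^sup>2 * indicat_real S x)" using iS by simp
      show "(\<lambda>x. (\<eta> x)\<^sup>2) \<in> borel_measurable lebesgue" using m by measurable
      have "(\<eta> x)\<^sup>2 \<le> M\<^sup>2" for x using M[of x] by (metis abs_ge_zero power2_abs power_mono)
      then show "AE x in lebesgue. norm ((\<eta> x)\<^sup>2) \<le> norm (M\<^sup>2 * indicat_real S x)"
        using supp by (intro AE_I2) (auto simp: indicator_def)
    qed
    let ?n = "\<lambda>p. indicat_real S (fst p) * near s 1 (fst p - snd p) + indicat_real S (snd p) * near s 1 (fst p - snd p)"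
    let ?f = "\<lambda>p. indicat_real S (fst p) * far s 1 (fst p - snd p) + indicat_real S (snd p) * far s 1 (fst p - snd p)"
    have "integrable leb2 (\<lambda>p. L\<^sup>2 * ?n p + 4 * M\<^sup>2 * ?f p)"
      using near_weighted[OF iS zero_less_one s] far_weighted[OF iS zero_less_one s(1)] by (simp add: split_beta')
    then show "integrable leb2 (\<lambda>(x, y). L\<^sup>2 * ((indicator S x + indicator S y) * near s 1 (x - y)) +
        4 * M\<^sup>2 * ((indicator S x + indicator S y) * far s 1 (x - y)))"
      by (simp add: split_beta' distrib_right)
    fix x y
    have ind0: "(0::real) \<le> indicator S x + indicator S y" by simp
    have nonneg: "0 \<le> L\<^sup>2 * ((indicator S x + indicator S y) * near s 1 (x - y))"
      "0 \<le> 4 * M\<^sup>2 * ((indicator S x + indicator S y) * far s 1 (x - y))" by (auto intro!: mult_nonneg_nonneg)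
    show "(\<eta> x - \<eta> y)\<^sup>2 * frac_ker s (x - y) \<le> L\<^sup>2 * ((indicator S x + indicator S y) * near s 1 (x - y)) +
        4 * M\<^sup>2 * ((indicator S x + indicator S y) * far s 1 (x - y))"
    proof (cases "norm (x - y) < 1")
      case True
      then show ?thesis using near[OF True] nonneg by linarith
    next
      case False
      then have f: "far s 1 (x - y) = frac_ker s (x - y)" by (simp add: far_def indicator_def)
      have "(\<eta> x - \<eta> y)\<^sup>2 * frac_ker s (x - y) \<le> 4 * M\<^sup>2 * ((indicator S x + indicator S y) * frac_ker s (x - y))"
      proof (cases "x \<in> S \<or> y \<in> S")
        case True
        have "\<bar>\<eta> x - \<eta> y\<bar> \<le> 2 * M" using M[of x] M[of y] by linarith
        then have "(\<eta> x - \<eta> y)\<^sup>2 \<le> (2 * M)\<^sup>2" by (metis abs_ge_zero power2_abs power_mono)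
        then have "(\<eta> x - \<eta> y)\<^sup>2 * frac_ker s (x - y) \<le> 4 * M\<^sup>2 * (1 * frac_ker s (x - y))"
          by (simp add: mult_right_mono power2_eq_square)
        also have "\<dots> \<le> 4 * M\<^sup>2 * ((indicator S x + indicator S y) * frac_ker s (x - y))"
          using True by (intro mult_left_mono mult_right_mono) (auto simp: indicator_def)
        finally show ?thesis .
      qed (use supp in simp)
      then show ?thesis using nonneg(1) unfolding f by linarith
    qed
  qed (fact m)
qed

section \<open>A comparison principle\<close>

text \<open>From \<open>\<bar>t\<bar> \<le> t\<^sup>2 + 1\<close> on the bounded set \<Omega>; under
  L2 normalisation the same inequality later gives bounds free of s.\<close>

lemma H0s_integrable:
  fixes \<Omega> :: "'a::euclidean_space set"
  assumes "open \<Omega>" "bounded \<Omega>" "\<phi> \<in> frac_H0s s \<Omega>"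
  shows "integrable lebesgue \<phi>"
proof (rule Bochner_Integration.integrable_bound)
  have i\<Omega>: "integrable lebesgue (indicat_real \<Omega>)"
    using assms(1,2) lmeasurable_open[of \<Omega>] by (simp add: fmeasurable_def)
  show "integrable lebesgue (\<lambda>x. (\<phi> x)\<^sup>2 + indicat_real \<Omega> x)"
    using assms i\<Omega> by (auto simp: frac_H0s_def frac_Hs_iff)
  show "\<phi> \<in> borel_measurable lebesgue" using assms by (auto simp: frac_H0s_def frac_Hs_iff)
  have "AE x in lebesgue. x \<notin> \<Omega> \<longrightarrow> \<phi> x = 0" using assms by (simp add: frac_H0s_def)
  then show "AE x in lebesgue. norm (\<phi> x) \<le> norm ((\<phi> x)\<^sup>2 + indicat_real \<Omega> x)"
  proof eventually_elim
    case (elim x)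
    have "\<bar>\<phi> x\<bar> \<le> (\<phi> x)\<^sup>2 + 1" using sum_squares_bound[of "\<bar>\<phi> x\<bar>" 1] abs_ge_zero[of "\<phi> x"]
      unfolding power2_abs by simp
    then show ?case using elim by (cases "x \<in> \<Omega>") auto
  qed
qed

text \<open>The truncation \<open>v = max 0 (\<phi> - \<psi>)\<close> is admissible, and \<open>F\<close> below satisfies
  \<open>F x y + F y x \<le> (\<phi> x - \<phi> y) * (v x - v y) * frac_ker s (x - y)\<close> with \<open>F\<close> integrable.\<close>

lemma comparison:
  fixes \<Omega> :: "'a::euclidean_space set" and \<phi> \<psi> :: "'a \<Rightarrow> real"
  assumes \<Omega>: "open \<Omega>" "bounded \<Omega>" and s: "0 < s" "s \<le> 1/4"
    and \<phi>: "\<phi> \<in> frac_H0s s \<Omega>"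
    and weak: "\<And>v. v \<in> frac_H0s s \<Omega> \<Longrightarrow> energy s \<phi> v = 2 * \<mu> * (\<integral>x. \<phi> x * v x \<partial>lebesgue)"
    and lip: "\<And>x y. \<bar>\<psi> x - \<psi> y\<bar> \<le> L * norm (x - y)"
    and out: "\<And>x. x \<notin> \<Omega> \<Longrightarrow> \<psi> x = b" and b: "0 < b" "\<And>x. b \<le> \<psi> x" and M: "\<And>x. \<psi> x \<le> M"
    and qr: "0 < q" "q \<le> r"
    and strict: "AE x in lebesgue. \<psi> x < \<phi> x \<longrightarrow>
       \<mu> * \<phi> x < tail TYPE('a) s r * \<phi> x - (\<integral>y. \<phi> y * far s r (x - y) \<partial>lebesgue)
         + (\<integral>y. (\<psi> x - \<psi> y) * (indicator {y. norm (x - y) < r} y * frac_ker s (x - y)) \<partial>lebesgue)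
         + b * (\<integral>y. indicator {y. y \<notin> \<Omega> \<and> q \<le> norm (x - y) \<and> norm (x - y) < r} y * frac_ker s (x - y) \<partial>lebesgue)"
  shows "AE x in lebesgue. \<phi> x \<le> \<psi> x"
proof -
  define v where "v x = max 0 (\<phi> x - \<psi> x)" for x
  have r: "0 < r" using qr by simp
  have \<phi>H: "\<phi> \<in> frac_Hs s" and \<phi>0: "AE x in lebesgue. x \<notin> \<Omega> \<longrightarrow> \<phi> x = 0"
    using \<phi> by (auto simp: frac_H0s_def)
  have \<phi>m [measurable]: "\<phi> \<in> borel_measurable lebesgue" and \<phi>sq: "integrable lebesgue (\<lambda>x. (\<phi> x)\<^sup>2)"
    using \<phi>H by (auto simp: frac_Hs_iff)
  \<comment> \<open>Outside \<Omega> the barrier equals the positive constant \<open>b\<close> and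
    is not square integrable; after subtracting \<open>b\<close> it has bounded support.\<close>
  have \<eta>: "(\<lambda>x. \<psi> x - b) \<in> frac_Hs s"
  proof (rule lipschitz_compact_support_Hs(1)[OF s, of _ L \<Omega> "M - b"])
    show "\<bar>\<psi> x - b\<bar> \<le> M - b" for x using b(2)[of x] M[of x] by simp
  qed (use lip out \<Omega> in auto)
  then have "(\<lambda>x. (\<psi> x - b) + b) \<in> borel_measurable lebesgue"
    by (intro borel_measurable_add) (auto simp: frac_Hs_iff)
  then have \<psi>m [measurable]: "\<psi> \<in> borel_measurable lebesgue" by simp
  have vm [measurable]: "v \<in> borel_measurable lebesgue" unfolding v_def by measurable
  have v0: "0 \<le> v x" for x by (simp add: v_def)
  have v\<phi>: "v x \<le> \<bar>\<phi> x\<bar>" for x using b(1) b(2)[of x] by (simp add: v_def)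
  have v\<phi>v: "v x * \<phi> x \<ge> 0" for x using b(1) b(2)[of x] by (auto simp: v_def max_def)
  have vsq_le: "(v x)\<^sup>2 \<le> (\<phi> x)\<^sup>2" for x
    using v\<phi>[of x] v0[of x] by (metis power2_abs power_mono)
  have vsq: "integrable lebesgue (\<lambda>x. (v x)\<^sup>2)"
    by (rule Bochner_Integration.integrable_bound[OF \<phi>sq]) (use vsq_le in auto)
  have vH: "v \<in> frac_Hs s"
  proof (rule frac_HsI[OF vm vsq])
    have "integrable leb2 (\<lambda>(x, y). (\<phi> x - \<phi> y - (\<psi> x - \<psi> y))\<^sup>2 * frac_ker s (x - y))"
      using frac_Hs_lin[OF \<phi>H \<eta>, of 1 "-1"] by (simp add: frac_Hs_iff algebra_simps)
    then show "integrable leb2 (\<lambda>(x, y). (\<phi> x - \<phi> y - (\<psi> x - \<psi> y))\<^sup>2 * frac_ker s (x - y))" .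
    fix x y
    \<comment> \<open>Truncation is 1-Lipschitz, so \<open>v\<close> has smaller increments than
      \<open>\<phi> - \<psi>\<close>, which differs from an element of the energy space by a
      constant.\<close>
    have "\<bar>v x - v y\<bar> \<le> \<bar>\<phi> x - \<phi> y - (\<psi> x - \<psi> y)\<bar>" unfolding v_def by linarith
    then have "(v x - v y)\<^sup>2 \<le> (\<phi> x - \<phi> y - (\<psi> x - \<psi> y))\<^sup>2" by (metis abs_ge_zero power2_abs power_mono)
    then show "(v x - v y)\<^sup>2 * frac_ker s (x - y) \<le> (\<phi> x - \<phi> y - (\<psi> x - \<psi> y))\<^sup>2 * frac_ker s (x - y)"
      by (rule mult_right_mono) simp
  qed
  have "AE x in lebesgue. x \<notin> \<Omega> \<longrightarrow> v x = 0"
    using \<phi>0 by eventually_elim (use out b(1) in \<open>auto simp: v_def\<close>)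
  then have v: "v \<in> frac_H0s s \<Omega>" using vH by (simp add: frac_H0s_def)
  have vint: "integrable lebesgue v" by (rule H0s_integrable[OF \<Omega> v])
  have v\<phi>int: "integrable lebesgue (\<lambda>x. v x * \<phi> x)"
  proof (rule Bochner_Integration.integrable_bound[OF \<phi>sq])
    have "\<bar>v x * \<phi> x\<bar> \<le> (\<phi> x)\<^sup>2" for x
      using mult_right_mono[OF v\<phi>[of x], of "\<bar>\<phi> x\<bar>"] v0[of x] by (simp add: abs_mult power2_eq_square)
    then show "AE x in lebesgue. norm (v x * \<phi> x) \<le> norm ((\<phi> x)\<^sup>2)" by simp
  qed measurable

  \<comment> \<open>Each \<open>F\<close> carries the weight \<open>v\<close> at one point only, so
    that Fubini turns its integral into the pointwise expression of \<open>strict\<close>. Far away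
    the kernel is integrable and the product is expanded in \<open>F1\<close> and \<open>F2\<close>;
    nearby \<phi> is replaced by the Lipschitz function \<psi> in \<open>F3\<close>, while
    \<open>F4\<close> collects the exterior points. The cutoff \<open>q\<close> keeps
    \<open>F4\<close> integrable.\<close>
  define F1 where "F1 x y = v x * \<phi> x * far s r (x - y)" for x y
  define F2 where "F2 x y = v x * (\<phi> y * far s r (x - y))" for x y
  define F3 where "F3 x y = v x * ((\<psi> x - \<psi> y) * (indicator {y. norm (x - y) < r} y * frac_ker s (x - y)))" for x y
  define F4 where "F4 x y = v x * (indicator {y. y \<notin> \<Omega> \<and> q \<le> norm (x - y) \<and> norm (x - y) < r} y * frac_ker s (x - y))" for x y
  define F where "F x y = F1 x y - F2 x y + F3 x y + b * F4 x y" for x y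
  note mfst = leb2_measurable_fst[OF vm, unfolded split_beta'] leb2_measurable_fst[OF \<phi>m, unfolded split_beta']
    leb2_measurable_fst[OF \<psi>m, unfolded split_beta'] leb2_measurable_snd[OF \<phi>m, unfolded split_beta']
    leb2_measurable_snd[OF \<psi>m, unfolded split_beta']
    leb2_measurable_diff[OF far_measurable, unfolded split_beta'] leb2_measurable_diff[OF borel_measurable_frac_ker, unfolded split_beta']
  have i1: "integrable leb2 (\<lambda>(x, y). F1 x y)"
    unfolding F1_def using far_weighted(1)[OF v\<phi>int r s(1)] .
  have i2: "integrable leb2 (\<lambda>(x, y). F2 x y)"
  proof (rule Bochner_Integration.integrable_bound)
    show "integrable leb2 (\<lambda>p. (case p of (x, y) \<Rightarrow> (v x)\<^sup>2 * far s r (x - y)) + (case p of (x, y) \<Rightarrow> (\<phi> y)\<^sup>2 * far s r (x - y)))"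
      by (intro Bochner_Integration.integrable_add far_weighted vsq \<phi>sq r s)
    show "(\<lambda>(x, y). F2 x y) \<in> borel_measurable leb2"
      unfolding F2_def split_beta' by (intro borel_measurable_times mfst)
    have "\<bar>a * (c * k)\<bar> \<le> \<bar>a\<^sup>2 * k + c\<^sup>2 * k\<bar>" if "0 \<le> k" for a c k :: real
    proof -
      have "2 * \<bar>a * c\<bar> \<le> a\<^sup>2 + c\<^sup>2" using sum_squares_bound[of "\<bar>a\<bar>" "\<bar>c\<bar>"] by (simp add: abs_mult)
      then have "\<bar>a * c\<bar> \<le> a\<^sup>2 + c\<^sup>2" by linarith
      then have "\<bar>a * c\<bar> * k \<le> (a\<^sup>2 + c\<^sup>2) * k" using that by (rule mult_right_mono)
      then show ?thesis using that by (simp add: abs_mult distrib_right mult.assoc)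
    qed
    then show "AE p in leb2. norm (case p of (x, y) \<Rightarrow> F2 x y)
        \<le> norm ((case p of (x, y) \<Rightarrow> (v x)\<^sup>2 * far s r (x - y)) + (case p of (x, y) \<Rightarrow> (\<phi> y)\<^sup>2 * far s r (x - y)))"
      by (intro AE_I2) (auto simp: F2_def split: prod.split)
  qed
  have i3: "integrable leb2 (\<lambda>(x, y). F3 x y)"
  proof (rule Bochner_Integration.integrable_bound)
    show "integrable leb2 (\<lambda>p. L * (case p of (x, y) \<Rightarrow> v x * near s r (x - y)))"
      by (intro integrable_mult_right near_weighted vint r s)
    have "(\<lambda>p. indicat_real {z. norm z < r} (fst p - snd p)) \<in> borel_measurable leb2"
      using leb2_measurable_diff[of "indicat_real {z. norm z < r}"] by (simp add: split_beta')
    then have "(\<lambda>p. v (fst p) * ((\<psi> (fst p) - \<psi> (snd p)) * (indicator {z. norm z < r} (fst p - snd p) * frac_ker s (fst p - snd p)))) \<in> borel_measurable leb2"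
      by (intro borel_measurable_times borel_measurable_diff mfst)
    then show "(\<lambda>(x, y). F3 x y) \<in> borel_measurable leb2"
      unfolding F3_def split_beta' by (simp add: indicator_def)
    have "\<bar>F3 x y\<bar> \<le> \<bar>L * (v x * near s r (x - y))\<bar>" for x y
    proof (cases "norm (x - y) < r")
      case True
      have "\<bar>\<psi> x - \<psi> y\<bar> * (v x * frac_ker s (x - y)) \<le> L * norm (x - y) * (v x * frac_ker s (x - y))"
        using v0[of x] by (intro mult_right_mono lip) auto
      then have "\<bar>F3 x y\<bar> \<le> L * (v x * near s r (x - y))" using True v0[of x]
        by (simp add: F3_def near_def abs_mult mult_ac)
      then show ?thesis by simp
    qed (simp add: F3_def)
    then show "AE p in leb2. norm (case p of (x, y) \<Rightarrow> F3 x y) \<le> norm (L * (case p of (x, y) \<Rightarrow> v x * near s r (x - y)))"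
      by (intro AE_I2) (auto split: prod.split)
  qed
  have i4: "integrable leb2 (\<lambda>(x, y). F4 x y)"
  proof (rule Bochner_Integration.integrable_bound)
    show "integrable leb2 (\<lambda>(x, y). v x * far s q (x - y))"
      by (intro far_weighted vint qr s)
    have "(\<lambda>p. indicat_real {z. q \<le> norm z \<and> norm z < r} (fst p - snd p)) \<in> borel_measurable leb2"
      using leb2_measurable_diff[of "indicat_real {z. q \<le> norm z \<and> norm z < r}"] by (simp add: split_beta')
    moreover have "(\<lambda>p. indicat_real (- \<Omega>) (snd p)) \<in> borel_measurable leb2"
      using leb2_measurable_snd[of "indicat_real (- \<Omega>)"] \<Omega> by (simp add: split_beta')
    ultimately have "(\<lambda>p. v (fst p) * (indicator (- \<Omega>) (snd p) * (indicator {z. q \<le> norm z \<and> norm z < r} (fst p - snd p)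
        * frac_ker s (fst p - snd p)))) \<in> borel_measurable leb2"
      by (intro borel_measurable_times mfst)
    also have "(\<lambda>p. v (fst p) * (indicator (- \<Omega>) (snd p) * (indicator {z. q \<le> norm z \<and> norm z < r} (fst p - snd p)
        * frac_ker s (fst p - snd p)))) = (\<lambda>(x, y). F4 x y)"
      by (auto simp: fun_eq_iff F4_def indicator_def)
    finally show "(\<lambda>(x, y). F4 x y) \<in> borel_measurable leb2" .
    show "AE p in leb2. norm (case p of (x, y) \<Rightarrow> F4 x y) \<le> norm (case p of (x, y) \<Rightarrow> v x * far s q (x - y))"
      using v0 by (intro AE_I2) (auto simp: F4_def far_def indicator_def split: prod.split)
  qed
  have iF: "integrable leb2 (\<lambda>(x, y). F x y)"
    using i1 i2 i3 i4 unfolding F_def split_beta' by auto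

  define I2 where "I2 x = (\<integral>y. \<phi> y * far s r (x - y) \<partial>lebesgue)" for x
  define I3 where "I3 x = (\<integral>y. (\<psi> x - \<psi> y) * (indicator {y. norm (x - y) < r} y * frac_ker s (x - y)) \<partial>lebesgue)" for x
  define I4 where "I4 x = (\<integral>y. indicator {y. y \<notin> \<Omega> \<and> q \<le> norm (x - y) \<and> norm (x - y) < r} y * frac_ker s (x - y) \<partial>lebesgue)" for x
  note f1 = lebesgue_pair.integrable_fst[OF i1] lebesgue_pair.integral_fst[OF i1]
  note f2 = lebesgue_pair.integrable_fst[OF i2] lebesgue_pair.integral_fst[OF i2]
  note f3 = lebesgue_pair.integrable_fst[OF i3] lebesgue_pair.integral_fst[OF i3]
  note f4 = lebesgue_pair.integrable_fst[OF i4] lebesgue_pair.integral_fst[OF i4]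
  have e1: "(\<integral>y. F1 x y \<partial>lebesgue) = v x * \<phi> x * tail TYPE('a) s r" for x by (simp add: F1_def far_integral)
  have e2: "(\<integral>y. F2 x y \<partial>lebesgue) = v x * I2 x" for x by (simp add: F2_def I2_def)
  have e3: "(\<integral>y. F3 x y \<partial>lebesgue) = v x * I3 x" for x by (simp add: F3_def I3_def)
  have e4: "(\<integral>y. F4 x y \<partial>lebesgue) = v x * I4 x" for x by (simp add: F4_def I4_def)
  define Hf where "Hf x = tail TYPE('a) s r * \<phi> x - I2 x + I3 x + b * I4 x" for x
  have iH: "integrable lebesgue (\<lambda>x. v x * Hf x)"
  proof -
    have "integrable lebesgue (\<lambda>x. v x * \<phi> x * tail TYPE('a) s r - v x * I2 x + v x * I3 x + b * (v x * I4 x))"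
      using f1(1) f2(1) f3(1) f4(1) unfolding e1 e2 e3 e4 by auto
    then show ?thesis by (simp add: Hf_def algebra_simps)
  qed
  have intF: "(\<integral>(x, y). F x y \<partial>leb2) = (\<integral>x. v x * Hf x \<partial>lebesgue)"
  proof -
    have "(\<integral>(x, y). F x y \<partial>leb2) = (\<integral>(x, y). F1 x y \<partial>leb2) - (\<integral>(x, y). F2 x y \<partial>leb2) + (\<integral>(x, y). F3 x y \<partial>leb2) + b * (\<integral>(x, y). F4 x y \<partial>leb2)"
      using i1 i2 i3 i4 unfolding F_def split_beta' by simp
    also have "\<dots> = (\<integral>x. v x * \<phi> x * tail TYPE('a) s r \<partial>lebesgue) - (\<integral>x. v x * I2 x \<partial>lebesgue) + (\<integral>x. v x * I3 x \<partial>lebesgue) + b * (\<integral>x. v x * I4 x \<partial>lebesgue)"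
      unfolding f1(2)[symmetric] f2(2)[symmetric] f3(2)[symmetric] f4(2)[symmetric] e1 e2 e3 e4 ..
    also have "\<dots> = (\<integral>x. v x * \<phi> x * tail TYPE('a) s r - v x * I2 x + v x * I3 x + b * (v x * I4 x) \<partial>lebesgue)"
      using f1(1) f2(1) f3(1) f4(1) unfolding e1 e2 e3 e4 by simp
    also have "\<dots> = (\<integral>x. v x * Hf x \<partial>lebesgue)" by (simp add: Hf_def algebra_simps)
    finally show ?thesis .
  qed
  have pointwise: "F x y + F y x \<le> (\<phi> x - \<phi> y) * (v x - v y) * frac_ker s (x - y)"
    if x0: "x \<notin> \<Omega> \<longrightarrow> \<phi> x = 0" and y0: "y \<notin> \<Omega> \<longrightarrow> \<phi> y = 0" for x y
  proof (cases "norm (x - y) < r")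
    case False
    then have "F x y + F y x = v x * \<phi> x * frac_ker s (x - y) - v x * (\<phi> y * frac_ker s (x - y))
        + (v y * \<phi> y * frac_ker s (x - y) - v y * (\<phi> x * frac_ker s (x - y)))"
      by (simp add: F_def F1_def F2_def F3_def F4_def far_def norm_minus_commute[of y x] frac_ker_minus[of s y x])
    then show ?thesis by (simp add: algebra_simps)
  next
    case True
    define iy where "iy = (of_bool (y \<notin> \<Omega> \<and> q \<le> norm (x - y)) :: real)"
    define ix where "ix = (of_bool (x \<notin> \<Omega> \<and> q \<le> norm (x - y)) :: real)"
    have "F x y + F y x = (v x * (\<psi> x - \<psi> y) + v y * (\<psi> y - \<psi> x) + b * v x * iy + b * v y * ix) * frac_ker s (x - y)"
      using True by (simp add: F_def F1_def F2_def F3_def F4_def far_def norm_minus_commute[of y x] frac_ker_minus[of s y x]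
        iy_def ix_def indicator_def algebra_simps)
    also have "\<dots> \<le> (\<phi> x - \<phi> y) * (v x - v y) * frac_ker s (x - y)"
    proof (rule mult_right_mono)
      \<comment> \<open>The excess left after \<phi> is replaced by \<psi>. It is nonnegative
        because \<open>v\<close> is a nondecreasing function of \<open>\<phi> - \<psi>\<close>. If
        one point is exterior, then \<open>\<phi> - \<psi> = - b\<close> and \<open>v = 0\<close>
        there, and the excess is at least \<open>b\<close> times \<open>v\<close> at the other
        point.\<close>
      have ww: "0 \<le> (\<phi> x - \<psi> x - (\<phi> y - \<psi> y)) * (v x - v y)"
        by (auto simp: v_def max_def zero_le_mult_iff mult_nonneg_nonneg mult_nonpos_nonpos)
      have vx: "v x * (\<phi> x - \<psi> x) \<ge> 0" "v y * (\<phi> y - \<psi> y) \<ge> 0" by (auto simp: v_def max_def)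
      have "b * v x * iy + b * v y * ix \<le> (\<phi> x - \<psi> x - (\<phi> y - \<psi> y)) * (v x - v y)"
      proof (cases "y \<in> \<Omega>")
        case True
        show ?thesis
        proof (cases "x \<in> \<Omega>")
          case x: True
          then show ?thesis using True ww by (simp add: iy_def ix_def)
        next
          case False
          then have "v x = 0" "\<phi> x - \<psi> x = - b" using x0 out b(1) by (auto simp: v_def)
          moreover have "b * v y * ix \<le> b * v y" using b(1) v0[of y] by (auto simp: ix_def)
          moreover have "(- b - (\<phi> y - \<psi> y)) * (0 - v y) = b * v y + v y * (\<phi> y - \<psi> y)"
            by (simp add: algebra_simps)
          ultimately show ?thesis using vx(2) True by (simp add: iy_def)
        qed
      next
        case False
        then have y: "v y = 0" "\<phi> y - \<psi> y = - b" using y0 out b(1) by (auto simp: v_def)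
        moreover have "b * v x * iy \<le> b * v x" using b(1) v0[of x] by (auto simp: iy_def)
        moreover have "(\<phi> x - \<psi> x + b) * v x = v x * (\<phi> x - \<psi> x) + b * v x"
          by (simp add: algebra_simps)
        ultimately show ?thesis using vx(1) by simp
      qed
      then show "v x * (\<psi> x - \<psi> y) + v y * (\<psi> y - \<psi> x) + b * v x * iy + b * v y * ix \<le> (\<phi> x - \<phi> y) * (v x - v y)"
        by (simp add: algebra_simps)
    qed simp
    finally show ?thesis .
  qed
  \<comment> \<open>Symmetrisation: \<open>F x y\<close> and \<open>F y x\<close> have equal
    integrals, and it is their sum that the energy density dominates.\<close>
  have "2 * (\<integral>x. v x * Hf x \<partial>lebesgue) = (\<integral>(x, y). F x y \<partial>leb2) + (\<integral>(x, y). F y x \<partial>leb2)"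
    using intF integrable_leb2_swap(2)[OF iF] by simp
  also have "\<dots> = (\<integral>(x, y). F x y + F y x \<partial>leb2)"
    using iF integrable_leb2_swap(1)[OF iF] by (simp add: split_beta')
  also have "\<dots> \<le> energy s \<phi> v"
    unfolding energy_def
  proof (rule integral_mono_AE)
    show "integrable leb2 (\<lambda>(x, y). F x y + F y x)"
      using iF integrable_leb2_swap(1)[OF iF] by (simp add: split_beta')
    show "integrable leb2 (\<lambda>(x, y). (\<phi> x - \<phi> y) * (v x - v y) * frac_ker s (x - y))"
      by (rule energy_integrable[OF \<phi>H vH])
    show "AE p in leb2. (case p of (x, y) \<Rightarrow> F x y + F y x) \<le> (case p of (x, y) \<Rightarrow> (\<phi> x - \<phi> y) * (v x - v y) * frac_ker s (x - y))"
      using AE_leb2_fst[OF \<phi>0] AE_leb2_snd[OF \<phi>0]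
      by eventually_elim (use pointwise in \<open>auto split: prod.splits\<close>)
  qed
  also have "\<dots> = 2 * \<mu> * (\<integral>x. v x * \<phi> x \<partial>lebesgue)" using weak[OF v] by (simp add: mult.commute)
  finally have le: "(\<integral>x. v x * Hf x - \<mu> * (v x * \<phi> x) \<partial>lebesgue) \<le> 0"
    using iH v\<phi>int by simp
  \<comment> \<open>The integrand is positive wherever \<open>v\<close> is and zero elsewhere, yet
    \<open>le\<close> bounds its integral by 0; so \<open>v\<close> vanishes almost
    everywhere.\<close>
  have pos: "AE x in lebesgue. 0 < v x \<longrightarrow> 0 < v x * Hf x - \<mu> * (v x * \<phi> x)"
    using strict
  proof eventually_elim
    case (elim x)
    show ?case
    proof
      assume "0 < v x"
      then have "\<mu> * \<phi> x < Hf x" using elim by (auto simp: v_def Hf_def I2_def I3_def I4_def)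
      then have "v x * (\<mu> * \<phi> x) < v x * Hf x" using \<open>0 < v x\<close> by (rule mult_strict_left_mono)
      then show "0 < v x * Hf x - \<mu> * (v x * \<phi> x)" by (simp add: mult_ac)
    qed
  qed
  then have nonneg: "AE x in lebesgue. 0 \<le> v x * Hf x - \<mu> * (v x * \<phi> x)"
    by eventually_elim (use v0 in \<open>metis diff_zero less_eq_real_def mult_zero_left mult_zero_right\<close>)
  have "integrable lebesgue (\<lambda>x. v x * Hf x - \<mu> * (v x * \<phi> x))" using iH v\<phi>int by simp
  moreover have "(\<integral>x. v x * Hf x - \<mu> * (v x * \<phi> x) \<partial>lebesgue) = 0"
    using le integral_nonneg_AE[OF nonneg] by simp
  ultimately have "AE x in lebesgue. v x * Hf x - \<mu> * (v x * \<phi> x) = 0"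
    using integral_nonneg_eq_0_iff_AE nonneg by blast
  then show ?thesis using pos
  proof eventually_elim
    case (elim x)
    then have "\<not> 0 < v x" by auto
    then show ?case by (auto simp: v_def)
  qed
qed

section \<open>Uniform bound and boundary decay\<close>

text \<open>Here \<mu> is the eigenvalue divided by \<open>frac_const\<close>, and the factor 2
  undoes the one half in \<open>frac_form\<close>. The integral may run over the whole space because
  the functions vanish almost everywhere outside \<Omega>.\<close>

definition weak_solution :: "real \<Rightarrow> 'a::euclidean_space set \<Rightarrow> real \<Rightarrow> ('a \<Rightarrow> real) \<Rightarrow> bool" where
  "weak_solution s \<Omega> \<mu> \<phi> \<longleftrightarrow> \<phi> \<in> frac_H0s s \<Omega> \<and>
     (\<forall>v\<in>frac_H0s s \<Omega>. energy s \<phi> v = 2 * \<mu> * (\<integral>x. \<phi> x * v x \<partial>lebesgue)) \<and> (\<integral>x. (\<phi> x)\<^sup>2 \<partial>lebesgue) = 1"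

text \<open>Lets one-sided bounds be applied to both signs.\<close>

lemma weak_solution_uminus:
  assumes "weak_solution s \<Omega> \<mu> \<phi>" shows "weak_solution s \<Omega> \<mu> (\<lambda>x. - \<phi> x)"
proof -
  have "(\<lambda>x. - \<phi> x) \<in> frac_Hs s"
    using assms frac_Hs_lin[of \<phi> s \<phi> "-1" 0] by (auto simp: weak_solution_def frac_H0s_def)
  moreover have "energy s (\<lambda>x. - \<phi> x) v = - energy s \<phi> v" for v
  proof -
    have "(\<lambda>(x, y). (- \<phi> x - - \<phi> y) * (v x - v y) * frac_ker s (x - y))
        = (\<lambda>p. - (case p of (x, y) \<Rightarrow> (\<phi> x - \<phi> y) * (v x - v y) * frac_ker s (x - y)))"
      by (auto simp: fun_eq_iff algebra_simps)
    then show ?thesis unfolding energy_def by simp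
  qed
  ultimately show ?thesis using assms by (auto simp: weak_solution_def frac_H0s_def)
qed

text \<open>As \<open>2 * s \<le> 1\<close>, the kernel beyond distance \<open>1 / 2 ^ p\<close> is
  at most \<open>(2 ^ p) ^ (N + 1)\<close>, and the modulus of \<phi> is at most the sum of its
  square and the indicator of \<Omega>. The result is free of s and \<mu>, which makes
  \<open>sup_bound\<close> uniform.\<close>

lemma far_average_le:
  fixes \<Omega> :: "'a::euclidean_space set"
  assumes \<Omega>: "open \<Omega>" "bounded \<Omega>" and s: "0 < s" "s \<le> 1/4" and w: "weak_solution s \<Omega> \<mu> \<phi>"
  shows "(\<integral>y. \<phi> y * far s (1 / 2 ^ p) (x - y) \<partial>lebesgue) \<le> (2 ^ p) ^ (DIM('a) + 1) * (1 + measure lebesgue \<Omega>)"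
proof -
  define B where "B = (2 ^ p :: real) ^ (DIM('a) + 1)"
  have B: "0 \<le> B" by (simp add: B_def)
  have \<phi>: "\<phi> \<in> frac_H0s s \<Omega>" using w by (simp add: weak_solution_def)
  have i\<phi>: "integrable lebesgue \<phi>" by (rule H0s_integrable[OF \<Omega> \<phi>])
  have i\<Omega>: "integrable lebesgue (indicat_real \<Omega>)"
    using \<Omega> lmeasurable_open[of \<Omega>] by (simp add: fmeasurable_def)
  have sq: "integrable lebesgue (\<lambda>x. (\<phi> x)\<^sup>2)" using \<phi> by (simp add: frac_H0s_def frac_Hs_iff)
  have far_le: "far s (1 / 2 ^ p) z \<le> B" for z :: 'a
  proof (cases "1 / 2 ^ p \<le> norm z")
    case True
    have "frac_ker s z \<le> (1 / 2 ^ p) powr - (real DIM('a) + 2 * s)"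
      by (rule frac_ker_le) (use True s in auto)
    also have "\<dots> = (2 ^ p) powr (real DIM('a) + 2 * s)" unfolding powr_minus_divide by (simp add: powr_divide)
    also have "\<dots> \<le> (2 ^ p) powr (real (DIM('a) + 1))" using s by (intro powr_mono) auto
    also have "\<dots> = B" unfolding B_def by (subst powr_realpow) auto
    finally show ?thesis using True by (simp add: far_def)
  qed (use B in \<open>simp add: far_def\<close>)
  have "(\<integral>y. \<phi> y * far s (1 / 2 ^ p) (x - y) \<partial>lebesgue) \<le> (\<integral>y. B * ((\<phi> y)\<^sup>2 + indicat_real \<Omega> y) \<partial>lebesgue)"
  proof (rule integral_mono_AE)
    show "integrable lebesgue (\<lambda>y. B * ((\<phi> y)\<^sup>2 + indicat_real \<Omega> y))" using sq i\<Omega> by simp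
    show "integrable lebesgue (\<lambda>y. \<phi> y * far s (1 / 2 ^ p) (x - y))"
    proof (rule Bochner_Integration.integrable_bound)
      show "integrable lebesgue (\<lambda>y. B * \<phi> y)" using i\<phi> by simp
      have "(\<lambda>y. far s (1 / 2 ^ p) (x - y)) \<in> borel_measurable lebesgue" by simp
      then show "(\<lambda>y. \<phi> y * far s (1 / 2 ^ p) (x - y)) \<in> borel_measurable lebesgue"
        by (rule borel_measurable_times[OF borel_measurable_integrable[OF i\<phi>]])
      have "\<bar>\<phi> y\<bar> * far s (1 / 2 ^ p) (x - y) \<le> \<bar>\<phi> y\<bar> * B" for y by (intro mult_left_mono far_le) auto
      then show "AE y in lebesgue. norm (\<phi> y * far s (1 / 2 ^ p) (x - y)) \<le> norm (B * \<phi> y)"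
        using B by (auto simp: abs_mult mult.commute)
    qed
    have "AE x in lebesgue. x \<notin> \<Omega> \<longrightarrow> \<phi> x = 0" using \<phi> by (simp add: frac_H0s_def)
    then show "AE y in lebesgue. \<phi> y * far s (1 / 2 ^ p) (x - y) \<le> B * ((\<phi> y)\<^sup>2 + indicat_real \<Omega> y)"
    proof eventually_elim
      case (elim y)
      have "\<bar>\<phi> y\<bar> \<le> (\<phi> y)\<^sup>2 + 1" using sum_squares_bound[of "\<bar>\<phi> y\<bar>" 1] abs_ge_zero[of "\<phi> y"]
        unfolding power2_abs by simp
      then have "\<bar>\<phi> y\<bar> \<le> (\<phi> y)\<^sup>2 + indicat_real \<Omega> y" using elim by (cases "y \<in> \<Omega>") auto
      then have "\<bar>\<phi> y\<bar> * B \<le> ((\<phi> y)\<^sup>2 + indicat_real \<Omega> y) * B" using B by (rule mult_right_mono)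
      moreover have "\<phi> y * far s (1 / 2 ^ p) (x - y) \<le> \<bar>\<phi> y\<bar> * far s (1 / 2 ^ p) (x - y)"
        by (intro mult_right_mono) auto
      moreover have "\<bar>\<phi> y\<bar> * far s (1 / 2 ^ p) (x - y) \<le> \<bar>\<phi> y\<bar> * B" by (intro mult_left_mono far_le) auto
      ultimately show ?case by (simp add: mult.commute)
    qed
  qed
  also have "\<dots> = B * (1 + measure lebesgue \<Omega>)"
    using w sq i\<Omega> \<Omega> by (simp add: weak_solution_def)
  finally show ?thesis by (simp add: B_def)
qed

definition sup_bound :: "'a::euclidean_space set \<Rightarrow> nat \<Rightarrow> real" where
  "sup_bound \<Omega> p = (2 ^ p) ^ (DIM('a) + 1) * (1 + measure lebesgue \<Omega>)"

lemma sup_bound_pos: "0 < sup_bound \<Omega> p"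
  by (simp add: sup_bound_def add_pos_nonneg)

text \<open>A constant barrier: its differences vanish, and with both cutoffs equal to
  \<open>1 / 2 ^ p\<close> the exterior annulus is empty. Where \<phi> exceeds the constant, the
  surplus of at least 1 in \<open>tail - \<mu>\<close>, multiplied by \<phi>, already beats the far
  average.\<close>

lemma weak_solution_le_sup_bound:
  fixes \<Omega> :: "'a::euclidean_space set"
  assumes \<Omega>: "open \<Omega>" "bounded \<Omega>" and s: "0 < s" "s \<le> 1/4" and w: "weak_solution s \<Omega> \<mu> \<phi>"
    and \<mu>: "\<mu> + 1 \<le> tail TYPE('a) s (1 / 2 ^ p)"
  shows "AE x in lebesgue. \<phi> x \<le> sup_bound \<Omega> p"
proof (rule comparison[OF \<Omega> s, of \<phi> \<mu> "\<lambda>_. sup_bound \<Omega> p" 0 "sup_bound \<Omega> p" _ "1 / 2 ^ p" "1 / 2 ^ p"])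
  show "\<phi> \<in> frac_H0s s \<Omega>" "\<And>v. v \<in> frac_H0s s \<Omega> \<Longrightarrow> energy s \<phi> v = 2 * \<mu> * (\<integral>x. \<phi> x * v x \<partial>lebesgue)"
    using w by (auto simp: weak_solution_def)
  have empty: "{y. y \<notin> \<Omega> \<and> 1 / 2 ^ p \<le> norm (x - y) \<and> norm (x - y) < 1 / 2 ^ p} = {}" for x by auto
  have "\<mu> * \<phi> x < tail TYPE('a) s (1 / 2 ^ p) * \<phi> x - (\<integral>y. \<phi> y * far s (1 / 2 ^ p) (x - y) \<partial>lebesgue)"
    if x: "sup_bound \<Omega> p < \<phi> x" for x
  proof -
    have "0 < \<phi> x" using x sup_bound_pos[of \<Omega> p] by linarith
    then have "(\<mu> + 1) * \<phi> x \<le> tail TYPE('a) s (1 / 2 ^ p) * \<phi> x" using \<mu> by (intro mult_right_mono) auto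
    then show ?thesis using far_average_le[OF \<Omega> s w, of p x] x by (simp add: sup_bound_def distrib_right)
  qed
  then show "AE x in lebesgue. sup_bound \<Omega> p < \<phi> x \<longrightarrow> \<mu> * \<phi> x < tail TYPE('a) s (1 / 2 ^ p) * \<phi> x -
      (\<integral>y. \<phi> y * far s (1 / 2 ^ p) (x - y) \<partial>lebesgue) +
      (\<integral>y. (sup_bound \<Omega> p - sup_bound \<Omega> p) * (indicat_real {y. norm (x - y) < 1 / 2 ^ p} y * frac_ker s (x - y)) \<partial>lebesgue) +
      sup_bound \<Omega> p * (\<integral>y. indicat_real {y. y \<notin> \<Omega> \<and> 1 / 2 ^ p \<le> norm (x - y) \<and> norm (x - y) < 1 / 2 ^ p} y * frac_ker s (x - y) \<partial>lebesgue)"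
    by (simp add: empty)
qed (use sup_bound_pos[of \<Omega> p] in auto)

text \<open>The exterior ball at a boundary point \<open>w\<close> near x is shrunk to radius t / 8
  and its centre slid along the axis to distance 3t/4 from \<open>w\<close>. Since x is within t / 8
  of \<open>w\<close>, distances to x stay between 3t/4 - t/4 and 3t/4 + t/4, the two radii of the
  shell.\<close>

lemma exterior_ball_in_shell:
  fixes \<Omega> :: "'a::euclidean_space set"
  assumes \<Omega>: "open \<Omega>" "bounded \<Omega>"
    and R0: "0 < R0" "\<And>x. x \<in> frontier \<Omega> \<Longrightarrow> \<exists>c. ball c R0 \<subseteq> - closure \<Omega> \<and> cball c R0 \<inter> closure \<Omega> = {x}"
    and x: "x \<in> \<Omega>" "dist_compl \<Omega> x < t / 8" and t: "3 * t / 4 \<le> R0"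
  shows "\<exists>c. ball c (t / 8) \<subseteq> shell x t \<inter> - \<Omega>"
proof -
  have t0: "0 < t" using x infdist_nonneg[of x "- \<Omega>"] by (simp add: dist_compl_def)
  have "- \<Omega> \<noteq> {}" using \<Omega> not_bounded_UNIV by (metis Compl_empty_eq double_compl)
  then obtain z where z: "z \<in> - \<Omega>" "infdist x (- \<Omega>) = dist x z"
    using infdist_attains_inf[of "- \<Omega>" x] \<Omega> by (auto simp: closed_Compl)
  \<comment> \<open>The nearest point of the complement is replaced by a frontier point on the
    segment, which is no farther from x and at which the exterior ball is available.\<close>
  have "closed_segment x z \<inter> frontier \<Omega> \<noteq> {}"
    by (rule connected_Int_frontier) (use x z in auto)
  then obtain w where w: "w \<in> closed_segment x z" "w \<in> frontier \<Omega>" by auto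
  have xw: "dist x w < t / 8"
    using segment_bound(1)[OF w(1)] z x by (simp add: dist_compl_def dist_norm norm_minus_commute)
  obtain c where c: "ball c R0 \<subseteq> - closure \<Omega>" "cball c R0 \<inter> closure \<Omega> = {w}" using R0(2)[OF w(2)] by auto
  have "w \<in> cball c R0" "w \<in> closure \<Omega>" using c(2) by auto
  then have cw: "dist c w = R0" using c(1) by force
  define c' where "c' = w + (3 * t / 4 / R0) *\<^sub>R (c - w)"
  have c'w: "dist c' w = 3 * t / 4" using cw R0 t0 by (simp add: c'_def dist_norm)
  have "c - c' = (1 - 3 * t / 4 / R0) *\<^sub>R (c - w)" by (simp add: c'_def algebra_simps)
  then have "dist c c' = (1 - 3 * t / 4 / R0) * R0" using cw R0 t by (simp add: dist_norm)
  then have cc': "dist c c' = R0 - 3 * t / 4" using R0 by (simp add: left_diff_distrib)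
  have "ball c' (t / 8) \<subseteq> shell x t \<inter> - \<Omega>"
  proof
    fix y assume "y \<in> ball c' (t / 8)"
    then have y: "dist c' y < t / 8" by simp
    have "dist c y < R0" using dist_triangle[of c y c'] y cc' t0 by linarith
    then have "y \<notin> closure \<Omega>" using c(1) by auto
    then have "y \<notin> \<Omega>" using closure_subset by blast
    moreover have "dist x y < t"
      using dist_triangle[of x y w] dist_triangle[of w y c'] xw y c'w by (simp add: dist_commute)
    moreover have "t / 2 \<le> dist x y"
      using dist_triangle[of c' w y] dist_triangle[of y w x] xw y c'w by (simp add: dist_commute)
    ultimately show "y \<in> shell x t \<inter> - \<Omega>" by (simp add: shell_def dist_norm)
  qed
  then show ?thesis by blast
qed

lemma annulus_sum:
  fixes x :: "'a::euclidean_space"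
  assumes "p \<le> m" "0 < s" "A \<in> sets lebesgue"
  shows "(LINT y:{y\<in>A. 1 / 2 ^ m \<le> norm (x - y) \<and> norm (x - y) < 1 / 2 ^ p}|lebesgue. frac_ker s (x - y))
     = (\<Sum>j=p..<m. LINT y:shell x (1 / 2 ^ j) \<inter> A|lebesgue. frac_ker s (x - y))"
  using assms(1)
proof (induction m rule: dec_induct)
  case base
  have "{y \<in> A. 1 / 2 ^ p \<le> norm (x - y) \<and> norm (x - y) < 1 / 2 ^ p} = {}" by auto
  then show ?case by (simp add: set_lebesgue_integral_def)
next
  case (step m)
  let ?S = "\<lambda>m. {y\<in>A. 1 / 2 ^ m \<le> norm (x - y) \<and> norm (x - y) < 1 / 2 ^ p}"
  have pm: "(1::real) / 2 ^ m \<le> 1 / 2 ^ p" using step by (intro divide_left_mono) (auto intro: power_increasing)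
  define h :: real where "h = 1 / 2 ^ m"
  have h: "0 \<le> h" "1 / 2 ^ Suc m = h / 2" "h \<le> 1 / 2 ^ p" using pm by (simp_all add: h_def)
  have "?S (Suc m) = {y\<in>A. h \<le> norm (x - y) \<and> norm (x - y) < 1 / 2 ^ p} \<union> (shell x h \<inter> A)"
    unfolding h(2) shell_def using h(1,3) by (intro set_eqI iffI) (simp_all, linarith+)
  then have un: "?S (Suc m) = ?S m \<union> (shell x (1 / 2 ^ m) \<inter> A)" by (simp only: h_def)
  have meas: "?S m \<in> sets lebesgue" for m
  proof -
    have "{y. 1 / 2 ^ m \<le> norm (x - y) \<and> norm (x - y) < 1 / 2 ^ p} \<in> sets lebesgue"
      by (rule sets_lebesgue_borel) measurable
    then have "A \<inter> {y. 1 / 2 ^ m \<le> norm (x - y) \<and> norm (x - y) < 1 / 2 ^ p} \<in> sets lebesgue" by (rule sets.Int[OF assms(3)])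
    moreover have "A \<inter> {y. 1 / 2 ^ m \<le> norm (x - y) \<and> norm (x - y) < 1 / 2 ^ p} = ?S m" by blast
    ultimately show ?thesis by (simp only:)
  qed
  have "(LINT y:?S m \<union> (shell x (1 / 2 ^ m) \<inter> A)|lebesgue. frac_ker s (x - y))
      = (LINT y:?S m|lebesgue. frac_ker s (x - y)) + (LINT y:shell x (1 / 2 ^ m) \<inter> A|lebesgue. frac_ker s (x - y))"
  proof (rule set_integral_Un)
    show "?S m \<inter> (shell x (1 / 2 ^ m) \<inter> A) = {}" by (auto simp: shell_def)
    show "set_integrable lebesgue (?S m) (\<lambda>y. frac_ker s (x - y))"
      by (rule shell_integrable[of "1 / 2 ^ m", OF _ assms(2) meas]) auto
    show "set_integrable lebesgue (shell x (1 / 2 ^ m) \<inter> A) (\<lambda>y. frac_ker s (x - y))"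
    proof (rule shell_integrable[of "1 / 2 ^ m / 2", OF _ assms(2)])
      show "shell x (1 / 2 ^ m) \<inter> A \<in> sets lebesgue"
        by (rule sets.Int[OF sets_lebesgue_borel[OF shell_borel] assms(3)])
      show "shell x (1 / 2 ^ m) \<inter> A \<subseteq> {y. 1 / 2 ^ m / 2 \<le> norm (x - y)}" unfolding shell_def by blast
    qed simp
  qed
  then show ?case unfolding un using step by simp
qed

text \<open>The numerator is the exterior mass of a shell from \<open>shell_mass_ge\<close>; the
  bracket collects the losses of a barrier rising by one unit, namely the whole shell mass and the
  part near the singularity. The 4 makes the loss a quarter of the exterior mass, while the gain is
  at least half of it because \<open>b\<close> is at least \<open>a / 2\<close>.\<close>

definition decay_rate :: "'a::euclidean_space itself \<Rightarrow> real" where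
  "decay_rate _ = (unit_ball_vol (real DIM('a)) / 8 ^ DIM('a))
     / (4 * (2 * unit_ball_vol (real DIM('a)) * 2 ^ DIM('a) + 16 * near_bound TYPE('a)))"

lemma decay_rate: "0 < decay_rate TYPE('a::euclidean_space)" "decay_rate TYPE('a) \<le> 1/2"
proof -
  define V where "V = unit_ball_vol (real DIM('a))"
  have V: "0 < V" by (simp add: V_def)
  have near: "0 < near_bound TYPE('a)" by (rule near_bound_pos)
  have pos: "0 < 2 * V * 2 ^ DIM('a) + 16 * near_bound TYPE('a)" using V near by (simp add: add_pos_pos)
  show "0 < decay_rate TYPE('a)" unfolding decay_rate_def V_def[symmetric] using V pos by simp
  have "V / 8 ^ DIM('a) \<le> V / 1" using V by (intro divide_left_mono) auto
  also have "V / 1 \<le> V * 2 ^ DIM('a)" using V by simp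
  finally have "V / 8 ^ DIM('a) \<le> V * 2 ^ DIM('a)" .
  moreover have "0 < V * 2 ^ DIM('a)" using V by simp
  moreover have "y \<le> 2 * (2 * x + 16 * n)" if "y \<le> x" "0 < x" "0 < n" for x y n :: real using that by simp
  ultimately have "V / 8 ^ DIM('a) \<le> 2 * (2 * (V * 2 ^ DIM('a)) + 16 * near_bound TYPE('a))" using near by blast
  then have "V / 8 ^ DIM('a) \<le> 2 * (2 * V * 2 ^ DIM('a) + 16 * near_bound TYPE('a))" by (simp only: mult.assoc)
  moreover have "u / (4 * d) \<le> 1 / 2" if "u \<le> 2 * d" "0 < d" for u d :: real using that by (simp add: field_simps)
  ultimately show "decay_rate TYPE('a) \<le> 1/2" unfolding decay_rate_def V_def[symmetric] using pos by blast
qed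

text \<open>The kernel mass of the dyadic shells outside \<open>\<Omega>\<close>, seen from a point at distance below
  \<open>2 ^ - (m + 3)\<close> from the boundary, beats the loss caused by the variation of the barrier.\<close>

lemma barrier_estimate:
  fixes \<Omega> :: "'a::euclidean_space set" and \<psi> :: "'a \<Rightarrow> real"
  assumes \<Omega>: "open \<Omega>" "bounded \<Omega>" and s: "0 < s" "s \<le> 1/4"
    and R0: "0 < R0" "\<And>x. x \<in> frontier \<Omega> \<Longrightarrow> \<exists>c. ball c R0 \<subseteq> - closure \<Omega> \<and> cball c R0 \<inter> closure \<Omega> = {x}"
    and x: "x \<in> \<Omega>" "dist_compl \<Omega> x < 1 / 2 ^ (m + 3)" and pm: "p < m" "1 / 2 ^ p \<le> R0"
    and lip: "\<And>x y. \<bar>\<psi> x - \<psi> y\<bar> \<le> L * norm (x - y)" and a: "0 < a"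
    and near: "\<And>y. norm (x - y) < 1 / 2 ^ m \<Longrightarrow> \<psi> y - \<psi> x \<le> decay_rate TYPE('a) * a * (2 ^ (m + 3) * norm (x - y))"
    and mid: "\<And>y. norm (x - y) < 1 / 2 ^ p \<Longrightarrow> \<psi> y - \<psi> x \<le> decay_rate TYPE('a) * a"
    and b: "b = (1 - decay_rate TYPE('a)) * a"
  shows "real (m - p) * (a * (unit_ball_vol (real DIM('a)) / 8 ^ DIM('a)) / 4) \<le>
     (\<integral>y. (\<psi> x - \<psi> y) * (indicator {y. norm (x - y) < 1 / 2 ^ p} y * frac_ker s (x - y)) \<partial>lebesgue)
     + b * (\<integral>y. indicator {y. y \<notin> \<Omega> \<and> 1 / 2 ^ m \<le> norm (x - y) \<and> norm (x - y) < 1 / 2 ^ p} y * frac_ker s (x - y) \<partial>lebesgue)"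
proof -
  define \<gamma> where "\<gamma> = decay_rate TYPE('a)"
  define c where "c = unit_ball_vol (real DIM('a)) / 8 ^ DIM('a)"
  define C0 where "C0 = 2 * unit_ball_vol (real DIM('a)) * 2 ^ DIM('a)"
  define C1 where "C1 = near_bound TYPE('a)"
  \<comment> \<open>All gains and losses are compared with multiples of this one sum, so they can be
    subtracted before its size is estimated; at the end \<open>S \<ge> m - p\<close> counts the
    scales.\<close>
  define S where "S = (\<Sum>j=p..<m. (1 / 2 ^ j) powr (- 2 * s))"
  have \<gamma>: "0 < \<gamma>" "\<gamma> \<le> 1/2" using decay_rate[where ?'a = 'a] by (auto simp: \<gamma>_def)
  have c: "0 < c" and C0: "0 < C0" and C1: "0 < C1" by (auto simp: c_def C0_def C1_def near_bound_pos)
  have \<gamma>c: "\<gamma> * (C0 + 16 * C1) = c / 4"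
    using C0 C1 unfolding \<gamma>_def decay_rate_def c_def[symmetric] C0_def[symmetric] C1_def[symmetric] by (simp add: field_simps)
  have one_le: "1 \<le> (1 / 2 ^ j :: real) powr (- 2 * s)" for j
    using s by (simp add: powr_divide powr_minus_divide ge_one_powr_ge_zero)
  have S_ge: "real (m - p) \<le> S"
    unfolding S_def using sum_mono[of "{p..<m}" "\<lambda>_. 1" "\<lambda>j. (1 / 2 ^ j) powr (- 2 * s)"] one_le by simp
  let ?mid = "\<lambda>y. indicator {y. 1 / 2 ^ m \<le> norm (x - y) \<and> norm (x - y) < 1 / 2 ^ p} y * frac_ker s (x - y)"
  have mid_int: "integrable lebesgue ?mid"
    using shell_integrable[of "1 / 2 ^ m" s "{y. 1 / 2 ^ m \<le> norm (x - y) \<and> norm (x - y) < 1 / 2 ^ p}" x] s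
    by (auto simp: set_integrable_def)
  have mid_le: "(\<integral>y. ?mid y \<partial>lebesgue) \<le> C0 * S"
  proof -
    have "(\<integral>y. ?mid y \<partial>lebesgue) = (\<Sum>j=p..<m. LINT y:shell x (1 / 2 ^ j)|lebesgue. frac_ker s (x - y))"
      using annulus_sum[of p m s UNIV x] pm s by (simp add: set_lebesgue_integral_def)
    also have "\<dots> \<le> (\<Sum>j=p..<m. C0 * (1 / 2 ^ j) powr (- 2 * s))"
      unfolding C0_def by (intro sum_mono shell_mass_le s) auto
    finally show ?thesis by (simp add: S_def sum_distrib_left)
  qed
  have ext_ge: "c * S \<le> (\<integral>y. indicator {y. y \<notin> \<Omega> \<and> 1 / 2 ^ m \<le> norm (x - y) \<and> norm (x - y) < 1 / 2 ^ p} y * frac_ker s (x - y) \<partial>lebesgue)"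
  proof -
    have "c * S = (\<Sum>j=p..<m. c * (1 / 2 ^ j) powr (- 2 * s))" by (simp add: S_def sum_distrib_left)
    also have "\<dots> \<le> (\<Sum>j=p..<m. LINT y:shell x (1 / 2 ^ j) \<inter> - \<Omega>|lebesgue. frac_ker s (x - y))"
    proof (intro sum_mono)
      \<comment> \<open>Being closer to the boundary than the finest scale requires, x sees an
        exterior ball in the shell of every scale j from p to m - 1.\<close>
      fix j assume j: "j \<in> {p..<m}"
      have "(1::real) / 2 ^ (m + 3) \<le> 1 / 2 ^ (j + 3)" using j by (intro divide_left_mono power_increasing) auto
      then have xj: "dist_compl \<Omega> x < (1 / 2 ^ j) / 8" using x by (simp add: power_add)
      have "(1::real) / 2 ^ j \<le> 1 / 2 ^ p" using j by (intro divide_left_mono power_increasing) auto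
      then have "1 / 2 ^ j \<le> R0" using pm(2) by linarith
      moreover have "3 * h / 4 \<le> R0" if "h \<le> R0" for h using that R0(1) by simp
      ultimately have "3 * (1 / 2 ^ j) / 4 \<le> R0" by blast
      from exterior_ball_in_shell[OF \<Omega> R0 x(1) xj this]
      obtain z where "ball z ((1 / 2 ^ j) / 8) \<subseteq> shell x (1 / 2 ^ j) \<inter> - \<Omega>" by blast
      from shell_mass_ge[OF _ s(1) this]
      show "c * (1 / 2 ^ j) powr (- 2 * s) \<le> (LINT y:shell x (1 / 2 ^ j) \<inter> - \<Omega>|lebesgue. frac_ker s (x - y))"
        unfolding c_def using \<Omega> by auto
    qed
    also have "\<dots> = (LINT y:{y\<in>- \<Omega>. 1 / 2 ^ m \<le> norm (x - y) \<and> norm (x - y) < 1 / 2 ^ p}|lebesgue. frac_ker s (x - y))"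
      using annulus_sum[of p m s "- \<Omega>" x] pm s \<Omega> by simp
    finally show ?thesis by (simp add: set_lebesgue_integral_def)
  qed
  have near_le: "2 ^ (m + 3) * (\<integral>y. near s (1 / 2 ^ m) (x - y) \<partial>lebesgue) \<le> 16 * C1 * S"
  proof -
    \<comment> \<open>\<open>S\<close> ends at the index m - 1. Passing from scale m to m - 1 costs
      \<open>(1 / 2) powr (- 2 * s) \<le> 2\<close>; with the 8 in
      \<open>2 ^ (m + 3) / 2 ^ m\<close> this is the 16 of \<open>decay_rate\<close>.\<close>
    obtain i where i: "m = Suc i" "p \<le> i" using pm(1) by (cases m) auto
    have "2 ^ (m + 3) * (\<integral>y. near s (1 / 2 ^ m) (x - y) \<partial>lebesgue) \<le> 2 ^ (m + 3) * (C1 * (1 / 2 ^ m) powr (1 - 2 * s))"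
      unfolding C1_def using s by (intro mult_left_mono near_integral) auto
    also have "(1 / 2 ^ m :: real) powr (1 - 2 * s) = (1 / 2 ^ m) * (1 / 2 ^ m) powr (- 2 * s)"
      using powr_add[of "1 / 2 ^ m :: real" 1 "- 2 * s"] by simp
    also have "2 ^ (m + 3) * (C1 * ((1 / 2 ^ m) * (1 / 2 ^ m) powr (- 2 * s))) = 8 * C1 * (1 / 2 ^ m) powr (- 2 * s)"
      by (simp add: power_add)
    also have "(1 / 2 ^ m :: real) powr (- 2 * s) = (1 / 2 ^ i) powr (- 2 * s) * (1 / 2) powr (- 2 * s)"
      unfolding i(1) by (simp add: mult.commute flip: powr_mult)
    also have "(1 / 2 :: real) powr (- 2 * s) \<le> 2"
    proof -
      have "(1 / 2 :: real) powr (- 2 * s) = 2 powr (2 * s)" by (simp add: powr_divide powr_minus_divide)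
      also have "\<dots> \<le> 2 powr 1" using s by (intro powr_mono) auto
      finally show ?thesis by simp
    qed
    also have "(1 / 2 ^ i) powr (- 2 * s) \<le> S"
      unfolding S_def using i by (intro member_le_sum) auto
    finally show ?thesis using C1 s
      by (simp add: mult_ac mult_left_mono)
  qed
  have I3: "- (\<gamma> * a * (16 * C1 * S + C0 * S)) \<le>
      (\<integral>y. (\<psi> x - \<psi> y) * (indicator {y. norm (x - y) < 1 / 2 ^ p} y * frac_ker s (x - y)) \<partial>lebesgue)"
  proof -
    have "\<gamma> * a * (2 ^ (m + 3) * (\<integral>y. near s (1 / 2 ^ m) (x - y) \<partial>lebesgue) + (\<integral>y. ?mid y \<partial>lebesgue))
       \<le> \<gamma> * a * (16 * C1 * S + C0 * S)"
      using \<gamma> a near_le mid_le by (intro mult_left_mono add_mono) auto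
    then have "- (\<gamma> * a * (16 * C1 * S + C0 * S)) \<le> - (\<gamma> * a * (2 ^ (m + 3) * (\<integral>y. near s (1 / 2 ^ m) (x - y) \<partial>lebesgue) + (\<integral>y. ?mid y \<partial>lebesgue)))"
      by simp
    also have "\<dots> = (\<integral>y. - (\<gamma> * a * (2 ^ (m + 3) * near s (1 / 2 ^ m) (x - y) + ?mid y)) \<partial>lebesgue)"
      using near_integrable[of "1 / 2 ^ m" s x] mid_int s by simp
    also have "\<dots> \<le> (\<integral>y. (\<psi> x - \<psi> y) * (indicator {y. norm (x - y) < 1 / 2 ^ p} y * frac_ker s (x - y)) \<partial>lebesgue)"
    proof (rule integral_mono)
      show "integrable lebesgue (\<lambda>y. - (\<gamma> * a * (2 ^ (m + 3) * near s (1 / 2 ^ m) (x - y) + ?mid y)))"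
        using near_integrable[of "1 / 2 ^ m" s x] mid_int s by simp
      show "integrable lebesgue (\<lambda>y. (\<psi> x - \<psi> y) * (indicator {y. norm (x - y) < 1 / 2 ^ p} y * frac_ker s (x - y)))"
      proof (rule Bochner_Integration.integrable_bound)
        show "integrable lebesgue (\<lambda>y. L * near s (1 / 2 ^ p) (x - y))"
          using near_integrable[of "1 / 2 ^ p" s x] s by simp
        have "continuous_on UNIV \<psi>"
        proof (rule lipschitz_on_continuous_on)
          show "\<bar>L\<bar>-lipschitz_on UNIV \<psi>"
          proof (rule lipschitz_onI)
            fix x y
            have "\<bar>\<psi> x - \<psi> y\<bar> \<le> L * norm (x - y)" by (rule lip)
            also have "\<dots> \<le> \<bar>L\<bar> * norm (x - y)" by (intro mult_right_mono) auto
            finally show "dist (\<psi> x) (\<psi> y) \<le> \<bar>L\<bar> * dist x y" by (simp add: dist_norm)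
          qed simp
        qed
        then have [measurable]: "\<psi> \<in> borel_measurable borel" by (rule borel_measurable_continuous_onI)
        show "(\<lambda>y. (\<psi> x - \<psi> y) * (indicator {y. norm (x - y) < 1 / 2 ^ p} y * frac_ker s (x - y))) \<in> borel_measurable lebesgue"
          by (rule borel_imp_lebesgue) measurable
        have "\<bar>(\<psi> x - \<psi> y) * (indicator {y. norm (x - y) < 1 / 2 ^ p} y * frac_ker s (x - y))\<bar> \<le> L * near s (1 / 2 ^ p) (x - y)" for y
          using mult_right_mono[OF lip[of x y], of "frac_ker s (x - y)"] by (auto simp: near_def indicator_def abs_mult)
        then show "AE y in lebesgue. norm ((\<psi> x - \<psi> y) * (indicator {y. norm (x - y) < 1 / 2 ^ p} y * frac_ker s (x - y)))
            \<le> norm (L * near s (1 / 2 ^ p) (x - y))"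
          by (intro AE_I2) (use order_trans[OF _ abs_ge_self] in auto)
      qed
      fix y
      have "(1::real) / 2 ^ m \<le> 1 / 2 ^ p" using pm by (intro divide_left_mono power_increasing) auto
      then consider "norm (x - y) < 1 / 2 ^ m" "norm (x - y) < 1 / 2 ^ p"
        | "1 / 2 ^ m \<le> norm (x - y)" "norm (x - y) < 1 / 2 ^ p" | "\<not> norm (x - y) < 1 / 2 ^ p" "\<not> norm (x - y) < 1 / 2 ^ m" by linarith
      then show "- (\<gamma> * a * (2 ^ (m + 3) * near s (1 / 2 ^ m) (x - y) + ?mid y))
          \<le> (\<psi> x - \<psi> y) * (indicator {y. norm (x - y) < 1 / 2 ^ p} y * frac_ker s (x - y))"
      proof cases
        case 1
        have "(\<psi> y - \<psi> x) * frac_ker s (x - y) \<le> \<gamma> * a * (2 ^ (m + 3) * norm (x - y)) * frac_ker s (x - y)"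
          unfolding \<gamma>_def using near[OF 1(1)] by (rule mult_right_mono) simp
        then show ?thesis using 1 by (simp add: near_def algebra_simps)
      next
        case 2
        have "(\<psi> y - \<psi> x) * frac_ker s (x - y) \<le> \<gamma> * a * frac_ker s (x - y)"
          unfolding \<gamma>_def using mid[OF 2(2)] by (rule mult_right_mono) simp
        then show ?thesis using 2 by (simp add: near_def algebra_simps)
      next
        case 3
        then show ?thesis by (simp add: near_def)
      qed
    qed
    finally show ?thesis .
  qed
  have "real (m - p) * (a * c / 4) \<le> S * (a * c / 4)" using S_ge a c by (intro mult_right_mono) auto
  also have "\<dots> \<le> b * (c * S) - \<gamma> * a * (16 * C1 * S + C0 * S)"
  proof -
    have "\<gamma> * a * (16 * C1 * S + C0 * S) = (\<gamma> * (C0 + 16 * C1)) * (a * S)" by (simp add: algebra_simps)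
    then have e: "\<gamma> * a * (16 * C1 * S + C0 * S) = c / 4 * (a * S)" unfolding \<gamma>c .
    have "a / 2 \<le> b" unfolding b \<gamma>_def[symmetric] left_diff_distrib using mult_right_mono[OF \<gamma>(2), of a] a by linarith
    then have "a / 2 * (c * S) \<le> b * (c * S)" using c S_ge by (intro mult_right_mono) auto
    then show ?thesis unfolding e by (simp add: algebra_simps)
  qed
  also have "b * (c * S) \<le> b * (\<integral>y. indicator {y. y \<notin> \<Omega> \<and> 1 / 2 ^ m \<le> norm (x - y) \<and> norm (x - y) < 1 / 2 ^ p} y * frac_ker s (x - y) \<partial>lebesgue)"
    using a \<gamma> by (intro mult_left_mono ext_ge) (auto simp: b \<gamma>_def)
  finally show ?thesis using I3 unfolding c_def by linarith
qed

text \<open>The inequality is what remains of the eigenvalue bound. It is required at all scales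
  from \<open>p\<close> on because an improvement step may have to cut the kernel at a finer
  scale.\<close>

definition admissible :: "'a::euclidean_space set \<Rightarrow> nat \<Rightarrow> real \<Rightarrow> real \<Rightarrow> ('a \<Rightarrow> real) \<Rightarrow> bool" where
  "admissible \<Omega> p s \<mu> \<phi> \<longleftrightarrow> 0 < s \<and> s \<le> 1/4 \<and> weak_solution s \<Omega> \<mu> \<phi> \<and> (\<forall>i\<ge>p. \<mu> + 1 \<le> tail TYPE('a) s (1 / 2 ^ i))"

text \<open>The width \<delta> is chosen before s, \<mu> and \<phi>; this order of quantifiers
  carries the uniformity through the induction.\<close>

definition boundary_bound :: "'a::euclidean_space set \<Rightarrow> nat \<Rightarrow> real \<Rightarrow> bool" where
  "boundary_bound \<Omega> p a \<longleftrightarrow> (\<exists>\<delta>>0. \<forall>s \<mu> \<phi>. admissible \<Omega> p s \<mu> \<phi> \<longrightarrow>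
     (AE x in lebesgue. x \<in> \<Omega> \<and> dist_compl \<Omega> x < \<delta> \<longrightarrow> \<phi> x \<le> a))"

text \<open>The barrier is a ramp at the boundary plus a steep term deeper inside. The steep term
  lifts it above the global bound \<open>K\<close>, so \<phi> can exceed the barrier only in the
  layer where \<open>\<phi> \<le> a\<close> is known. There the ramp in turn confines the excess to
  distances below \<open>1 / 2 ^ (m + 3)\<close>, where exterior balls act on all scales from p to m
  - 1.\<close>

lemma boundary_bound_step:
  fixes \<Omega> :: "'a::euclidean_space set"
  assumes \<Omega>: "open \<Omega>" "bounded \<Omega>"
    and R0: "0 < R0" "\<And>x. x \<in> frontier \<Omega> \<Longrightarrow> \<exists>c. ball c R0 \<subseteq> - closure \<Omega> \<and> cball c R0 \<inter> closure \<Omega> = {x}"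
    and a: "0 < a" and bb: "boundary_bound \<Omega> p0 a"
  shows "boundary_bound \<Omega> p0 ((1 - decay_rate TYPE('a) / 2) * a)"
proof -
  define \<gamma> where "\<gamma> = decay_rate TYPE('a)"
  define c where "c = unit_ball_vol (real DIM('a)) / 8 ^ DIM('a)"
  define K where "K = sup_bound \<Omega> p0"
  define d where "d = dist_compl \<Omega>"
  have \<gamma>: "0 < \<gamma>" "\<gamma> \<le> 1/2" using decay_rate[where ?'a = 'a] by (auto simp: \<gamma>_def)
  have c: "0 < c" by (simp add: c_def)
  have K: "0 < K" by (simp add: K_def sup_bound_pos)
  obtain \<delta> where \<delta>: "0 < \<delta>" and bnd: "\<And>s \<mu> \<phi>. admissible \<Omega> p0 s \<mu> \<phi> \<Longrightarrow>
     AE x in lebesgue. x \<in> \<Omega> \<and> d x < \<delta> \<longrightarrow> \<phi> x \<le> a" using bb by (auto simp: boundary_bound_def d_def)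
  \<comment> \<open>Below \<open>R0\<close> the exterior balls fit into the shells; below
    \<open>\<delta> / 4\<close> a ball of radius \<open>1 / 2 ^ p\<close> around a point close to
    the boundary avoids the region where the steep term is active.\<close>
  obtain p1 where p1: "(1/2 :: real) ^ p1 < min R0 (\<delta> / 4)"
    using real_arch_pow_inv[of "min R0 (\<delta> / 4)" "1/2"] R0 \<delta> by auto
  define p where "p = max p0 p1"
  have "(1/2 :: real) ^ p \<le> (1/2) ^ p1" unfolding p_def by (intro power_decreasing) auto
  then have p: "p0 \<le> p" "1 / 2 ^ p \<le> R0" "1 / 2 ^ p \<le> \<delta> / 4" using p1 by (auto simp: p_def power_one_over)
  \<comment> \<open>The number of scales is fixed after \<open>p\<close>, since the far average to
    be beaten is bounded in terms of \<open>p\<close>.\<close>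
  obtain k where k: "sup_bound \<Omega> p < real k * (a * c / 4)"
    using reals_Archimedean3[of "a * c / 4"] a c by auto
  define m where "m = p + k"
  have "k \<noteq> 0" using k sup_bound_pos[of \<Omega> p] by (cases k) auto
  then have pm: "p < m" "m - p = k" by (auto simp: m_def)
  define b where "b = (1 - \<gamma>) * a"
  have b: "0 < b" using \<gamma> a by (simp add: b_def)
  \<comment> \<open>The ramp has height \<open>\<gamma> * a\<close>, so the first two terms reach
    \<open>a\<close> once \<open>2 ^ (m + 3) * d x \<ge> 1\<close>; the slope
    \<open>2 * K / \<delta>\<close> brings the last term to \<open>K\<close> at distance
    \<delta>.\<close>
  define \<psi> where "\<psi> x = b + \<gamma> * a * min 1 (2 ^ (m + 3) * d x) + 2 * K / \<delta> * max 0 (d x - \<delta> / 2)" for x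
  have d0: "0 \<le> d x" for x by (simp add: d_def dist_compl_def infdist_nonneg)
  have d_lip: "\<bar>d x - d y\<bar> \<le> norm (x - y)" for x y
    unfolding d_def dist_compl_def dist_norm[symmetric] by (rule infdist_triangle_abs)
  have d_out: "d x = 0" if "x \<notin> \<Omega>" for x using that by (simp add: d_def dist_compl_def)
  define A where "A = \<gamma> * a"
  define Q where "Q = (2::real) ^ (m + 3)"
  define R where "R = 2 * K / \<delta>"
  have A: "0 < A" and Q: "0 < Q" and R: "0 < R" using \<gamma> a K \<delta> by (auto simp: A_def Q_def R_def)
  have \<psi>_alt: "\<psi> x = b + A * min 1 (Q * d x) + R * max 0 (d x - \<delta> / 2)" for x by (simp add: \<psi>_def A_def Q_def R_def)
  have lip: "\<bar>\<psi> x - \<psi> y\<bar> \<le> (A * Q + R) * norm (x - y)" for x y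
  proof -
    have "\<bar>min 1 (Q * d x) - min 1 (Q * d y)\<bar> \<le> \<bar>Q * d x - Q * d y\<bar>" by linarith
    also have "\<dots> = Q * \<bar>d x - d y\<bar>" using Q by (simp add: abs_mult flip: right_diff_distrib)
    also have "\<dots> \<le> Q * norm (x - y)" using Q by (intro mult_left_mono d_lip) auto
    finally have 1: "A * \<bar>min 1 (Q * d x) - min 1 (Q * d y)\<bar> \<le> A * (Q * norm (x - y))" using A by (intro mult_left_mono) auto
    have "\<bar>max 0 (d x - \<delta> / 2) - max 0 (d y - \<delta> / 2)\<bar> \<le> norm (x - y)" using d_lip[of x y] by linarith
    then have 2: "R * \<bar>max 0 (d x - \<delta> / 2) - max 0 (d y - \<delta> / 2)\<bar> \<le> R * norm (x - y)" using R by (intro mult_left_mono) auto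
    have "\<psi> x - \<psi> y = A * (min 1 (Q * d x) - min 1 (Q * d y)) + R * (max 0 (d x - \<delta> / 2) - max 0 (d y - \<delta> / 2))"
      by (simp add: \<psi>_alt right_diff_distrib)
    also have "\<bar>\<dots>\<bar> \<le> A * \<bar>min 1 (Q * d x) - min 1 (Q * d y)\<bar> + R * \<bar>max 0 (d x - \<delta> / 2) - max 0 (d y - \<delta> / 2)\<bar>"
      using A R by (metis abs_mult abs_of_pos abs_triangle_ineq)
    also have "\<dots> \<le> A * (Q * norm (x - y)) + R * norm (x - y)" using 1 2 by (rule add_mono)
    finally show ?thesis by (simp add: algebra_simps)
  qed
  have \<psi>_ge: "b \<le> \<psi> x" for x unfolding \<psi>_alt using A Q R d0[of x] by (simp add: add_nonneg_nonneg)
  have \<psi>_out: "\<psi> x = b" if "x \<notin> \<Omega>" for x unfolding \<psi>_alt using d_out[OF that] \<delta> by simp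
  obtain T where T: "\<psi> x \<le> T" for x
  proof -
    have "\<Omega> \<noteq> UNIV" using \<Omega> not_bounded_UNIV by metis
    then obtain z where z: "z \<notin> \<Omega>" by auto
    obtain D where D: "\<And>x. x \<in> \<Omega> \<Longrightarrow> norm (x - z) \<le> D"
      using \<Omega>(2) unfolding bounded_any_center[of _ z] by (auto simp: dist_norm norm_minus_commute)
    have "\<psi> x \<le> b + (A * Q + R) * max 0 D" for x
    proof (cases "x \<in> \<Omega>")
      case True
      have "\<psi> x \<le> b + (A * Q + R) * norm (x - z)" using lip[of x z] \<psi>_out[OF z] by linarith
      also have "(A * Q + R) * norm (x - z) \<le> (A * Q + R) * max 0 D" using D[OF True] A Q R by (intro mult_left_mono) auto
      finally show ?thesis by simp
    qed (use \<psi>_out A Q R in auto)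
    then show ?thesis using that by blast
  qed
  have "AE x in lebesgue. x \<in> \<Omega> \<and> d x < 1 / 2 ^ (m + 4) \<longrightarrow> \<phi> x \<le> (1 - \<gamma> / 2) * a" if adm: "admissible \<Omega> p0 s \<mu> \<phi>" for s \<mu> \<phi>
  proof -
    have s: "0 < s" "s \<le> 1/4" and w: "weak_solution s \<Omega> \<mu> \<phi>"
      and \<mu>: "\<And>i. p0 \<le> i \<Longrightarrow> \<mu> + 1 \<le> tail TYPE('a) s (1 / 2 ^ i)" using adm by (auto simp: admissible_def)
    have le_K: "AE x in lebesgue. \<phi> x \<le> K" unfolding K_def by (rule weak_solution_le_sup_bound[OF \<Omega> s w \<mu>]) simp
    have \<phi>0: "AE x in lebesgue. x \<notin> \<Omega> \<longrightarrow> \<phi> x = 0" using w by (simp add: weak_solution_def frac_H0s_def)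
    have "AE x in lebesgue. \<phi> x \<le> \<psi> x"
    proof (rule comparison[OF \<Omega> s, of \<phi> \<mu> \<psi> "A * Q + R" b T "1 / 2 ^ m" "1 / 2 ^ p"])
      show "\<phi> \<in> frac_H0s s \<Omega>" "\<And>v. v \<in> frac_H0s s \<Omega> \<Longrightarrow> energy s \<phi> v = 2 * \<mu> * (\<integral>x. \<phi> x * v x \<partial>lebesgue)"
        using w by (auto simp: weak_solution_def)
      show "(1::real) / 2 ^ m \<le> 1 / 2 ^ p" using pm by (intro divide_left_mono power_increasing) auto
      show "AE x in lebesgue. \<psi> x < \<phi> x \<longrightarrow>
       \<mu> * \<phi> x < tail TYPE('a) s (1 / 2 ^ p) * \<phi> x - (\<integral>y. \<phi> y * far s (1 / 2 ^ p) (x - y) \<partial>lebesgue)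
         + (\<integral>y. (\<psi> x - \<psi> y) * (indicator {y. norm (x - y) < 1 / 2 ^ p} y * frac_ker s (x - y)) \<partial>lebesgue)
         + b * (\<integral>y. indicator {y. y \<notin> \<Omega> \<and> 1 / 2 ^ m \<le> norm (x - y) \<and> norm (x - y) < 1 / 2 ^ p} y * frac_ker s (x - y) \<partial>lebesgue)"
        using le_K \<phi>0 bnd[OF adm]
      proof eventually_elim
        case (elim x)
        show ?case
        proof
          assume gt: "\<psi> x < \<phi> x"
          have \<phi>pos: "0 < \<phi> x" using gt \<psi>_ge[of x] b by linarith
          then have x\<Omega>: "x \<in> \<Omega>" using elim by auto
          have "d x < \<delta>"
          proof (rule ccontr)
            assume "\<not> d x < \<delta>"
            then have "\<delta> / 2 \<le> max 0 (d x - \<delta> / 2)" by linarith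
            then have "R * (\<delta> / 2) \<le> R * max 0 (d x - \<delta> / 2)" using R by (intro mult_left_mono) auto
            then have "K \<le> R * max 0 (d x - \<delta> / 2)" using \<delta> by (simp add: R_def)
            moreover have "0 \<le> A * min 1 (Q * d x)" using A Q d0[of x] by simp
            ultimately show False using gt elim(1) b unfolding \<psi>_alt by linarith
          qed
          then have "\<phi> x \<le> a" using elim x\<Omega> by auto
          have dx: "d x < 1 / 2 ^ (m + 3)"
          proof (rule ccontr)
            assume "\<not> d x < 1 / 2 ^ (m + 3)"
            then have "1 \<le> Q * d x" by (simp add: Q_def field_simps)
            then have "\<psi> x = b + A + R * max 0 (d x - \<delta> / 2)" by (simp add: \<psi>_alt)
            moreover have "b + A = a" by (simp add: b_def A_def left_diff_distrib)
            moreover have "0 \<le> R * max 0 (d x - \<delta> / 2)" using R by simp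
            ultimately show False using gt \<open>\<phi> x \<le> a\<close> by linarith
          qed
          have "(1::real) / 2 ^ (m + 3) \<le> 1 / 2 ^ p" using pm by (intro divide_left_mono power_increasing) auto
          then have dy: "d y < \<delta> / 2" if "norm (x - y) < 1 / 2 ^ p" for y
            using d_lip[of x y] that dx p(3) by linarith
          have diff: "\<psi> y - \<psi> x \<le> A * (min 1 (Q * d y) - min 1 (Q * d x))" if "norm (x - y) < 1 / 2 ^ p" for y
          proof -
            have "max 0 (d y - \<delta> / 2) = 0" using dy[OF that] by simp
            moreover have "0 \<le> R * max 0 (d x - \<delta> / 2)" using R by simp
            ultimately show ?thesis by (simp add: \<psi>_alt right_diff_distrib)
          qed
          have mp: "(1::real) / 2 ^ m \<le> 1 / 2 ^ p" using pm by (intro divide_left_mono power_increasing) auto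
          have "real (m - p) * (a * (unit_ball_vol (real DIM('a)) / 8 ^ DIM('a)) / 4) \<le>
             (\<integral>y. (\<psi> x - \<psi> y) * (indicator {y. norm (x - y) < 1 / 2 ^ p} y * frac_ker s (x - y)) \<partial>lebesgue)
             + b * (\<integral>y. indicator {y. y \<notin> \<Omega> \<and> 1 / 2 ^ m \<le> norm (x - y) \<and> norm (x - y) < 1 / 2 ^ p} y * frac_ker s (x - y) \<partial>lebesgue)"
          proof (rule barrier_estimate[OF \<Omega> s R0 x\<Omega> dx[unfolded d_def] pm(1) p(2) lip a])
            fix y
            show "\<psi> y - \<psi> x \<le> decay_rate TYPE('a) * a" if "norm (x - y) < 1 / 2 ^ p"
            proof -
              have "0 \<le> Q * d x" using Q d0[of x] by simp
              then have "min 1 (Q * d y) - min 1 (Q * d x) \<le> 1" by linarith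
              then have "A * (min 1 (Q * d y) - min 1 (Q * d x)) \<le> A * 1" using A by (intro mult_left_mono) auto
              then show ?thesis using diff[OF that] by (simp add: A_def \<gamma>_def)
            qed
            show "\<psi> y - \<psi> x \<le> decay_rate TYPE('a) * a * (2 ^ (m + 3) * norm (x - y))" if n: "norm (x - y) < 1 / 2 ^ m"
            proof -
              have "Q * (d y - d x) \<le> Q * norm (x - y)" using d_lip[of x y] Q by (intro mult_left_mono) auto
              moreover have "0 \<le> Q * norm (x - y)" using Q by simp
              ultimately have "min 1 (Q * d y) - min 1 (Q * d x) \<le> Q * norm (x - y)"
                unfolding right_diff_distrib by linarith
              then have "A * (min 1 (Q * d y) - min 1 (Q * d x)) \<le> A * (Q * norm (x - y))" using A by (intro mult_left_mono) auto
              then show ?thesis using diff[OF less_le_trans[OF n mp]] by (simp add: A_def \<gamma>_def Q_def)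
            qed
            show "b = (1 - decay_rate TYPE('a)) * a" unfolding b_def \<gamma>_def ..
          qed
          then have ge: "sup_bound \<Omega> p < 
             (\<integral>y. (\<psi> x - \<psi> y) * (indicator {y. norm (x - y) < 1 / 2 ^ p} y * frac_ker s (x - y)) \<partial>lebesgue)
             + b * (\<integral>y. indicator {y. y \<notin> \<Omega> \<and> 1 / 2 ^ m \<le> norm (x - y) \<and> norm (x - y) < 1 / 2 ^ p} y * frac_ker s (x - y) \<partial>lebesgue)"
            using k unfolding pm(2) c_def by linarith
          have "\<mu> * \<phi> x \<le> tail TYPE('a) s (1 / 2 ^ p) * \<phi> x" using \<mu>[OF p(1)] \<phi>pos by (intro mult_right_mono) auto
          then show "\<mu> * \<phi> x < tail TYPE('a) s (1 / 2 ^ p) * \<phi> x - (\<integral>y. \<phi> y * far s (1 / 2 ^ p) (x - y) \<partial>lebesgue)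
             + (\<integral>y. (\<psi> x - \<psi> y) * (indicator {y. norm (x - y) < 1 / 2 ^ p} y * frac_ker s (x - y)) \<partial>lebesgue)
             + b * (\<integral>y. indicator {y. y \<notin> \<Omega> \<and> 1 / 2 ^ m \<le> norm (x - y) \<and> norm (x - y) < 1 / 2 ^ p} y * frac_ker s (x - y) \<partial>lebesgue)"
            using far_average_le[OF \<Omega> s w, of p x] ge unfolding sup_bound_def by linarith
        qed
      qed
    qed (use lip \<psi>_out b \<psi>_ge T in auto)
    then show ?thesis
    proof eventually_elim
      case (elim x)
      show ?case
      proof
        assume x: "x \<in> \<Omega> \<and> d x < 1 / 2 ^ (m + 4)"
        have "(1::real) / 2 ^ (m + 4) \<le> 1 / 2 ^ p" using pm by (intro divide_left_mono power_increasing) auto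
        then have "max 0 (d x - \<delta> / 2) = 0" using x p(3) \<delta> by simp
        \<comment> \<open>At half the width of the ramp at most half its height is reached, whence
          the factor \<open>1 - \<gamma> / 2\<close>.\<close>
        moreover have "Q * d x \<le> 1 / 2" using x by (simp add: Q_def power_add field_simps)
        then have "A * min 1 (Q * d x) \<le> A * (1 / 2)" using A by (intro mult_left_mono) auto
        ultimately have "\<psi> x \<le> b + A / 2" by (simp add: \<psi>_alt)
        also have "\<dots> = (1 - \<gamma> / 2) * a" by (simp add: b_def A_def algebra_simps)
        finally show "\<phi> x \<le> (1 - \<gamma> / 2) * a" using elim by simp
      qed
    qed
  qed
  then show ?thesis unfolding boundary_bound_def d_def \<gamma>_def[symmetric]
    by (intro exI[of _ "1 / 2 ^ (m + 4)"]) auto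
qed

text \<open>The induction starts from the uniform sup bound. The number of improvement steps needed
  depends on \<open>\<epsilon>\<close> but not on s, so the width of the last layer is still
  positive and uniform.\<close>

lemma boundary_bound_all:
  fixes \<Omega> :: "'a::euclidean_space set"
  assumes \<Omega>: "open \<Omega>" "bounded \<Omega>" and ext: "uniform_exterior_sphere \<Omega>" and \<epsilon>: "0 < \<epsilon>"
  shows "boundary_bound \<Omega> p \<epsilon>"
proof -
  obtain R0 where R0: "0 < R0" "\<And>x. x \<in> frontier \<Omega> \<Longrightarrow> \<exists>c. ball c R0 \<subseteq> - closure \<Omega> \<and> cball c R0 \<inter> closure \<Omega> = {x}"
    using ext unfolding uniform_exterior_sphere_def by blast
  define q where "q = 1 - decay_rate TYPE('a) / 2"
  have q: "0 < q" "q < 1" using decay_rate[where ?'a = 'a] by (auto simp: q_def)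
  have step: "boundary_bound \<Omega> p (q ^ n * sup_bound \<Omega> p)" for n
  proof (induction n)
    case 0
    have "AE x in lebesgue. \<phi> x \<le> sup_bound \<Omega> p" if "admissible \<Omega> p s \<mu> \<phi>" for s \<mu> \<phi>
      using that by (intro weak_solution_le_sup_bound[OF \<Omega>, of s \<mu>]) (auto simp: admissible_def)
    then have "AE x in lebesgue. x \<in> \<Omega> \<and> dist_compl \<Omega> x < 1 \<longrightarrow> \<phi> x \<le> sup_bound \<Omega> p" if "admissible \<Omega> p s \<mu> \<phi>" for s \<mu> \<phi>
      using that by fastforce
    then show ?case unfolding boundary_bound_def by (intro exI[of _ 1]) auto
  next
    case (Suc n)
    have "0 < q ^ n * sup_bound \<Omega> p" using q sup_bound_pos[of \<Omega> p] by simp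
    from boundary_bound_step[OF \<Omega> R0 this Suc.IH] show ?case by (simp add: q_def mult.assoc)
  qed
  obtain n where "q ^ n < \<epsilon> / sup_bound \<Omega> p"
    using real_arch_pow_inv[of "\<epsilon> / sup_bound \<Omega> p" q] q \<epsilon> sup_bound_pos[of \<Omega> p] by auto
  then have le: "q ^ n * sup_bound \<Omega> p \<le> \<epsilon>" using sup_bound_pos[of \<Omega> p] by (simp add: field_simps)
  from step[of n] obtain \<delta> where "\<delta> > 0" "\<And>s \<mu> \<phi>. admissible \<Omega> p s \<mu> \<phi> \<Longrightarrow>
     (AE x in lebesgue. x \<in> \<Omega> \<and> dist_compl \<Omega> x < \<delta> \<longrightarrow> \<phi> x \<le> q ^ n * sup_bound \<Omega> p)"
    by (auto simp: boundary_bound_def)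
  moreover from this(2) have "AE x in lebesgue. x \<in> \<Omega> \<and> dist_compl \<Omega> x < \<delta> \<longrightarrow> \<phi> x \<le> \<epsilon>"
    if "admissible \<Omega> p s \<mu> \<phi>" for s \<mu> \<phi>
    using that le by (fastforce elim: eventually_mono)
  ultimately show ?thesis unfolding boundary_bound_def by blast
qed

lemma admissible_boundary_decay:
  fixes \<Omega> :: "'a::euclidean_space set"
  assumes \<Omega>: "open \<Omega>" "bounded \<Omega>" and ext: "uniform_exterior_sphere \<Omega>" and \<epsilon>: "0 < \<epsilon>"
  shows "\<exists>\<delta>>0. \<forall>s \<mu> \<phi>. admissible \<Omega> p s \<mu> \<phi> \<longrightarrow>
    (AE x in lebesgue. x \<in> \<Omega> \<and> dist_compl \<Omega> x < \<delta> \<longrightarrow> \<bar>\<phi> x\<bar> \<le> \<epsilon>)"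
proof -
  obtain \<delta> where \<delta>: "0 < \<delta>" "\<And>s \<mu> \<phi>. admissible \<Omega> p s \<mu> \<phi> \<Longrightarrow>
     (AE x in lebesgue. x \<in> \<Omega> \<and> dist_compl \<Omega> x < \<delta> \<longrightarrow> \<phi> x \<le> \<epsilon>)"
    using boundary_bound_all[OF assms, of p] by (auto simp: boundary_bound_def)
  have "AE x in lebesgue. x \<in> \<Omega> \<and> dist_compl \<Omega> x < \<delta> \<longrightarrow> \<bar>\<phi> x\<bar> \<le> \<epsilon>" if adm: "admissible \<Omega> p s \<mu> \<phi>" for s \<mu> \<phi>
  proof -
    have "admissible \<Omega> p s \<mu> (\<lambda>x. - \<phi> x)" using adm by (simp add: admissible_def weak_solution_uminus)
    from \<delta>(2)[OF this] \<delta>(2)[OF adm] show ?thesis by eventually_elim auto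
  qed
  then show ?thesis using \<delta>(1) by blast
qed

section \<open>Compactness of the energy space\<close>

lemma integrable_leb2_product:
  fixes f g :: "'a::euclidean_space \<Rightarrow> real"
  assumes f: "integrable lebesgue f" and g: "integrable lebesgue g"
  shows "integrable leb2 (\<lambda>(x, y). f x * g y)"
    and "(\<integral>(x, y). f x * g y \<partial>leb2) = (\<integral>x. f x \<partial>lebesgue) * (\<integral>y. g y \<partial>lebesgue)"
proof -
  show i: "integrable leb2 (\<lambda>(x, y). f x * g y)"
  proof (rule lebesgue_pair.Fubini_integrable)
    show "(\<lambda>(x, y). f x * g y) \<in> borel_measurable leb2"
      using borel_measurable_times[OF leb2_measurable_fst[OF borel_measurable_integrable[OF f]]
        leb2_measurable_snd[OF borel_measurable_integrable[OF g]]] by (simp add: split_beta')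
    show "AE x in lebesgue. integrable lebesgue (\<lambda>y. case (x, y) of (x, y) \<Rightarrow> f x * g y)" using g by simp
    show "integrable lebesgue (\<lambda>x. \<integral>y. norm (case (x, y) of (x, y) \<Rightarrow> f x * g y) \<partial>lebesgue)"
      using f by (simp add: abs_mult)
  qed
  show "(\<integral>(x, y). f x * g y \<partial>leb2) = (\<integral>x. f x \<partial>lebesgue) * (\<integral>y. g y \<partial>lebesgue)"
    using lebesgue_pair.integral_fst[OF i] by simp
qed

lemma square_integrable_on_set:
  fixes w :: "'a::euclidean_space \<Rightarrow> real"
  assumes Q: "Q \<in> lmeasurable" and w: "w \<in> borel_measurable lebesgue" "integrable lebesgue (\<lambda>x. (w x)\<^sup>2)"
  shows "integrable lebesgue (\<lambda>x. indicator Q x * w x)" "integrable lebesgue (\<lambda>x. indicator Q x * (w x)\<^sup>2)"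
proof -
  have iQ: "integrable lebesgue (indicat_real Q)" using Q by (simp add: lmeasurable_iff_integrable)
  have [measurable]: "Q \<in> sets lebesgue" using Q by auto
  show "integrable lebesgue (\<lambda>x. indicator Q x * (w x)\<^sup>2)"
    by (rule Bochner_Integration.integrable_bound[OF w(2)]) (use w(1) in \<open>auto simp: indicator_def\<close>)
  show "integrable lebesgue (\<lambda>x. indicator Q x * w x)"
  proof (rule Bochner_Integration.integrable_bound[OF Bochner_Integration.integrable_add[OF w(2) iQ]])
    show "(\<lambda>x. indicator Q x * w x) \<in> borel_measurable lebesgue" using w(1) by measurable
    have "\<bar>w x\<bar> \<le> (w x)\<^sup>2 + 1" for x using sum_squares_bound[of "\<bar>w x\<bar>" 1] abs_ge_zero[of "w x"]
      unfolding power2_abs by simp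
    then show "AE x in lebesgue. norm (indicator Q x * w x) \<le> norm ((w x)\<^sup>2 + indicat_real Q x)"
      by (auto simp: indicator_def)
  qed
qed

text \<open>Expanding the square splits the L2 mass on \<open>Q\<close> into the mean, which is
  finite-dimensional data, and the oscillation, which the energy controls.\<close>

lemma variance_identity:
  fixes w :: "'a::euclidean_space \<Rightarrow> real"
  assumes Q: "Q \<in> lmeasurable" and w: "w \<in> borel_measurable lebesgue" "integrable lebesgue (\<lambda>x. (w x)\<^sup>2)"
  shows "integrable leb2 (\<lambda>(x, y). indicator Q x * indicator Q y * (w x - w y)\<^sup>2)"
    and "measure lebesgue Q * (\<integral>x. indicator Q x * (w x)\<^sup>2 \<partial>lebesgue) = (\<integral>x. indicator Q x * w x \<partial>lebesgue)\<^sup>2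
      + (\<integral>(x, y). indicator Q x * indicator Q y * (w x - w y)\<^sup>2 \<partial>leb2) / 2"
proof -
  have iQ: "integrable lebesgue (indicat_real Q)" using Q by (simp add: lmeasurable_iff_integrable)
  note i = square_integrable_on_set[OF Q w]
  note p1 = integrable_leb2_product[OF i(2) iQ] and p2 = integrable_leb2_product[OF iQ i(2)]
    and p3 = integrable_leb2_product[OF i(1) i(1)]
  have eq: "indicator Q x * indicator Q y * (w x - w y)\<^sup>2 = indicator Q x * (w x)\<^sup>2 * indicator Q y
      + indicator Q x * (indicator Q y * (w y)\<^sup>2) - 2 * (indicator Q x * w x * (indicator Q y * w y))" for x y
    by (simp add: power2_eq_square algebra_simps)
  show "integrable leb2 (\<lambda>(x, y). indicator Q x * indicator Q y * (w x - w y)\<^sup>2)"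
    unfolding eq using p1(1) p2(1) p3(1) by (simp add: split_beta')
  have "(\<integral>(x, y). indicator Q x * indicator Q y * (w x - w y)\<^sup>2 \<partial>leb2) =
     (\<integral>(x, y). indicator Q x * (w x)\<^sup>2 * indicator Q y \<partial>leb2) + (\<integral>(x, y). indicator Q x * (indicator Q y * (w y)\<^sup>2) \<partial>leb2)
     - 2 * (\<integral>(x, y). indicator Q x * w x * (indicator Q y * w y) \<partial>leb2)"
    unfolding eq using p1(1) p2(1) p3(1) by (simp add: split_beta')
  then show "measure lebesgue Q * (\<integral>x. indicator Q x * (w x)\<^sup>2 \<partial>lebesgue) = (\<integral>x. indicator Q x * w x \<partial>lebesgue)\<^sup>2
      + (\<integral>(x, y). indicator Q x * indicator Q y * (w x - w y)\<^sup>2 \<partial>leb2) / 2"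
    unfolding p1(2) p2(2) p3(2) using Q by (simp add: power2_eq_square fmeasurable_def field_simps)
qed

text \<open>The lower corner of the half-open dyadic cube of side \<open>1 / 2 ^ m\<close> that
  contains x; the cubes appear as fibres of this map.\<close>

definition grid :: "nat \<Rightarrow> 'a::euclidean_space \<Rightarrow> 'a" where
  "grid m x = (\<Sum>b\<in>Basis. (of_int \<lfloor>2 ^ m * (x \<bullet> b)\<rfloor> / 2 ^ m) *\<^sub>R b)"

lemma grid_measurable [measurable]: "grid m \<in> borel_measurable borel"
  unfolding grid_def by measurable

lemma grid_inner: "b \<in> Basis \<Longrightarrow> grid m x \<bullet> b = of_int \<lfloor>2 ^ m * (x \<bullet> b)\<rfloor> / 2 ^ m"
  by (simp add: grid_def inner_sum_left inner_Basis if_distrib sum.delta cong: if_cong)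

lemma grid_inner_bounds:
  assumes "b \<in> Basis"
  shows "grid m x \<bullet> b \<le> x \<bullet> b" "x \<bullet> b < grid m x \<bullet> b + 1 / 2 ^ m"
proof -
  have "of_int \<lfloor>2 ^ m * (x \<bullet> b)\<rfloor> \<le> 2 ^ m * (x \<bullet> b)" "2 ^ m * (x \<bullet> b) < of_int \<lfloor>2 ^ m * (x \<bullet> b)\<rfloor> + 1" by linarith+
  then show "grid m x \<bullet> b \<le> x \<bullet> b" "x \<bullet> b < grid m x \<bullet> b + 1 / 2 ^ m"
    unfolding grid_inner[OF assms] by (simp_all add: field_simps)
qed

lemma norm_diff_grid_cell:
  fixes x y :: "'a::euclidean_space"
  assumes "grid m x = grid m y"
  shows "norm (x - y) \<le> real DIM('a) / 2 ^ m"
proof -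
  have "norm (x - y) \<le> (\<Sum>b\<in>Basis. \<bar>(x - y) \<bullet> b\<bar>)" by (rule norm_le_l1)
  also have "\<dots> \<le> (\<Sum>b\<in>(Basis :: 'a set). 1 / 2 ^ m)"
  proof (intro sum_mono)
    fix b :: 'a assume b: "b \<in> Basis"
    show "\<bar>(x - y) \<bullet> b\<bar> \<le> 1 / 2 ^ m"
    proof -
      have "\<bar>p - q\<bar> \<le> h" if "g \<le> p" "p < g + h" "g \<le> q" "q < g + h" for p q g h :: real using that by linarith
      from this[OF grid_inner_bounds[OF b, where m = m and x = x] grid_inner_bounds[OF b, where m = m and x = y, folded assms]]
      show ?thesis unfolding inner_diff_left .
    qed
  qed
  finally show ?thesis by simp
qed

lemma grid_cell_measure:
  fixes z :: "'a::euclidean_space" and m :: nat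
  defines "Q \<equiv> {x. grid m x = grid m z}"
  shows "Q \<in> lmeasurable" "(1 / 2 ^ m) ^ DIM('a) \<le> measure lebesgue Q"
proof -
  have sets: "Q \<in> sets lebesgue"
  proof -
    have "Q \<in> sets borel" unfolding Q_def by measurable
    then show ?thesis by simp
  qed
  have "bounded Q"
    unfolding Q_def bounded_any_center[of _ z]
    by (intro exI[of _ "real DIM('a) / 2 ^ m"]) (auto simp: dist_norm dest: norm_diff_grid_cell intro: norm_diff_grid_cell[OF sym])
  then show Q: "Q \<in> lmeasurable" using sets by (intro bounded_set_imp_lmeasurable)
  let ?B = "box (grid m z) (grid m z + (1 / 2 ^ m) *\<^sub>R One)"
  have "?B \<subseteq> Q"
  proof
    fix x assume x: "x \<in> ?B"
    have "\<lfloor>2 ^ m * (x \<bullet> b)\<rfloor> = \<lfloor>2 ^ m * (z \<bullet> b)\<rfloor>" if b: "b \<in> Basis" for b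
    proof (rule floor_unique)
      have "grid m z \<bullet> b < x \<bullet> b" "x \<bullet> b < grid m z \<bullet> b + 1 / 2 ^ m"
        using x b by (auto simp: mem_box inner_add_left)
      then show "of_int \<lfloor>2 ^ m * (z \<bullet> b)\<rfloor> \<le> 2 ^ m * (x \<bullet> b)" "2 ^ m * (x \<bullet> b) < of_int \<lfloor>2 ^ m * (z \<bullet> b)\<rfloor> + 1"
        unfolding grid_inner[OF b] by (simp_all add: field_simps)
    qed
    then show "x \<in> Q" by (simp add: Q_def grid_def)
  qed
  then have "measure lebesgue ?B \<le> measure lebesgue Q"
    using Q by (intro measure_mono_fmeasurable) auto
  moreover have "measure lebesgue ?B = (1 / 2 ^ m) ^ DIM('a)"
    by (simp add: measure_lborel_box inner_add_left inner_diff_left)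
  ultimately show "(1 / 2 ^ m) ^ DIM('a) \<le> measure lebesgue Q" by simp
qed

lemma finite_grid_image:
  assumes "bounded \<Omega>" shows "finite (grid m ` (\<Omega> :: 'a::euclidean_space set))"
proof -
  obtain K where K: "\<And>x. x \<in> \<Omega> \<Longrightarrow> norm x \<le> K" using assms by (auto simp: bounded_iff)
  define L where "L = \<lceil>2 ^ m * K\<rceil> + 1"
  have "grid m ` \<Omega> \<subseteq> (\<lambda>f. \<Sum>b\<in>Basis. (of_int (f b) / 2 ^ m) *\<^sub>R b) ` ((Basis :: 'a set) \<rightarrow>\<^sub>E {-L..L})"
  proof
    fix y assume "y \<in> grid m ` \<Omega>"
    then obtain x where x: "x \<in> \<Omega>" "y = grid m x" by auto
    define f where "f = restrict (\<lambda>b. \<lfloor>2 ^ m * (x \<bullet> b)\<rfloor>) Basis"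
    have "f \<in> Basis \<rightarrow>\<^sub>E {-L..L}"
      unfolding f_def
    proof (intro restrict_PiE_iff[THEN iffD2] ballI)
      fix b :: 'a assume b: "b \<in> Basis"
      have "\<bar>x \<bullet> b\<bar> \<le> K" using Basis_le_norm[OF b, of x] K[OF x(1)] by linarith
      then have "2 ^ m * \<bar>x \<bullet> b\<bar> \<le> 2 ^ m * K" by (intro mult_left_mono) auto
      then have "\<bar>2 ^ m * (x \<bullet> b)\<bar> \<le> 2 ^ m * K" by (simp add: abs_mult)
      then show "\<lfloor>2 ^ m * (x \<bullet> b)\<rfloor> \<in> {-L..L}" unfolding L_def by simp linarith
    qed
    moreover have "y = (\<Sum>b\<in>Basis. (of_int (f b) / 2 ^ m) *\<^sub>R b)" unfolding x(2) grid_def f_def by simp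
    ultimately show "y \<in> (\<lambda>f. \<Sum>b\<in>Basis. (of_int (f b) / 2 ^ m) *\<^sub>R b) ` ((Basis :: 'a set) \<rightarrow>\<^sub>E {-L..L})" by blast
  qed
  then show ?thesis by (rule finite_subset) (intro finite_imageI finite_PiE, auto)
qed

text \<open>The variance identity is summed over the cells. Within a cell the distance is at most
  \<open>N / 2 ^ m\<close>, so the oscillation costs \<open>(N / 2 ^ m) powr (N + 2 * s)\<close>
  times the energy; division by the cell volume leaves a factor
  \<open>(1 / 2 ^ m) powr (2 * s)\<close>, which is small for large m.\<close>

lemma grid_Poincare:
  fixes \<Omega> :: "'a::euclidean_space set"
  assumes \<Omega>: "open \<Omega>" "bounded \<Omega>" and s: "0 < s" and w: "w \<in> frac_H0s s \<Omega>"
  shows "(\<integral>x. (w x)\<^sup>2 \<partial>lebesgue) \<le>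
    (2 ^ m) ^ DIM('a) * (\<Sum>p\<in>grid m ` \<Omega>. (\<integral>x. indicator {x. grid m x = p} x * w x \<partial>lebesgue)\<^sup>2)
    + real DIM('a) powr (real DIM('a) + 2 * s) * (1 / 2 ^ m) powr (2 * s) * energy s w w"
proof -
  define N where "N = real DIM('a)"
  define P where "P = grid m ` \<Omega>"
  define Q where "Q p = {x :: 'a. grid m x = p}" for p
  define D where "D = (N / 2 ^ m) powr (N + 2 * s)"
  have wH: "w \<in> frac_Hs s" and w0: "AE x in lebesgue. x \<notin> \<Omega> \<longrightarrow> w x = 0" using w by (auto simp: frac_H0s_def)
  have wm: "w \<in> borel_measurable lebesgue" and wsq: "integrable lebesgue (\<lambda>x. (w x)\<^sup>2)" using wH by (auto simp: frac_Hs_iff)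
  have en: "integrable leb2 (\<lambda>(x, y). (w x - w y)\<^sup>2 * frac_ker s (x - y))" using wH by (simp add: frac_Hs_iff)
  have N: "0 < N" by (simp add: N_def)
  have finP: "finite P" unfolding P_def by (rule finite_grid_image[OF \<Omega>(2)])
  have Qm: "Q p \<in> lmeasurable" and Qge: "(1 / 2 ^ m) ^ DIM('a) \<le> measure lebesgue (Q p)" if "p \<in> P" for p
    using that grid_cell_measure[where 'a = 'a and m = m] by (auto simp: P_def Q_def)
  define J where "J p = (\<integral>(x, y). indicator (Q p) x * indicator (Q p) y * (w x - w y)\<^sup>2 \<partial>leb2)" for p
  note vi = variance_identity[OF Qm wm wsq]
  have Jint: "integrable leb2 (\<lambda>(x, y). indicator (Q p) x * indicator (Q p) y * (w x - w y)\<^sup>2)" if "p \<in> P" for p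
    by (rule vi(1)[OF that])
  have Jsum: "(\<Sum>p\<in>P. J p) \<le> D * energy s w w"
  proof -
    have "(\<Sum>p\<in>P. J p) = (\<integral>z. (\<Sum>p\<in>P. case z of (x, y) \<Rightarrow> indicator (Q p) x * indicator (Q p) y * (w x - w y)\<^sup>2) \<partial>leb2)"
      unfolding J_def using Jint by (subst Bochner_Integration.integral_sum) auto
    also have "\<dots> \<le> (\<integral>z. D * (case z of (x, y) \<Rightarrow> (w x - w y)\<^sup>2 * frac_ker s (x - y)) \<partial>leb2)"
    proof (rule integral_mono)
      show "integrable leb2 (\<lambda>z. \<Sum>p\<in>P. case z of (x, y) \<Rightarrow> indicator (Q p) x * indicator (Q p) y * (w x - w y)\<^sup>2)"
        using Jint by (intro Bochner_Integration.integrable_sum) auto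
      show "integrable leb2 (\<lambda>z. D * (case z of (x, y) \<Rightarrow> (w x - w y)\<^sup>2 * frac_ker s (x - y)))" using en by simp
      fix z :: "'a \<times> 'a"
      obtain x y where z: "z = (x, y)" by (cases z)
      have "(\<Sum>p\<in>P. indicator (Q p) x * indicator (Q p) y * (w x - w y)\<^sup>2) \<le> D * ((w x - w y)\<^sup>2 * frac_ker s (x - y))"
      \<comment> \<open>The diagonal is set apart because the kernel has the value 0 there; the left
        side vanishes on it as well.\<close>
      proof (cases "grid m x = grid m y \<and> x \<noteq> y")
        case True
        have "(\<Sum>p\<in>P. indicator (Q p) x * indicator (Q p) y * (w x - w y)\<^sup>2) = (\<Sum>p\<in>P. if p = grid m x then (w x - w y)\<^sup>2 else 0)"
          using True by (intro sum.cong) (auto simp: Q_def indicator_def)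
        also have "\<dots> \<le> (w x - w y)\<^sup>2" using finP by (simp add: sum.delta)
        also have "\<dots> \<le> D * ((w x - w y)\<^sup>2 * frac_ker s (x - y))"
        proof -
          have "(N / 2 ^ m) powr - (N + 2 * s) \<le> frac_ker s (x - y)"
            unfolding N_def using norm_diff_grid_cell[of m x y] True s by (intro frac_ker_ge) auto
          then have "D * (N / 2 ^ m) powr - (N + 2 * s) \<le> D * frac_ker s (x - y)" by (intro mult_left_mono) (auto simp: D_def)
          moreover have "D * (N / 2 ^ m) powr - (N + 2 * s) = 1" unfolding D_def using N by (simp flip: powr_add)
          ultimately have "1 \<le> D * frac_ker s (x - y)" by simp
          then have "(w x - w y)\<^sup>2 * 1 \<le> (w x - w y)\<^sup>2 * (D * frac_ker s (x - y))" by (intro mult_left_mono) auto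
          then show ?thesis by (simp add: mult_ac)
        qed
        finally show ?thesis .
      next
        case False
        then have "(\<Sum>p\<in>P. indicator (Q p) x * indicator (Q p) y * (w x - w y)\<^sup>2) = 0"
          by (intro sum.neutral) (auto simp: Q_def indicator_def)
        moreover have "0 \<le> D * ((w x - w y)\<^sup>2 * frac_ker s (x - y))" by (simp add: D_def)
        ultimately show ?thesis by simp
      qed
      then show "(\<Sum>p\<in>P. case z of (x, y) \<Rightarrow> indicator (Q p) x * indicator (Q p) y * (w x - w y)\<^sup>2)
          \<le> D * (case z of (x, y) \<Rightarrow> (w x - w y)\<^sup>2 * frac_ker s (x - y))" by (simp add: z)
    qed
    also have "\<dots> = D * energy s w w" by (simp add: energy_def power2_eq_square)
    finally show ?thesis .
  qed
  have J0: "0 \<le> J p" for p unfolding J_def by (intro integral_nonneg_AE) (auto split: prod.split)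
  have "(\<integral>x. (w x)\<^sup>2 \<partial>lebesgue) = (\<integral>x. (\<Sum>p\<in>P. indicator (Q p) x * (w x)\<^sup>2) \<partial>lebesgue)"
  proof (rule integral_cong_AE)
    show "(\<lambda>x. \<Sum>p\<in>P. indicator (Q p) x * (w x)\<^sup>2) \<in> borel_measurable lebesgue"
      using square_integrable_on_set(2)[OF Qm wm wsq] by (intro borel_measurable_sum) auto
    show "(\<lambda>x. (w x)\<^sup>2) \<in> borel_measurable lebesgue" using wsq by auto
    show "AE x in lebesgue. (w x)\<^sup>2 = (\<Sum>p\<in>P. indicator (Q p) x * (w x)\<^sup>2)"
      using w0
    proof eventually_elim
      case (elim x)
      have "(\<Sum>p\<in>P. indicator (Q p) x * (w x)\<^sup>2) = (\<Sum>p\<in>P. if p = grid m x then (w x)\<^sup>2 else 0)"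
        by (intro sum.cong) (auto simp: Q_def indicator_def)
      also have "\<dots> = (w x)\<^sup>2" using elim finP by (auto simp: sum.delta P_def)
      finally show ?case by simp
    qed
  qed
  also have "\<dots> = (\<Sum>p\<in>P. \<integral>x. indicator (Q p) x * (w x)\<^sup>2 \<partial>lebesgue)"
    using square_integrable_on_set(2)[OF Qm wm wsq] by (intro Bochner_Integration.integral_sum) auto
  also have "\<dots> \<le> (\<Sum>p\<in>P. (2 ^ m) ^ DIM('a) * ((\<integral>x. indicator (Q p) x * w x \<partial>lebesgue)\<^sup>2 + J p / 2))"
  proof (intro sum_mono)
    fix p assume p: "p \<in> P"
    define I where "I = (\<integral>x. indicator (Q p) x * (w x)\<^sup>2 \<partial>lebesgue)"
    have I0: "0 \<le> I" unfolding I_def by (intro integral_nonneg_AE) auto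
    have "(1 / 2 ^ m) ^ DIM('a) * I \<le> measure lebesgue (Q p) * I" using Qge[OF p] I0 by (rule mult_right_mono)
    also have "\<dots> = (\<integral>x. indicator (Q p) x * w x \<partial>lebesgue)\<^sup>2 + J p / 2" unfolding I_def J_def by (rule vi(2)[OF p])
    finally have "(2 ^ m) ^ DIM('a) * ((1 / 2 ^ m) ^ DIM('a) * I) \<le> (2 ^ m) ^ DIM('a) * ((\<integral>x. indicator (Q p) x * w x \<partial>lebesgue)\<^sup>2 + J p / 2)"
      by (intro mult_left_mono) auto
    moreover have "(2 ^ m) ^ DIM('a) * ((1 / 2 ^ m) ^ DIM('a) * I) = I" by (simp add: power_divide)
    ultimately show "(\<integral>x. indicator (Q p) x * (w x)\<^sup>2 \<partial>lebesgue) \<le> (2 ^ m) ^ DIM('a) * ((\<integral>x. indicator (Q p) x * w x \<partial>lebesgue)\<^sup>2 + J p / 2)"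
      unfolding I_def by simp
  qed
  also have "\<dots> = (2 ^ m) ^ DIM('a) * (\<Sum>p\<in>P. (\<integral>x. indicator (Q p) x * w x \<partial>lebesgue)\<^sup>2) + (2 ^ m) ^ DIM('a) * ((\<Sum>p\<in>P. J p) / 2)"
    by (simp add: sum_distrib_left sum.distrib distrib_left sum_divide_distrib)
  also have "(2 ^ m) ^ DIM('a) * ((\<Sum>p\<in>P. J p) / 2) \<le> (2 ^ m) ^ DIM('a) * (D * energy s w w)"
  proof -
    have "0 \<le> (\<Sum>p\<in>P. J p)" using J0 by (intro sum_nonneg) auto
    then show ?thesis using Jsum by (intro mult_left_mono) auto
  qed
  also have "(2 ^ m) ^ DIM('a) * (D * energy s w w) = N powr (N + 2 * s) * (1 / 2 ^ m) powr (2 * s) * energy s w w"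
  proof -
    have "D = N powr (N + 2 * s) * (1 / 2 ^ m) powr (N + 2 * s)"
      unfolding D_def using N by (simp add: powr_divide)
    also have "(1 / 2 ^ m :: real) powr (N + 2 * s) = (1 / 2 ^ m) ^ DIM('a) * (1 / 2 ^ m) powr (2 * s)"
      unfolding powr_add by (simp add: N_def powr_realpow)
    finally have "D = N powr (N + 2 * s) * ((1 / 2 ^ m) ^ DIM('a) * (1 / 2 ^ m) powr (2 * s))" .
    moreover have "(2 ^ m :: real) ^ DIM('a) * (1 / 2 ^ m) ^ DIM('a) = 1" by (simp add: power_divide)
    ultimately show ?thesis by (simp add: mult_ac)
  qed
  finally show ?thesis by (simp add: P_def Q_def N_def)
qed

lemma frac_H0s_lin:
  assumes "u \<in> frac_H0s s \<Omega>" "v \<in> frac_H0s s \<Omega>"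
  shows "(\<lambda>x. a * u x + b * v x) \<in> frac_H0s s \<Omega>"
proof -
  have "AE x in lebesgue. x \<notin> \<Omega> \<longrightarrow> u x = 0" "AE x in lebesgue. x \<notin> \<Omega> \<longrightarrow> v x = 0"
    using assms by (auto simp: frac_H0s_def)
  then have "AE x in lebesgue. x \<notin> \<Omega> \<longrightarrow> a * u x + b * v x = 0" by eventually_elim auto
  then show ?thesis using assms frac_Hs_lin[of u s v a b] by (simp add: frac_H0s_def)
qed

lemma frac_H0s_diff:
  assumes "u \<in> frac_H0s s \<Omega>" "v \<in> frac_H0s s \<Omega>"
  shows "(\<lambda>x. u x - v x) \<in> frac_H0s s \<Omega>"
  using frac_H0s_lin[OF assms, of 1 "-1"] by simp

lemma frac_H0sD:
  fixes u :: "'a::euclidean_space \<Rightarrow> real"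
  assumes "u \<in> frac_H0s s \<Omega>"
  shows "u \<in> frac_Hs s" "u \<in> borel_measurable lebesgue" "integrable lebesgue (\<lambda>x. (u x)\<^sup>2)"
    "integrable leb2 (\<lambda>(x, y). (u x - u y)\<^sup>2 * frac_ker s (x - y))" "AE x in lebesgue. x \<notin> \<Omega> \<longrightarrow> u x = 0"
  using assms by (auto simp: frac_H0s_def frac_Hs_iff)

lemma energy_self: "energy s u u = (\<integral>(x, y). (u x - u y)\<^sup>2 * frac_ker s (x - y) \<partial>leb2)"
  by (simp add: energy_def power2_eq_square)

lemma energy_nonneg: "0 \<le> energy s u u"
  unfolding energy_self by (intro integral_nonneg_AE) (auto split: prod.split)

lemma energy_diff_le:
  fixes u v :: "'a::euclidean_space \<Rightarrow> real"
  assumes u: "u \<in> frac_H0s s \<Omega>" and v: "v \<in> frac_H0s s \<Omega>"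
  shows "energy s (\<lambda>x. u x - v x) (\<lambda>x. u x - v x) \<le> 2 * energy s u u + 2 * energy s v v"
proof -
  note iu = frac_H0sD(4)[OF u] and iv = frac_H0sD(4)[OF v] and id = frac_H0sD(4)[OF frac_H0s_diff[OF u v]]
  have "energy s (\<lambda>x. u x - v x) (\<lambda>x. u x - v x) \<le> (\<integral>z. 2 * (case z of (x, y) \<Rightarrow> (u x - u y)\<^sup>2 * frac_ker s (x - y))
      + 2 * (case z of (x, y) \<Rightarrow> (v x - v y)\<^sup>2 * frac_ker s (x - y)) \<partial>leb2)"
    unfolding energy_self
  proof (rule integral_mono[OF id])
    show "integrable leb2 (\<lambda>z. 2 * (case z of (x, y) \<Rightarrow> (u x - u y)\<^sup>2 * frac_ker s (x - y))
      + 2 * (case z of (x, y) \<Rightarrow> (v x - v y)\<^sup>2 * frac_ker s (x - y)))" using iu iv by simp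
    fix z :: "'a \<times> 'a"
    obtain x y where z: "z = (x, y)" by (cases z)
    have "(u x - v x - (u y - v y))\<^sup>2 \<le> 2 * (u x - u y)\<^sup>2 + 2 * (v x - v y)\<^sup>2"
    proof -
      have "(p - q)\<^sup>2 \<le> 2 * p\<^sup>2 + 2 * q\<^sup>2" for p q :: real
        using sum_squares_bound[of p "- q"] power2_sum[of p "- q"] by simp
      from this[of "u x - u y" "v x - v y"] show ?thesis by (simp add: algebra_simps)
    qed
    from mult_right_mono[OF this, of "frac_ker s (x - y)"]
    show "(case z of (x, y) \<Rightarrow> (u x - v x - (u y - v y))\<^sup>2 * frac_ker s (x - y)) \<le> 2 * (case z of (x, y) \<Rightarrow> (u x - u y)\<^sup>2 * frac_ker s (x - y))
      + 2 * (case z of (x, y) \<Rightarrow> (v x - v y)\<^sup>2 * frac_ker s (x - y))" by (simp add: z distrib_right)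
  qed
  also have "\<dots> = 2 * energy s u u + 2 * energy s v v" unfolding energy_self using iu iv by simp
  finally show ?thesis .
qed

section \<open>Subsequences converging in L2\<close>

lemma convergent_finite_family:
  fixes a :: "nat \<Rightarrow> 'p \<Rightarrow> real"
  assumes "finite P" "\<And>n p. p \<in> P \<Longrightarrow> \<bar>a n p\<bar> \<le> B p"
  shows "\<exists>r. strict_mono (r :: nat \<Rightarrow> nat) \<and> (\<forall>p\<in>P. convergent (\<lambda>n. a (r n) p))"
  using assms
proof (induction P rule: finite_induct)
  case empty
  then show ?case by (intro exI[of _ id]) (auto simp: strict_mono_def)
next
  case (insert q P)
  then obtain r where r: "strict_mono (r :: nat \<Rightarrow> nat)" "\<forall>p\<in>P. convergent (\<lambda>n. a (r n) p)" by auto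
  have "bounded (range (\<lambda>n. a (r n) q))" unfolding bounded_iff using insert.prems[of q] by auto
  then obtain l r' where r': "strict_mono (r' :: nat \<Rightarrow> nat)" "((\<lambda>n. a (r n) q) \<circ> r') \<longlonglongrightarrow> l"
    using bounded_imp_convergent_subsequence by blast
  have "convergent (\<lambda>n. a (r (r' n)) p)" if "p \<in> insert q P" for p
  proof (cases "p = q")
    case True
    then show ?thesis using r' by (auto simp: convergent_def o_def)
  next
    case False
    then have "convergent (\<lambda>n. a (r n) p)" using that r by auto
    then show ?thesis using convergent_subseq_convergent[OF _ r'(1)] by (auto simp: o_def)
  qed
  moreover have "strict_mono (\<lambda>n. r (r' n))" using r(1) r'(1) by (simp add: strict_mono_def)
  ultimately show ?case by blast
qed

text \<open>The level \<open>m\<close> is fixed first, so that the energy bound makes the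
  oscillation term small; then only finitely many cell integrals are left, and Bolzano-Weierstrass
  applies to them.\<close>

lemma L2_almost_Cauchy_subsequence:
  fixes \<Omega> :: "'a::euclidean_space set"
  assumes \<Omega>: "open \<Omega>" "bounded \<Omega>" and s: "0 < s" and u: "\<And>n. u n \<in> frac_H0s s \<Omega>"
    and b: "\<And>n. (\<integral>x. (u n x)\<^sup>2 \<partial>lebesgue) \<le> b" and e: "\<And>n. energy s (u n) (u n) \<le> e" and \<epsilon>: "0 < \<epsilon>"
  shows "\<exists>r. strict_mono (r :: nat \<Rightarrow> nat) \<and> (\<exists>N. \<forall>i\<ge>N. \<forall>j\<ge>N. (\<integral>x. (u (r i) x - u (r j) x)\<^sup>2 \<partial>lebesgue) \<le> \<epsilon>)"
proof -
  \<comment> \<open>The 4 comes from \<open>energy_diff_le\<close>: a difference has energy at most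
    \<open>2 * e + 2 * e\<close>.\<close>
  define C where "C = real DIM('a) powr (real DIM('a) + 2 * s) * (4 * e)"
  have e0: "0 \<le> e" using e[of 0] energy_nonneg[of s "u 0"] by linarith
  have C0: "0 \<le> C" using e0 by (simp add: C_def)
  obtain m where m: "C * (1 / 2 ^ m) powr (2 * s) \<le> \<epsilon> / 2"
  proof -
    define q :: real where "q = 1 / 2 powr (2 * s)"
    have "1 < (2 :: real) powr (2 * s)" using s by (intro gr_one_powr) auto
    then have q: "0 < q" "q < 1" by (auto simp: q_def)
    obtain m where "q ^ m < \<epsilon> / 2 / (C + 1)" using real_arch_pow_inv[of "\<epsilon> / 2 / (C + 1)" q] q C0 \<epsilon> by auto
    then have "(C + 1) * q ^ m \<le> \<epsilon> / 2" using C0 by (simp add: field_simps)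
    moreover have "C * q ^ m \<le> (C + 1) * q ^ m" using q by (intro mult_right_mono) auto
    moreover have "(1 / 2 ^ m :: real) powr (2 * s) = q ^ m"
    proof -
      have "(2 ^ m :: real) powr (2 * s) = (2 powr (2 * s)) ^ m"
        by (simp add: powr_powr mult.commute flip: powr_realpow)
      then show ?thesis by (simp add: q_def powr_divide power_divide)
    qed
    ultimately show ?thesis using that[of m] by simp
  qed
  define P where "P = grid m ` \<Omega>"
  define a where "a n p = (\<integral>x. indicator {x. grid m x = p} x * u n x \<partial>lebesgue)" for n p
  have finP: "finite P" unfolding P_def by (rule finite_grid_image[OF \<Omega>(2)])
  have Qm: "{x. grid m x = p} \<in> lmeasurable" if "p \<in> P" for p
    using that grid_cell_measure(1)[of m] by (auto simp: P_def)
  note um = frac_H0sD(2)[OF u] and usq = frac_H0sD(3)[OF u]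
  have ai: "integrable lebesgue (\<lambda>x. indicator {x. grid m x = p} x * u n x)" if "p \<in> P" for n p
    by (rule square_integrable_on_set(1)[OF Qm[OF that] um usq])
  have a_le: "\<bar>a n p\<bar> \<le> b + measure lebesgue {x. grid m x = p}" if p: "p \<in> P" for n p
  proof -
    let ?Q = "{x. grid m x = p}"
    have iQ: "integrable lebesgue (indicat_real ?Q)" using Qm[OF p] by (simp add: lmeasurable_iff_integrable)
    have "\<bar>a n p\<bar> \<le> (\<integral>x. \<bar>indicator ?Q x * u n x\<bar> \<partial>lebesgue)" unfolding a_def by (rule integral_abs_bound)
    also have "\<dots> \<le> (\<integral>x. (u n x)\<^sup>2 + indicat_real ?Q x \<partial>lebesgue)"
    proof (rule integral_mono)
      fix x
      have "\<bar>u n x\<bar> \<le> (u n x)\<^sup>2 + 1" using sum_squares_bound[of "\<bar>u n x\<bar>" 1] abs_ge_zero[of "u n x"]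
        unfolding power2_abs by simp
      then show "\<bar>indicator ?Q x * u n x\<bar> \<le> (u n x)\<^sup>2 + indicat_real ?Q x" by (auto simp: indicator_def)
    qed (use ai[OF p] usq iQ in auto)
    also have "\<dots> = (\<integral>x. (u n x)\<^sup>2 \<partial>lebesgue) + measure lebesgue ?Q"
      using usq iQ Qm[OF p] by (simp add: fmeasurable_def)
    finally show ?thesis using b[of n] by simp
  qed
  obtain r where r: "strict_mono (r :: nat \<Rightarrow> nat)" "\<forall>p\<in>P. convergent (\<lambda>n. a (r n) p)"
    using convergent_finite_family[of P a, OF finP a_le] by blast
  then obtain l where l: "\<And>p. p \<in> P \<Longrightarrow> (\<lambda>n. a (r n) p) \<longlonglongrightarrow> l p" unfolding convergent_def by metis
  \<comment> \<open>The 4 is the one in \<open>(2 * \<eta>)\<^sup>2\<close>; the 1 added to the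
    cardinality keeps \<open>W\<close> positive when there is no cell.\<close>
  define W where "W = (2 ^ m :: real) ^ DIM('a) * real (card P + 1) * 4"
  have W: "0 < W" by (simp add: W_def)
  define \<eta> where "\<eta> = sqrt (\<epsilon> / 2 / W)"
  have \<eta>: "0 < \<eta>" "W * \<eta>\<^sup>2 = \<epsilon> / 2" using \<epsilon> W by (auto simp: \<eta>_def)
  have "\<forall>\<^sub>F n in sequentially. \<bar>a (r n) p - l p\<bar> < \<eta>" if "p \<in> P" for p
    using tendstoD[OF l[OF that] \<eta>(1)] by (simp add: dist_real_def)
  then have "\<forall>\<^sub>F n in sequentially. \<forall>p\<in>P. \<bar>a (r n) p - l p\<bar> < \<eta>" using finP by (intro eventually_ball_finite) auto
  then obtain N where N: "\<And>n p. n \<ge> N \<Longrightarrow> p \<in> P \<Longrightarrow> \<bar>a (r n) p - l p\<bar> < \<eta>" by (auto simp: eventually_sequentially)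
  have "(\<integral>x. (u (r i) x - u (r j) x)\<^sup>2 \<partial>lebesgue) \<le> \<epsilon>" if ij: "i \<ge> N" "j \<ge> N" for i j
  proof -
    let ?w = "\<lambda>x. u (r i) x - u (r j) x"
    have w: "?w \<in> frac_H0s s \<Omega>" by (intro frac_H0s_diff u)
    have "(\<integral>x. (?w x)\<^sup>2 \<partial>lebesgue) \<le> (2 ^ m) ^ DIM('a) * (\<Sum>p\<in>P. (\<integral>x. indicator {x. grid m x = p} x * ?w x \<partial>lebesgue)\<^sup>2)
      + real DIM('a) powr (real DIM('a) + 2 * s) * (1 / 2 ^ m) powr (2 * s) * energy s ?w ?w"
      unfolding P_def by (rule grid_Poincare[OF \<Omega> s w])
    also have "(\<Sum>p\<in>P. (\<integral>x. indicator {x. grid m x = p} x * ?w x \<partial>lebesgue)\<^sup>2) \<le> (\<Sum>p\<in>P. 4 * \<eta>\<^sup>2)"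
    proof (intro sum_mono)
      fix p assume p: "p \<in> P"
      have "(\<integral>x. indicator {x. grid m x = p} x * ?w x \<partial>lebesgue) = a (r i) p - a (r j) p"
        using ai[OF p, of "r i"] ai[OF p, of "r j"] unfolding a_def by (simp add: right_diff_distrib)
      moreover have "\<bar>a (r i) p - a (r j) p\<bar> \<le> 2 * \<eta>" using N[OF ij(1) p] N[OF ij(2) p] by linarith
      then have "(a (r i) p - a (r j) p)\<^sup>2 \<le> (2 * \<eta>)\<^sup>2" by (metis abs_ge_zero power2_abs power_mono)
      ultimately show "(\<integral>x. indicator {x. grid m x = p} x * ?w x \<partial>lebesgue)\<^sup>2 \<le> 4 * \<eta>\<^sup>2" by (simp add: power_mult_distrib)
    qed
    also have "(2 ^ m) ^ DIM('a) * (\<Sum>p\<in>P. 4 * \<eta>\<^sup>2) \<le> W * \<eta>\<^sup>2"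
      unfolding W_def by (simp add: algebra_simps)
    also have "W * \<eta>\<^sup>2 = \<epsilon> / 2" by (rule \<eta>)
    also have "real DIM('a) powr (real DIM('a) + 2 * s) * (1 / 2 ^ m) powr (2 * s) * energy s ?w ?w
        \<le> real DIM('a) powr (real DIM('a) + 2 * s) * (1 / 2 ^ m) powr (2 * s) * (4 * e)"
      using energy_diff_le[OF u u, of "r i" "r j"] e[of "r i"] e[of "r j"] by (intro mult_left_mono) auto
    also have "\<dots> \<le> \<epsilon> / 2" using m by (simp add: C_def mult_ac)
    finally show ?thesis by simp
  qed
  then show ?thesis using r(1) by (intro exI[of _ r]) blast
qed

text \<open>Diagonal extraction over the accuracies \<open>1 / 4 ^ k\<close>, whose square roots are
  summable, as convergence almost everywhere will demand.\<close>

lemma L2_Cauchy_subsequence: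
  fixes \<Omega> :: "'a::euclidean_space set"
  assumes \<Omega>: "open \<Omega>" "bounded \<Omega>" and s: "0 < s" and u: "\<And>n. u n \<in> frac_H0s s \<Omega>"
    and b: "\<And>n. (\<integral>x. (u n x)\<^sup>2 \<partial>lebesgue) \<le> b" and e: "\<And>n. energy s (u n) (u n) \<le> e"
  shows "\<exists>r. strict_mono (r :: nat \<Rightarrow> nat) \<and> (\<forall>k. \<exists>N. \<forall>i\<ge>N. \<forall>j\<ge>N. (\<integral>x. (u (r i) x - u (r j) x)\<^sup>2 \<partial>lebesgue) \<le> 1 / 4 ^ k)"
proof -
  define Q where "Q k r \<longleftrightarrow> (\<exists>N. \<forall>i\<ge>N. \<forall>j\<ge>N. (\<integral>x. (u (r i) x - u (r j) x)\<^sup>2 \<partial>lebesgue) \<le> 1 / 4 ^ k)"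
    for k :: nat and r :: "nat \<Rightarrow> nat"
  interpret subseqs Q
  proof
    fix k and t :: "nat \<Rightarrow> nat" assume "strict_mono t"
    show "\<exists>r'. strict_mono r' \<and> Q k (t \<circ> r')"
      using L2_almost_Cauchy_subsequence[OF \<Omega> s, of "\<lambda>n. u (t n)" b e "1 / 4 ^ k"] u b e by (simp add: Q_def)
  qed
  have stable: "Q k (t \<circ> r)" if r: "strict_mono r" and Qt: "Q k t" for k t r
  proof -
    obtain N where N: "\<And>i j. i \<ge> N \<Longrightarrow> j \<ge> N \<Longrightarrow> (\<integral>x. (u (t i) x - u (t j) x)\<^sup>2 \<partial>lebesgue) \<le> 1 / 4 ^ k"
      using Qt by (auto simp: Q_def)
    have "r i \<ge> N" if "i \<ge> N" for i using seq_suble[OF r, of i] that by linarith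
    then show ?thesis unfolding Q_def using N by (intro exI[of _ N]) auto
  qed
  have "Q k diagseq" for k
  proof -
    \<comment> \<open>The k-th property is available for the diagonal sequence only from the index
      \<open>Suc k\<close> on; being asymptotic, it survives the shift.\<close>
    have "Q k (diagseq \<circ> (+) (Suc k))" by (rule diagseq_holds) (rule stable)
    then obtain N where N: "\<And>i j. i \<ge> N \<Longrightarrow> j \<ge> N \<Longrightarrow> (\<integral>x. (u (diagseq (Suc k + i)) x - u (diagseq (Suc k + j)) x)\<^sup>2 \<partial>lebesgue) \<le> 1 / 4 ^ k"
      by (auto simp: Q_def)
    have "(\<integral>x. (u (diagseq i) x - u (diagseq j) x)\<^sup>2 \<partial>lebesgue) \<le> 1 / 4 ^ k" if "i \<ge> Suc k + N" "j \<ge> Suc k + N" for i j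
      using N[of "i - Suc k" "j - Suc k"] that by simp
    then show ?thesis unfolding Q_def by (intro exI[of _ "Suc k + N"]) blast
  qed
  then show ?thesis using subseq_diagseq by (intro exI[of _ diagseq]) (auto simp: Q_def)
qed

text \<open>The bound is asked only eventually, since it is applied to energies that merely converge
  and to Cauchy estimates.\<close>

lemma Fatou_integrable:
  fixes f :: "nat \<Rightarrow> 'b \<Rightarrow> real"
  assumes f: "\<And>n. integrable M (f n)" and nonneg: "\<And>n x. 0 \<le> f n x" and g: "g \<in> borel_measurable M"
    and lim: "AE x in M. (\<lambda>n. f n x) \<longlonglongrightarrow> g x" and le: "\<forall>\<^sub>F n in sequentially. (\<integral>x. f n x \<partial>M) \<le> c"
  shows "integrable M g" "(\<integral>x. g x \<partial>M) \<le> c"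
proof -
  have c: "0 \<le> c"
  proof -
    obtain n where "(\<integral>x. f n x \<partial>M) \<le> c" using eventually_happens'[OF _ le] by auto
    moreover have "0 \<le> (\<integral>x. f n x \<partial>M)" using nonneg by (intro integral_nonneg_AE) auto
    ultimately show ?thesis by linarith
  qed
  have g0: "AE x in M. 0 \<le> g x" using lim by eventually_elim (use nonneg in \<open>auto intro: LIMSEQ_le_const\<close>)
  have "(\<integral>\<^sup>+x. g x \<partial>M) = (\<integral>\<^sup>+x. liminf (\<lambda>n. ennreal (f n x)) \<partial>M)"
  proof (rule nn_integral_cong_AE)
    show "AE x in M. ennreal (g x) = liminf (\<lambda>n. ennreal (f n x))"
      using lim by eventually_elim (intro lim_imp_Liminf[symmetric] tendsto_ennrealI, auto)
  qed
  also have "\<dots> \<le> liminf (\<lambda>n. \<integral>\<^sup>+x. f n x \<partial>M)"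
    using f by (intro nn_integral_liminf) auto
  also have "\<dots> \<le> ennreal c"
  proof -
    have "\<forall>\<^sub>F n in sequentially. (\<integral>\<^sup>+x. f n x \<partial>M) \<le> ennreal c"
      using le by eventually_elim (use f nonneg in \<open>simp add: nn_integral_eq_integral ennreal_leI\<close>)
    then show ?thesis by (intro Liminf_le) auto
  qed
  finally have *: "(\<integral>\<^sup>+x. g x \<partial>M) \<le> ennreal c" .
  show "integrable M g" "(\<integral>x. g x \<partial>M) \<le> c"
    using integrable_le_of_nn_integral_le[OF g g0 * c] by auto
qed

text \<open>Riesz-Fischer. On the finite measure of \<Omega> the L2 bounds turn into summable L1
  bounds of consecutive differences, so the telescoping series converges absolutely almost
  everywhere. The rate is part of the conclusion because strong convergence is recovered from it by
  Fatou.\<close>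

lemma L2_Cauchy_AE_subsequence:
  fixes z :: "nat \<Rightarrow> 'a::euclidean_space \<Rightarrow> real"
  assumes \<Omega>: "\<Omega> \<in> lmeasurable" and m: "\<And>n. z n \<in> borel_measurable lebesgue" and sq: "\<And>n. integrable lebesgue (\<lambda>x. (z n x)\<^sup>2)"
    and supp: "\<And>n. AE x in lebesgue. x \<notin> \<Omega> \<longrightarrow> z n x = 0"
    and Cauchy: "\<And>k. \<exists>N. \<forall>i\<ge>N. \<forall>j\<ge>N. (\<integral>x. (z i x - z j x)\<^sup>2 \<partial>lebesgue) \<le> 1 / 4 ^ k"
  shows "\<exists>t w. strict_mono (t :: nat \<Rightarrow> nat) \<and> w \<in> borel_measurable lebesgue \<and> (AE x in lebesgue. (\<lambda>k. z (t k) x) \<longlonglongrightarrow> w x)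
     \<and> (\<forall>k. \<forall>i\<ge>k. \<forall>j\<ge>k. (\<integral>x. (z (t i) x - z (t j) x)\<^sup>2 \<partial>lebesgue) \<le> 1 / 4 ^ k)"
proof -
  obtain N where N: "\<And>k i j. i \<ge> N k \<Longrightarrow> j \<ge> N k \<Longrightarrow> (\<integral>x. (z i x - z j x)\<^sup>2 \<partial>lebesgue) \<le> 1 / 4 ^ k"
    using Cauchy by metis
  \<comment> \<open>Adding \<open>k\<close> makes \<open>t\<close> strictly increasing, and the sum
    dominates every \<open>N i\<close> with \<open>i \<le> k\<close> although \<open>N\<close> may
    fail to be monotone.\<close>
  define t where "t k = k + (\<Sum>i\<le>k. N i)" for k :: nat
  have t: "strict_mono t" unfolding strict_mono_Suc_iff by (simp add: t_def)
  have t_ge: "N k \<le> t i" if "k \<le> i" for k i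
  proof -
    have "N k \<le> (\<Sum>i\<le>i. N i)" using that by (intro member_le_sum) auto
    then show ?thesis by (simp add: t_def)
  qed
  define d where "d k x = \<bar>z (t (Suc k)) x - z (t k) x\<bar>" for k x
  have i\<Omega>: "integrable lebesgue (indicat_real \<Omega>)" using \<Omega> by (simp add: lmeasurable_iff_integrable)
  have dm [measurable]: "d k \<in> borel_measurable lebesgue" for k unfolding d_def using m by measurable
  have d_sq: "integrable lebesgue (\<lambda>x. (d k x)\<^sup>2)" for k
  proof (rule Bochner_Integration.integrable_bound)
    show "integrable lebesgue (\<lambda>x. 2 * (z (t (Suc k)) x)\<^sup>2 + 2 * (z (t k) x)\<^sup>2)" using sq by simp
    have "(p - q)\<^sup>2 \<le> 2 * p\<^sup>2 + 2 * q\<^sup>2" for p q :: real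
      using sum_squares_bound[of p "- q"] power2_sum[of p "- q"] by simp
    then show "AE x in lebesgue. norm ((d k x)\<^sup>2) \<le> norm (2 * (z (t (Suc k)) x)\<^sup>2 + 2 * (z (t k) x)\<^sup>2)"
      by (intro AE_I2) (simp add: d_def)
  qed measurable
  have d_int: "(\<integral>\<^sup>+x. d k x \<partial>lebesgue) \<le> ennreal ((1 + measure lebesgue \<Omega>) * (1 / 2) ^ k)" for k
  proof -
    have "(\<integral>\<^sup>+x. d k x \<partial>lebesgue) \<le> (\<integral>\<^sup>+x. ennreal (2 ^ k * (d k x)\<^sup>2 + (1 / 2) ^ k * indicat_real \<Omega> x) \<partial>lebesgue)"
    proof (rule nn_integral_mono_AE)
      show "AE x in lebesgue. ennreal (d k x) \<le> ennreal (2 ^ k * (d k x)\<^sup>2 + (1 / 2) ^ k * indicat_real \<Omega> x)"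
        using supp[of "t k"] supp[of "t (Suc k)"]
      proof eventually_elim
        case (elim x)
        show ?case
        proof (cases "x \<in> \<Omega>")
          case True
          \<comment> \<open>The weight in \<open>d \<le> P * d\<^sup>2 + 1 / P\<close>. As the
            integral of \<open>d\<^sup>2\<close> is at most \<open>1 / 4 ^ k\<close>, the choice
            \<open>2 ^ k\<close> makes both terms of order \<open>1 / 2 ^ k\<close>.\<close>
          define P :: real where "P = 2 ^ k"
          have P: "0 < P" by (simp add: P_def)
          have "2 * (P * d k x) * 1 \<le> (P * d k x)\<^sup>2 + 1\<^sup>2" by (rule sum_squares_bound)
          moreover have "0 \<le> P * d k x" using P by (simp add: d_def)
          ultimately have "P * d k x \<le> (P * d k x)\<^sup>2 + 1" by simp
          then have "P * d k x / P \<le> ((P * d k x)\<^sup>2 + 1) / P" using P by (intro divide_right_mono) auto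
          then have "d k x \<le> P * (d k x)\<^sup>2 + 1 / P" using P by (simp add: add_divide_distrib power2_eq_square mult_ac)
          then show ?thesis using True by (intro ennreal_leI) (simp add: P_def power_one_over)
        qed (use elim in \<open>simp add: d_def\<close>)
      qed
    qed
    also have "\<dots> = ennreal (\<integral>x. 2 ^ k * (d k x)\<^sup>2 + (1 / 2) ^ k * indicat_real \<Omega> x \<partial>lebesgue)"
      using d_sq i\<Omega> by (intro nn_integral_eq_integral) auto
    also have "(\<integral>x. 2 ^ k * (d k x)\<^sup>2 + (1 / 2) ^ k * indicat_real \<Omega> x \<partial>lebesgue) = 2 ^ k * (\<integral>x. (d k x)\<^sup>2 \<partial>lebesgue) + (1 / 2) ^ k * measure lebesgue \<Omega>"
      using d_sq i\<Omega> \<Omega> by (simp add: fmeasurable_def)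
    also have "\<dots> \<le> 2 ^ k * (1 / 4 ^ k) + (1 / 2) ^ k * measure lebesgue \<Omega>"
      using N[OF t_ge t_ge, of k "Suc k" k] by (intro add_right_mono mult_left_mono) (auto simp: d_def)
    also have "\<dots> = (1 + measure lebesgue \<Omega>) * (1 / 2) ^ k"
    proof -
      have "(4::real) ^ k = 2 ^ k * 2 ^ k" by (simp flip: power_mult_distrib)
      then show ?thesis by (simp add: power_one_over distrib_right add_divide_distrib)
    qed
    finally show ?thesis by (simp add: ennreal_leI)
  qed
  have "(\<integral>\<^sup>+x. (\<Sum>k. ennreal (d k x)) \<partial>lebesgue) = (\<Sum>k. \<integral>\<^sup>+x. d k x \<partial>lebesgue)"
    by (rule nn_integral_suminf) simp
  also have "\<dots> \<le> (\<Sum>k. ennreal ((1 + measure lebesgue \<Omega>) * (1 / 2) ^ k))"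
    by (intro suminf_le d_int summableI)
  also have "\<dots> = ennreal ((1 + measure lebesgue \<Omega>) * 2)"
    using sums_mult[OF geometric_sums[of "1/2 :: real"], of "1 + measure lebesgue \<Omega>"]
    by (intro suminf_ennreal_eq) auto
  also have "\<dots> < \<infinity>" by simp
  finally have "AE x in lebesgue. (\<Sum>k. ennreal (d k x)) \<noteq> \<infinity>"
    by (intro nn_integral_PInf_AE) auto
  then have conv: "AE x in lebesgue. convergent (\<lambda>k. z (t k) x)"
  proof eventually_elim
    case (elim x)
    then have "summable (\<lambda>k. d k x)" by (intro summable_suminf_not_top) (auto simp: d_def)
    then have "summable (\<lambda>k. z (t (Suc k)) x - z (t k) x)" unfolding d_def by (rule summable_rabs_cancel)
    then have "convergent (\<lambda>n. (\<Sum>k<n. z (t (Suc k)) x - z (t k) x) + z (t 0) x)"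
      by (intro convergent_add convergent_const) (simp add: summable_iff_convergent)
    moreover have "(\<Sum>k<n. z (t (Suc k)) x - z (t k) x) + z (t 0) x = z (t n) x" for n
      using sum_lessThan_telescope[of "\<lambda>k. z (t k) x" n] by simp
    ultimately show ?case by (simp only:)
  qed
  define w where "w x = lim (\<lambda>k. z (t k) x)" for x
  have "w \<in> borel_measurable lebesgue" unfolding w_def using m by (intro borel_measurable_lim_metric)
  moreover have "AE x in lebesgue. (\<lambda>k. z (t k) x) \<longlonglongrightarrow> w x"
    using conv by eventually_elim (simp add: w_def convergent_LIMSEQ_iff)
  ultimately show ?thesis using t N t_ge by (intro exI[of _ t] exI[of _ w]) auto
qed

text \<open>Fatou serves three times: for square integrability of the limit, for its energy, and for
  L2 convergence, by letting the second index of the Cauchy estimate tend to infinity.\<close>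

lemma frac_H0s_compact:
  fixes \<Omega> :: "'a::euclidean_space set"
  assumes \<Omega>: "open \<Omega>" "bounded \<Omega>" and s: "0 < s" and u: "\<And>n. u n \<in> frac_H0s s \<Omega>"
    and b: "\<And>n. (\<integral>x. (u n x)\<^sup>2 \<partial>lebesgue) \<le> b" and e: "(\<lambda>n. energy s (u n) (u n)) \<longlonglongrightarrow> e"
  shows "\<exists>r w. strict_mono (r :: nat \<Rightarrow> nat) \<and> w \<in> frac_H0s s \<Omega> \<and>
    (\<lambda>n. \<integral>x. (u (r n) x - w x)\<^sup>2 \<partial>lebesgue) \<longlonglongrightarrow> 0 \<and> energy s w w \<le> e"
proof -
  have "Bseq (\<lambda>n. energy s (u n) (u n))" using e by (intro convergent_imp_Bseq) (auto simp: convergent_def)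
  then obtain e0 where "\<And>n. \<bar>energy s (u n) (u n)\<bar> \<le> e0" unfolding Bseq_def by auto
  then have e0: "energy s (u n) (u n) \<le> e0" for n using abs_le_D1 by blast
  obtain r0 where r0: "strict_mono (r0 :: nat \<Rightarrow> nat)"
    "\<And>k. \<exists>N. \<forall>i\<ge>N. \<forall>j\<ge>N. (\<integral>x. (u (r0 i) x - u (r0 j) x)\<^sup>2 \<partial>lebesgue) \<le> 1 / 4 ^ k"
    using L2_Cauchy_subsequence[of \<Omega> s u b e0, OF \<Omega> s u b e0] by blast
  obtain t w where t: "strict_mono (t :: nat \<Rightarrow> nat)" and wm: "w \<in> borel_measurable lebesgue"
    and lim: "AE x in lebesgue. (\<lambda>k. u (r0 (t k)) x) \<longlonglongrightarrow> w x"
    and C: "\<And>k i j. i \<ge> k \<Longrightarrow> j \<ge> k \<Longrightarrow> (\<integral>x. (u (r0 (t i)) x - u (r0 (t j)) x)\<^sup>2 \<partial>lebesgue) \<le> 1 / 4 ^ k"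
    using L2_Cauchy_AE_subsequence[of \<Omega> "\<lambda>n. u (r0 n)", OF lmeasurable_open[OF \<Omega>(2,1)]
      frac_H0sD(2)[OF u] frac_H0sD(3)[OF u] frac_H0sD(5)[OF u] r0(2)] by blast
  define r where "r = r0 \<circ> t"
  have r: "strict_mono r" unfolding r_def by (rule strict_mono_o[OF r0(1) t])
  have lim': "AE x in lebesgue. (\<lambda>k. u (r k) x) \<longlonglongrightarrow> w x" using lim by (simp add: r_def)
  have C': "(\<integral>x. (u (r i) x - u (r j) x)\<^sup>2 \<partial>lebesgue) \<le> 1 / 4 ^ k" if "i \<ge> k" "j \<ge> k" for k i j
    using C[OF that] by (simp add: r_def)
  have wsq: "integrable lebesgue (\<lambda>x. (w x)\<^sup>2)"
  proof (rule Fatou_integrable(1)[of lebesgue "\<lambda>n x. (u (r n) x)\<^sup>2" _ b])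
    show "AE x in lebesgue. (\<lambda>n. (u (r n) x)\<^sup>2) \<longlonglongrightarrow> (w x)\<^sup>2" using lim' by eventually_elim (intro tendsto_power)
    show "(\<lambda>x. (w x)\<^sup>2) \<in> borel_measurable lebesgue" using wm by measurable
  qed (use frac_H0sD(3)[OF u] b in auto)
  have pair_lim: "AE z in leb2. (\<lambda>n. case z of (x, y) \<Rightarrow> (u (r n) x - u (r n) y)\<^sup>2 * frac_ker s (x - y)) \<longlonglongrightarrow>
      (case z of (x, y) \<Rightarrow> (w x - w y)\<^sup>2 * frac_ker s (x - y))"
    using AE_leb2_fst[OF lim'] AE_leb2_snd[OF lim']
    by eventually_elim (auto split: prod.splits intro!: tendsto_intros)
  have pm: "(\<lambda>(x, y). (w x - w y)\<^sup>2 * frac_ker s (x - y)) \<in> borel_measurable leb2"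
    using leb2_measurable_prod_ker[OF wm wm, of s] by (simp add: power2_eq_square)
  have er: "(\<lambda>n. energy s (u (r n)) (u (r n))) \<longlonglongrightarrow> e" using LIMSEQ_subseq_LIMSEQ[OF e r] by (simp add: o_def)
  \<comment> \<open>The energies converge to \<open>e\<close> but need not lie below it, so Fatou is
    applied with the bound \<open>e + \<epsilon>\<close>.\<close>
  have fat: "integrable leb2 (\<lambda>(x, y). (w x - w y)\<^sup>2 * frac_ker s (x - y)) \<and> energy s w w \<le> e + \<epsilon>" if "0 < \<epsilon>" for \<epsilon>
  proof -
    have "\<forall>\<^sub>F n in sequentially. energy s (u (r n)) (u (r n)) < e + \<epsilon>"
      using order_tendstoD(2)[OF er, of "e + \<epsilon>"] that by simp
    then have ev: "\<forall>\<^sub>F n in sequentially. (\<integral>z. (case z of (x, y) \<Rightarrow> (u (r n) x - u (r n) y)\<^sup>2 * frac_ker s (x - y)) \<partial>leb2) \<le> e + \<epsilon>"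
      unfolding energy_self by eventually_elim simp
    from Fatou_integrable[OF frac_H0sD(4)[OF u] _ pm pair_lim ev]
    show ?thesis unfolding energy_self by (auto split: prod.split)
  qed
  have w0: "AE x in lebesgue. x \<notin> \<Omega> \<longrightarrow> w x = 0"
  proof -
    have "AE x in lebesgue. \<forall>n. x \<notin> \<Omega> \<longrightarrow> u (r n) x = 0"
      unfolding AE_all_countable using frac_H0sD(5)[OF u] by blast
    then show ?thesis using lim'
    proof eventually_elim
      case (elim x)
      show ?case
      proof
        assume "x \<notin> \<Omega>"
        then have "(\<lambda>k. 0) \<longlonglongrightarrow> w x" using elim by simp
        then show "w x = 0" by (simp add: LIMSEQ_const_iff)
      qed
    qed
  qed
  have w: "w \<in> frac_H0s s \<Omega>" using wm wsq fat[of 1] w0 by (simp add: frac_H0s_def frac_Hs_iff)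
  have "energy s w w \<le> e" by (rule field_le_epsilon) (use fat in blast)
  moreover have "(\<lambda>n. \<integral>x. (u (r n) x - w x)\<^sup>2 \<partial>lebesgue) \<longlonglongrightarrow> 0"
  proof (rule tendsto_sandwich)
    have "(\<integral>x. (u (r k) x - w x)\<^sup>2 \<partial>lebesgue) \<le> 1 / 4 ^ k" for k
    proof (rule Fatou_integrable(2)[of lebesgue "\<lambda>n x. (u (r k) x - u (r n) x)\<^sup>2"])
      show "integrable lebesgue (\<lambda>x. (u (r k) x - u (r n) x)\<^sup>2)" for n
        by (rule frac_H0sD(3)[OF frac_H0s_diff[OF u u]])
      show "(\<lambda>x. (u (r k) x - w x)\<^sup>2) \<in> borel_measurable lebesgue" using wm frac_H0sD(2)[OF u] by measurable
      show "AE x in lebesgue. (\<lambda>n. (u (r k) x - u (r n) x)\<^sup>2) \<longlonglongrightarrow> (u (r k) x - w x)\<^sup>2"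
        using lim' by eventually_elim (intro tendsto_intros)
      show "\<forall>\<^sub>F n in sequentially. (\<integral>x. (u (r k) x - u (r n) x)\<^sup>2 \<partial>lebesgue) \<le> 1 / 4 ^ k"
        using eventually_ge_at_top[of k] by eventually_elim (rule C', auto)
    qed simp
    then show "\<forall>\<^sub>F n in sequentially. (\<integral>x. (u (r n) x - w x)\<^sup>2 \<partial>lebesgue) \<le> (1 / 4) ^ n"
      by (simp add: power_one_over)
    show "\<forall>\<^sub>F n in sequentially. 0 \<le> (\<integral>x. (u (r n) x - w x)\<^sup>2 \<partial>lebesgue)"
      by (intro always_eventually allI integral_nonneg_AE) auto
    show "(\<lambda>n. 0) \<longlonglongrightarrow> (0::real)" by simp
    show "(\<lambda>n. (1 / 4 :: real) ^ n) \<longlonglongrightarrow> 0" by (rule LIMSEQ_power_zero) simp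
  qed
  ultimately show ?thesis using r w by blast
qed

section \<open>Bounds on the eigenvalues\<close>

lemma frac_const_pos:
  assumes "0 < s" "s < 1" shows "0 < frac_const N s"
  unfolding frac_const_def using assms
  by (intro divide_pos_pos mult_pos_pos Gamma_real_pos) (auto intro: add_nonneg_pos)

lemma far_weighted_integral:
  fixes w :: "'a::euclidean_space \<Rightarrow> real"
  assumes "integrable lebesgue w" "0 < r" "0 < s"
  shows "(\<integral>(x, y). w x * far s r (x - y) \<partial>leb2) = tail TYPE('a) s r * (\<integral>x. w x \<partial>lebesgue)"
    and "(\<integral>(x, y). w y * far s r (x - y) \<partial>leb2) = tail TYPE('a) s r * (\<integral>x. w x \<partial>lebesgue)"
proof -
  note i = far_weighted(1)[OF assms]
  show 1: "(\<integral>(x, y). w x * far s r (x - y) \<partial>leb2) = tail TYPE('a) s r * (\<integral>x. w x \<partial>lebesgue)"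
    using lebesgue_pair.integral_fst[OF i] by (simp add: far_integral mult.commute)
  show "(\<integral>(x, y). w y * far s r (x - y) \<partial>leb2) = tail TYPE('a) s r * (\<integral>x. w x \<partial>lebesgue)"
    using integrable_leb2_swap(2)[OF i] 1 by (simp add: far_minus)
qed

lemma near_weighted_integral_le:
  fixes w :: "'a::euclidean_space \<Rightarrow> real"
  assumes w: "integrable lebesgue w" "\<And>x. 0 \<le> w x" and s: "0 < s" "s \<le> 1/4"
  shows "(\<integral>(x, y). w x * near s 1 (x - y) \<partial>leb2) \<le> near_bound TYPE('a) * (\<integral>x. w x \<partial>lebesgue)"
    and "(\<integral>(x, y). w y * near s 1 (x - y) \<partial>leb2) \<le> near_bound TYPE('a) * (\<integral>x. w x \<partial>lebesgue)"
proof -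
  note i = near_weighted(1)[OF w(1) zero_less_one s]
  have "(\<integral>(x, y). w x * near s 1 (x - y) \<partial>leb2) = (\<integral>x. w x * (\<integral>y. near s 1 (x - y) \<partial>lebesgue) \<partial>lebesgue)"
    using lebesgue_pair.integral_fst[OF i] by simp
  also have "\<dots> \<le> (\<integral>x. w x * near_bound TYPE('a) \<partial>lebesgue)"
  proof (rule integral_mono)
    show "integrable lebesgue (\<lambda>x. w x * (\<integral>y. near s 1 (x - y) \<partial>lebesgue))"
      using lebesgue_pair.integrable_fst[OF i] by simp
    show "w x * (\<integral>y. near s 1 (x - y) \<partial>lebesgue) \<le> w x * near_bound TYPE('a)" for x
      using near_integral[OF zero_less_one s, of x] w(2) by (intro mult_left_mono) auto
  qed (use w in simp)
  finally show 1: "(\<integral>(x, y). w x * near s 1 (x - y) \<partial>leb2) \<le> near_bound TYPE('a) * (\<integral>x. w x \<partial>lebesgue)"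
    by (simp add: mult.commute)
  show "(\<integral>(x, y). w y * near s 1 (x - y) \<partial>leb2) \<le> near_bound TYPE('a) * (\<integral>x. w x \<partial>lebesgue)"
    using integrable_leb2_swap(2)[OF i] 1 by (simp add: near_minus)
qed

lemma square_sum_disjoint:
  fixes a :: "'i \<Rightarrow> real"
  assumes "finite I" "\<And>i j. i \<in> I \<Longrightarrow> j \<in> I \<Longrightarrow> i \<noteq> j \<Longrightarrow> a i * a j = 0"
  shows "(\<Sum>i\<in>I. a i)\<^sup>2 = (\<Sum>i\<in>I. (a i)\<^sup>2)"
proof -
  have "(\<Sum>i\<in>I. a i)\<^sup>2 = (\<Sum>i\<in>I. \<Sum>j\<in>I. a i * a j)" by (simp add: power2_eq_square sum_product)
  also have "\<dots> = (\<Sum>i\<in>I. \<Sum>j\<in>I. if j = i then (a i)\<^sup>2 else 0)"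
    using assms(2) by (intro sum.cong refl) (auto simp: power2_eq_square)
  also have "\<dots> = (\<Sum>i\<in>I. (a i)\<^sup>2)" using assms(1) by (intro sum.cong refl) (simp add: sum.delta)
  finally show ?thesis .
qed

text \<open>The test space is spanned by bumps with disjoint supports inside one ball of diameter at
  most 1, so that distances above 1 contribute exactly \<open>tail s 1\<close> to the Rayleigh quotient.\<close>

lemma test_space:
  fixes \<Omega> :: "'a::euclidean_space set"
  assumes \<Omega>: "open \<Omega>" "\<Omega> \<noteq> {}" and k: "k \<ge> 1"
  shows "\<exists>(g :: nat \<Rightarrow> 'a \<Rightarrow> real) A. 0 \<le> A \<and> (\<forall>s. 0 < s \<and> s \<le> 1/4 \<longrightarrow>
     (\<forall>i. g i \<in> frac_Hs s) \<and> (\<forall>i<k. \<forall>x. x \<notin> \<Omega> \<longrightarrow> g i x = 0) \<and>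
     (\<forall>c. energy s (\<lambda>x. \<Sum>i<k. c i * g i x) (\<lambda>x. \<Sum>i<k. c i * g i x)
        \<le> 2 * (tail TYPE('a) s 1 + A) * (\<integral>x. (\<Sum>i<k. c i * g i x)\<^sup>2 \<partial>lebesgue)) \<and>
     (\<forall>c. (\<exists>i<k. c i \<noteq> 0) \<longrightarrow> (\<integral>x. (\<Sum>i<k. c i * g i x)\<^sup>2 \<partial>lebesgue) \<noteq> 0))"
proof -
  obtain z where "z \<in> \<Omega>" using \<Omega> by auto
  then obtain \<rho>0 where "0 < \<rho>0" "ball z \<rho>0 \<subseteq> \<Omega>" using \<Omega>(1) openE by blast
  define \<rho> where "\<rho> = min \<rho>0 (1/2)"
  have \<rho>: "0 < \<rho>" "\<rho> \<le> 1/2" "ball z \<rho> \<subseteq> \<Omega>" using \<open>0 < \<rho>0\<close> \<open>ball z \<rho>0 \<subseteq> \<Omega>\<close> by (auto simp: \<rho>_def)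
  \<comment> \<open>Centres \<open>2 * \<eta>\<close> apart make the balls of radius \<eta>
    disjoint, and the last one reaches out to \<open>(2 * k - 1) * \<eta>\<close>, within
    \<open>\<rho> = 2 * k * \<eta>\<close>.\<close>
  define \<eta> where "\<eta> = \<rho> / (2 * real k)"
  have \<eta>: "0 < \<eta>" "2 * real k * \<eta> = \<rho>" using \<rho> k by (auto simp: \<eta>_def)
  obtain e :: 'a where e: "norm e = 1" using vector_choose_size[of 1] by auto
  define ctr where "ctr i = z + (2 * real i * \<eta>) *\<^sub>R e" for i :: nat
  define g where "g i x = max 0 (\<eta> - norm (x - ctr i))" for i x
  define U where "U i = ball (ctr i) \<eta>" for i
  have g_supp: "g i x = 0" if "x \<notin> U i" for i x using that by (simp add: g_def U_def dist_norm norm_minus_commute)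
  have g0: "0 \<le> g i x" "g i x \<le> \<eta>" for i x using \<eta> by (auto simp: g_def)
  have g_lip: "\<bar>g i x - g i y\<bar> \<le> 1 * norm (x - y)" for i x y
    using norm_triangle_ineq3[of "x - ctr i" "y - ctr i"] by (simp add: g_def)
  have U_sub: "U i \<subseteq> ball z \<rho>" if "i < k" for i
  proof
    fix y assume "y \<in> U i"
    then have "dist (ctr i) y < \<eta>" by (simp add: U_def)
    moreover have "dist z (ctr i) = 2 * real i * \<eta>" using e \<eta> by (simp add: ctr_def dist_norm)
    ultimately have "dist z y < (2 * real i + 1) * \<eta>" using dist_triangle[of z y "ctr i"] by (simp add: algebra_simps)
    also have "\<dots> \<le> (2 * real k) * \<eta>" using that \<eta> by (intro mult_right_mono) auto
    finally show "y \<in> ball z \<rho>" using \<eta> by simp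
  qed
  have disj: "g i x * g j x = 0" if "i \<noteq> j" for i j x
  proof (rule ccontr)
    assume "g i x * g j x \<noteq> 0"
    then have "x \<in> U i" "x \<in> U j" using g_supp by (metis mult_zero_left, metis mult_zero_right)
    then have "dist (ctr i) (ctr j) < 2 * \<eta>" using dist_triangle[of "ctr i" "ctr j" x] by (simp add: U_def dist_commute)
    moreover have "ctr i - ctr j = (2 * (real i - real j) * \<eta>) *\<^sub>R e" by (simp add: ctr_def algebra_simps)
    then have "dist (ctr i) (ctr j) = \<bar>2 * (real i - real j) * \<eta>\<bar>" using e unfolding dist_norm by (simp only: norm_scaleR mult_1_right)
    then have "dist (ctr i) (ctr j) = 2 * \<bar>real i - real j\<bar> * \<eta>" using \<eta> by (simp only: abs_mult)
    moreover have "1 \<le> \<bar>real i - real j\<bar>" using that by linarith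
    then have "2 * 1 * \<eta> \<le> 2 * \<bar>real i - real j\<bar> * \<eta>" using \<eta> by (intro mult_right_mono mult_left_mono) auto
    ultimately show False by simp
  qed
  have gH: "g i \<in> frac_Hs s" if "0 < s" "s \<le> 1/4" for s i
    by (rule lipschitz_compact_support_Hs(1)[OF that g_lip, of "U i"]) (use g_supp g0 in \<open>auto simp: U_def\<close>)
  have gm: "g i \<in> borel_measurable lebesgue" and gsq: "integrable lebesgue (\<lambda>x. (g i x)\<^sup>2)" for i
    using gH[of "1/4" i] by (auto simp: frac_Hs_iff)
  define \<kappa> where "\<kappa> = (\<eta> / 2)\<^sup>2 * (unit_ball_vol (real DIM('a)) * (\<eta> / 2) ^ DIM('a))"
  have \<kappa>: "0 < \<kappa>" using \<eta> by (simp add: \<kappa>_def)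
  define \<beta> where "\<beta> = unit_ball_vol (real DIM('a)) * \<eta> ^ DIM('a)"
  have \<beta>: "0 < \<beta>" using \<eta> by (simp add: \<beta>_def)
  have iB: "integrable lebesgue (indicat_real (ball c r))" for c :: 'a and r
    using lmeasurable_ball by (simp add: lmeasurable_iff_integrable)
  have mass: "\<kappa> \<le> (\<integral>x. (g i x)\<^sup>2 \<partial>lebesgue)" for i
  proof -
    have "\<kappa> = (\<integral>x. (\<eta> / 2)\<^sup>2 * indicat_real (ball (ctr i) (\<eta> / 2)) x \<partial>lebesgue)"
      using \<eta> by (simp add: \<kappa>_def content_ball)
    also have "\<dots> \<le> (\<integral>x. (g i x)\<^sup>2 \<partial>lebesgue)"
    proof (rule integral_mono)
      fix x
      show "(\<eta> / 2)\<^sup>2 * indicat_real (ball (ctr i) (\<eta> / 2)) x \<le> (g i x)\<^sup>2"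
      proof (cases "x \<in> ball (ctr i) (\<eta> / 2)")
        case True
        then have "norm (x - ctr i) < \<eta> / 2" by (simp add: dist_norm norm_minus_commute)
        then have "\<eta> / 2 \<le> g i x" unfolding g_def by linarith
        then have "(\<eta> / 2)\<^sup>2 \<le> (g i x)\<^sup>2" using \<eta> by (intro power_mono) auto
        then show ?thesis using True by simp
      qed simp
    qed (use iB gsq in auto)
    finally show ?thesis .
  qed
  \<comment> \<open>\<open>k\<close> pays for the square of a sum of k terms,
    \<open>\<beta> * near_bound\<close> bounds the short-range energy of a bump, and \<kappa>
    converts the sum of squared coefficients into the squared L2 norm.\<close>
  define A where "A = real k * \<beta> * near_bound TYPE('a) / \<kappa>"
  have nb: "0 < near_bound TYPE('a)" by (rule near_bound_pos)
  have A: "0 \<le> A" using \<beta> \<kappa> nb by (simp add: A_def)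
  define G where "G c x = (\<Sum>i<k. c i * g i x)" for c x
  have G_sq: "(G c x)\<^sup>2 = (\<Sum>i<k. (c i)\<^sup>2 * (g i x)\<^sup>2)" for c x
  proof -
    have "(G c x)\<^sup>2 = (\<Sum>i<k. (c i * g i x)\<^sup>2)"
      unfolding G_def by (rule square_sum_disjoint) (use disj in \<open>auto simp: mult_ac\<close>)
    then show ?thesis by (simp add: power_mult_distrib)
  qed
  have G_int: "integrable lebesgue (\<lambda>x. (G c x)\<^sup>2)" for c unfolding G_sq using gsq by simp
  have G_mass: "\<kappa> * (\<Sum>i<k. (c i)\<^sup>2) \<le> (\<integral>x. (G c x)\<^sup>2 \<partial>lebesgue)" for c
  proof -
    have "\<kappa> * (\<Sum>i<k. (c i)\<^sup>2) = (\<Sum>i<k. (c i)\<^sup>2 * \<kappa>)" by (simp add: sum_distrib_left mult.commute)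
    also have "\<dots> \<le> (\<Sum>i<k. (c i)\<^sup>2 * (\<integral>x. (g i x)\<^sup>2 \<partial>lebesgue))" by (intro sum_mono mult_left_mono mass) auto
    also have "\<dots> = (\<integral>x. (G c x)\<^sup>2 \<partial>lebesgue)" unfolding G_sq using gsq by simp
    finally show ?thesis .
  qed
  have G_supp: "G c x = 0" if "x \<notin> ball z \<rho>" for c x
    unfolding G_def using that U_sub g_supp by (intro sum.neutral) (metis lessThan_iff mult_zero_right subsetD)
  have bound: "energy s (G c) (G c) \<le> 2 * (tail TYPE('a) s 1 + A) * (\<integral>x. (G c x)\<^sup>2 \<partial>lebesgue)"
    if s: "0 < s" "s \<le> 1/4" for s c
  proof -
    define T where "T = (\<integral>x. (G c x)\<^sup>2 \<partial>lebesgue)"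
    define F1 where "F1 p = (case p of (x, y) \<Rightarrow> (G c x)\<^sup>2 * far s 1 (x - y))" for p
    define F2 where "F2 p = (case p of (x, y) \<Rightarrow> (G c y)\<^sup>2 * far s 1 (x - y))" for p
    define N1 where "N1 i p = (case p of (x, y) \<Rightarrow> indicat_real (U i) x * near s 1 (x - y))" for i p
    define N2 where "N2 i p = (case p of (x, y) \<Rightarrow> indicat_real (U i) y * near s 1 (x - y))" for i p
    have iF: "integrable leb2 F1" "integrable leb2 F2"
      unfolding F1_def F2_def using far_weighted[OF G_int zero_less_one s(1)] by auto
    have iU: "integrable lebesgue (indicat_real (U i))" for i unfolding U_def by (rule iB)
    have iN: "integrable leb2 (N1 i)" "integrable leb2 (N2 i)" for i
      unfolding N1_def N2_def using near_weighted[OF iU zero_less_one s] by auto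
    have U_meas: "(\<integral>x. indicat_real (U i) x \<partial>lebesgue) = \<beta>" for i
      using \<eta> by (simp add: U_def \<beta>_def content_ball)
    have "energy s (G c) (G c) \<le> (\<integral>p. F1 p + F2 p + (\<Sum>i<k. real k * (c i)\<^sup>2 * (N1 i p + N2 i p)) \<partial>leb2)"
      unfolding energy_self
    \<comment> \<open>A function that is not integrable has integral 0, so only the nonnegative
      majorant has to be shown integrable.\<close>
    proof (rule integral_mono')
      show "integrable leb2 (\<lambda>p. F1 p + F2 p + (\<Sum>i<k. real k * (c i)\<^sup>2 * (N1 i p + N2 i p)))"
        using iF iN by auto
      fix p :: "'a \<times> 'a"
      obtain x y where p: "p = (x, y)" by (cases p)
      have F_nonneg: "0 \<le> F1 p" "0 \<le> F2 p" by (auto simp: F1_def F2_def p)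
      have N_nonneg: "0 \<le> (\<Sum>i<k. real k * (c i)\<^sup>2 * (N1 i p + N2 i p))"
        by (intro sum_nonneg) (auto simp: N1_def N2_def p intro!: mult_nonneg_nonneg add_nonneg_nonneg)
      show "0 \<le> F1 p + F2 p + (\<Sum>i<k. real k * (c i)\<^sup>2 * (N1 i p + N2 i p))" using F_nonneg N_nonneg by linarith
      have "(G c x - G c y)\<^sup>2 * frac_ker s (x - y) \<le> F1 p + F2 p + (\<Sum>i<k. real k * (c i)\<^sup>2 * (N1 i p + N2 i p))"
      proof (cases "norm (x - y) < 1")
        case True
        have "(G c x - G c y)\<^sup>2 = (\<Sum>i<k. c i * (g i x - g i y))\<^sup>2"
          by (simp add: G_def right_diff_distrib sum_subtractf)
        also have "\<dots> \<le> (\<Sum>i<k. (c i * (g i x - g i y))\<^sup>2) * real k"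
          using sum_squared_le_sum_of_squares[of "\<lambda>i. c i * (g i x - g i y)" "{..<k}"] by simp
        finally have "(G c x - G c y)\<^sup>2 * frac_ker s (x - y) \<le> (\<Sum>i<k. (c i * (g i x - g i y))\<^sup>2) * real k * frac_ker s (x - y)"
          by (rule mult_right_mono) simp
        also have "\<dots> = (\<Sum>i<k. real k * (c i)\<^sup>2 * ((g i x - g i y)\<^sup>2 * frac_ker s (x - y)))"
          by (simp add: sum_distrib_left sum_distrib_right power_mult_distrib mult_ac)
        also have "\<dots> \<le> (\<Sum>i<k. real k * (c i)\<^sup>2 * (N1 i p + N2 i p))"
        proof (intro sum_mono mult_left_mono)
          fix i
          have "(g i x - g i y)\<^sup>2 * frac_ker s (x - y) \<le> 1\<^sup>2 * ((indicator (U i) x + indicator (U i) y) * near s 1 (x - y))"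
            by (rule lipschitz_compact_support_Hs(2)[OF s g_lip _ _ _ _ True]) (use g_supp g0 in \<open>auto simp: U_def\<close>)
          then show "(g i x - g i y)\<^sup>2 * frac_ker s (x - y) \<le> N1 i p + N2 i p"
            by (simp add: N1_def N2_def p distrib_right)
        qed auto
        finally show ?thesis using F_nonneg by linarith
      next
        case False
        have "G c x * G c y = 0"
        proof (rule ccontr)
          assume "G c x * G c y \<noteq> 0"
          then have "x \<in> ball z \<rho>" "y \<in> ball z \<rho>" using G_supp by (metis mult_zero_left, metis mult_zero_right)
          then have "dist x y < 1" using dist_triangle[of x y z] \<rho>(2) by (simp add: dist_commute)
          then show False using False by (simp add: dist_norm)
        qed
        then have "(G c x - G c y)\<^sup>2 = (G c x)\<^sup>2 + (G c y)\<^sup>2" by (simp add: power2_diff)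
        then have "(G c x - G c y)\<^sup>2 * frac_ker s (x - y) = F1 p + F2 p"
          using False by (simp add: F1_def F2_def p far_def distrib_right)
        then show ?thesis using N_nonneg by linarith
      qed
      then show "(case p of (x, y) \<Rightarrow> (G c x - G c y)\<^sup>2 * frac_ker s (x - y)) \<le> F1 p + F2 p + (\<Sum>i<k. real k * (c i)\<^sup>2 * (N1 i p + N2 i p))"
        by (simp add: p)
    qed
    also have "\<dots> = (\<integral>p. F1 p \<partial>leb2) + (\<integral>p. F2 p \<partial>leb2) + (\<Sum>i<k. real k * (c i)\<^sup>2 * ((\<integral>p. N1 i p \<partial>leb2) + (\<integral>p. N2 i p \<partial>leb2)))"
      using iF iN by simp
    also have "(\<integral>p. F1 p \<partial>leb2) = tail TYPE('a) s 1 * T"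
      unfolding F1_def T_def by (rule far_weighted_integral(1)[OF G_int zero_less_one s(1)])
    also have "(\<integral>p. F2 p \<partial>leb2) = tail TYPE('a) s 1 * T"
      unfolding F2_def T_def by (rule far_weighted_integral(2)[OF G_int zero_less_one s(1)])
    also have "(\<Sum>i<k. real k * (c i)\<^sup>2 * ((\<integral>p. N1 i p \<partial>leb2) + (\<integral>p. N2 i p \<partial>leb2)))
        \<le> (\<Sum>i<k. real k * (c i)\<^sup>2 * (near_bound TYPE('a) * \<beta> + near_bound TYPE('a) * \<beta>))"
    proof (intro sum_mono mult_left_mono add_mono)
      fix i
      show "(\<integral>p. N1 i p \<partial>leb2) \<le> near_bound TYPE('a) * \<beta>" "(\<integral>p. N2 i p \<partial>leb2) \<le> near_bound TYPE('a) * \<beta>"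
        using near_weighted_integral_le[OF iU _ s, of i] unfolding N1_def N2_def U_meas by simp_all
    qed auto
    also have "\<dots> = 2 * A * (\<kappa> * (\<Sum>i<k. (c i)\<^sup>2))"
    proof -
      have "2 * A * (\<kappa> * q) = real k * q * (near_bound TYPE('a) * \<beta> + near_bound TYPE('a) * \<beta>)" for q
        using \<kappa> by (simp add: A_def)
      then show ?thesis by (simp only: sum_distrib_left)
    qed
    also have "\<dots> \<le> 2 * A * T"
      unfolding T_def using A by (intro mult_left_mono G_mass) auto
    finally show ?thesis unfolding T_def[symmetric] by (simp add: algebra_simps)
  qed
  have indep: "(\<integral>x. (G c x)\<^sup>2 \<partial>lebesgue) \<noteq> 0" if "\<exists>i<k. c i \<noteq> 0" for c
  proof -
    have "0 < (\<Sum>i<k. (c i)\<^sup>2)" using that by (auto intro!: sum_pos2)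
    then have "0 < \<kappa> * (\<Sum>i<k. (c i)\<^sup>2)" using \<kappa> by simp
    then show ?thesis using G_mass[of c] by linarith
  qed
  have out: "g i x = 0" if "i < k" "x \<notin> \<Omega>" for i x using that U_sub[of i] \<rho>(3) g_supp by blast
  show ?thesis
    using A gH out bound indep unfolding G_def by (intro exI[of _ g] exI[of _ A]) blast
qed

section \<open>The fractional form as an instance of the abstract pair of forms\<close>

lemma energy_add:
  fixes u v w :: "'a::euclidean_space \<Rightarrow> real"
  assumes "u \<in> frac_Hs s" "v \<in> frac_Hs s" "w \<in> frac_Hs s"
  shows "energy s (\<lambda>x. u x + v x) w = energy s u w + energy s v w"
proof -
  have "energy s (\<lambda>x. u x + v x) w = (\<integral>p. (case p of (x, y) \<Rightarrow> (u x - u y) * (w x - w y) * frac_ker s (x - y))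
     + (case p of (x, y) \<Rightarrow> (v x - v y) * (w x - w y) * frac_ker s (x - y)) \<partial>leb2)"
    unfolding energy_def by (intro Bochner_Integration.integral_cong) (auto simp: algebra_simps)
  then show ?thesis unfolding energy_def using energy_integrable[of u s w] energy_integrable[of v s w] assms by simp
qed

lemma energy_scale: "energy s (\<lambda>x. a * u x) w = a * energy s u w"
proof -
  have "energy s (\<lambda>x. a * u x) w = (\<integral>p. a * (case p of (x, y) \<Rightarrow> (u x - u y) * (w x - w y) * frac_ker s (x - y)) \<partial>leb2)"
    unfolding energy_def by (intro Bochner_Integration.integral_cong) (auto simp: algebra_simps)
  then show ?thesis by (simp add: energy_def)
qed

lemma energy_sym: "energy s u v = energy s v u"
  unfolding energy_def by (simp add: mult.commute)

lemma H0s_product_integrable: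
  assumes u: "u \<in> frac_H0s s \<Omega>" and v: "v \<in> frac_H0s s \<Omega>"
  shows "integrable lebesgue (\<lambda>x. u x * v x)"
proof (rule Bochner_Integration.integrable_bound)
  show "integrable lebesgue (\<lambda>x. (u x)\<^sup>2 + (v x)\<^sup>2)" using frac_H0sD(3)[OF u] frac_H0sD(3)[OF v] by simp
  show "(\<lambda>x. u x * v x) \<in> borel_measurable lebesgue" using frac_H0sD(2)[OF u] frac_H0sD(2)[OF v] by measurable
  have "\<bar>a * b\<bar> \<le> a\<^sup>2 + b\<^sup>2" for a b :: real
    using sum_squares_bound[of "\<bar>a\<bar>" "\<bar>b\<bar>"] abs_ge_zero[of "a * b"] unfolding abs_mult power2_abs by linarith
  then show "AE x in lebesgue. norm (u x * v x) \<le> norm ((u x)\<^sup>2 + (v x)\<^sup>2)" by simp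
qed

lemma H0s_set_integral:
  assumes \<Omega>: "open \<Omega>" and u: "u \<in> frac_H0s s \<Omega>" and v: "v \<in> frac_H0s s \<Omega>"
  shows "(LINT x:\<Omega>|lebesgue. u x * v x) = (\<integral>x. u x * v x \<partial>lebesgue)"
  unfolding set_lebesgue_integral_def
proof (rule integral_cong_AE)
  show m: "(\<lambda>x. u x * v x) \<in> borel_measurable lebesgue" using frac_H0sD(2)[OF u] frac_H0sD(2)[OF v] by measurable
  have "\<Omega> \<in> sets lebesgue" using \<Omega> by simp
  then show "(\<lambda>x. indicator \<Omega> x *\<^sub>R (u x * v x)) \<in> borel_measurable lebesgue" using m by measurable
  show "AE x in lebesgue. indicator \<Omega> x *\<^sub>R (u x * v x) = u x * v x"
    using frac_H0sD(5)[OF u] by eventually_elim (auto simp: indicator_def)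
qed

lemma frac_compact_form_pair:
  fixes \<Omega> :: "'a::euclidean_space set"
  assumes \<Omega>: "open \<Omega>" "bounded \<Omega>" and s: "0 < s" "s < 1"
  shows "compact_form_pair (frac_H0s s \<Omega>) (\<lambda>u v. \<integral>x. u x * v x \<partial>lebesgue) (frac_form s)"
proof -
  define C where "C = frac_const DIM('a) s"
  have C: "0 < C" unfolding C_def by (rule frac_const_pos[OF s])
  have form: "frac_form s u v = C / 2 * energy s u v" for u v :: "'a \<Rightarrow> real" by (simp add: frac_form_eq C_def)
  have zero: "(\<lambda>x. 0) \<in> frac_H0s s \<Omega>" by (simp add: frac_H0s_def frac_Hs_iff split_beta')
  have add: "(\<lambda>x. u x + v x) \<in> frac_H0s s \<Omega>" if "u \<in> frac_H0s s \<Omega>" "v \<in> frac_H0s s \<Omega>" for u v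
    using frac_H0s_lin[OF that, of 1 1] by simp
  have scale: "(\<lambda>x. a * u x) \<in> frac_H0s s \<Omega>" if "u \<in> frac_H0s s \<Omega>" for a u
    using frac_H0s_lin[OF that that, of a 0] by simp
  interpret E: psd_form "frac_H0s s \<Omega>" "frac_form s"
  proof
    fix u v w :: "'a \<Rightarrow> real" and a :: real
    assume u: "u \<in> frac_H0s s \<Omega>" and v: "v \<in> frac_H0s s \<Omega>"
    show "frac_form s (\<lambda>x. u x + v x) w = frac_form s u w + frac_form s v w" if "w \<in> frac_H0s s \<Omega>"
      using frac_H0sD(1)[OF u] frac_H0sD(1)[OF v] frac_H0sD(1)[OF that] by (simp add: form energy_add distrib_left)
    show "frac_form s u v = frac_form s v u" by (simp add: form energy_sym[of s u v])
  next
    show "frac_form s (\<lambda>x. a * u x) w = a * frac_form s u w" for a and u w :: "'a \<Rightarrow> real" by (simp add: form energy_scale)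
    show "0 \<le> frac_form s u u" for u :: "'a \<Rightarrow> real" using C energy_nonneg[of s u] by (simp add: form)
  qed (fact zero add scale)+
  interpret G: psd_form "frac_H0s s \<Omega>" "\<lambda>u v. \<integral>x. u x * v x \<partial>lebesgue"
  proof
    fix u v w :: "'a \<Rightarrow> real"
    assume u: "u \<in> frac_H0s s \<Omega>" and v: "v \<in> frac_H0s s \<Omega>"
    show "(\<integral>x. (u x + v x) * w x \<partial>lebesgue) = (\<integral>x. u x * w x \<partial>lebesgue) + (\<integral>x. v x * w x \<partial>lebesgue)" if w: "w \<in> frac_H0s s \<Omega>"
      using H0s_product_integrable[OF u w] H0s_product_integrable[OF v w] by (simp add: distrib_right)
    show "(\<integral>x. u x * v x \<partial>lebesgue) = (\<integral>x. v x * u x \<partial>lebesgue)" by (simp add: mult.commute)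
  next
    show "(\<integral>x. a * u x * w x \<partial>lebesgue) = a * (\<integral>x. u x * w x \<partial>lebesgue)" for a and u w :: "'a \<Rightarrow> real"
      by (simp add: mult.assoc)
    show "0 \<le> (\<integral>x. u x * u x \<partial>lebesgue)" for u :: "'a \<Rightarrow> real" by (intro integral_nonneg_AE) auto
  qed (fact zero add scale)+
  show ?thesis
  proof
    fix u :: "nat \<Rightarrow> 'a \<Rightarrow> real" and b e
    assume u: "\<And>n. u n \<in> frac_H0s s \<Omega>" and b: "\<And>n. (\<integral>x. u n x * u n x \<partial>lebesgue) \<le> b"
      and e: "(\<lambda>n. frac_form s (u n) (u n)) \<longlonglongrightarrow> e"
    have "(\<lambda>n. 2 / C * frac_form s (u n) (u n)) \<longlonglongrightarrow> 2 / C * e" by (intro tendsto_intros e)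
    then have e': "(\<lambda>n. energy s (u n) (u n)) \<longlonglongrightarrow> 2 / C * e" using C by (simp add: form)
    obtain r w where r: "strict_mono (r :: nat \<Rightarrow> nat)" "w \<in> frac_H0s s \<Omega>"
      "(\<lambda>n. \<integral>x. (u (r n) x - w x)\<^sup>2 \<partial>lebesgue) \<longlonglongrightarrow> 0" "energy s w w \<le> 2 / C * e"
      using frac_H0s_compact[of \<Omega> s u b, OF \<Omega> s(1) u _ e'] b by (auto simp: power2_eq_square)
    have "frac_form s w w \<le> C / 2 * (2 / C * e)" unfolding form using C r(4) by (intro mult_left_mono) auto
    then have "frac_form s w w \<le> e" using C by simp
    then show "\<exists>r w. strict_mono (r :: nat \<Rightarrow> nat) \<and> w \<in> frac_H0s s \<Omega> \<and>
       (\<lambda>n. \<integral>x. (u (r n) x - w x) * (u (r n) x - w x) \<partial>lebesgue) \<longlonglongrightarrow> 0 \<and> frac_form s w w \<le> e"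
      using r by (intro exI[of _ r] exI[of _ w]) (simp add: power2_eq_square)
  qed
qed

text \<open>On the energy space a null vector of the L2 product is a function vanishing almost
  everywhere. The concrete and abstract notions of eigenfunction and of independence therefore
  agree, and \<open>frac_kth_eigenvalue\<close> is the least number with
  \<open>kth k\<close>.\<close>

lemma frac_kth_eigenvalue_le:
  fixes \<Omega> :: "'a::euclidean_space set"
  assumes \<Omega>: "open \<Omega>" "bounded \<Omega>" and s: "0 < s" "s < 1" and k: "k \<ge> 1"
    and g: "\<And>i. i < k \<Longrightarrow> g i \<in> frac_H0s s \<Omega>"
    and bound: "\<And>c. frac_form s (\<lambda>x. \<Sum>i<k. c i * g i x) (\<lambda>x. \<Sum>i<k. c i * g i x) \<le> X * (\<integral>x. (\<Sum>i<k. c i * g i x)\<^sup>2 \<partial>lebesgue)"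
    and indep: "\<And>c. \<exists>i<k. c i \<noteq> 0 \<Longrightarrow> (\<integral>x. (\<Sum>i<k. c i * g i x)\<^sup>2 \<partial>lebesgue) \<noteq> 0"
  shows "frac_kth_eigenvalue s \<Omega> k \<le> X"
proof -
  interpret compact_form_pair "frac_H0s s \<Omega>" "\<lambda>u v. \<integral>x. u x * v x \<partial>lebesgue" "frac_form s"
    by (rule frac_compact_form_pair[OF \<Omega> s])
  have zero_iff: "(\<integral>x. u x * u x \<partial>lebesgue) = 0 \<longleftrightarrow> (AE x in lebesgue. u x = 0)" if u: "u \<in> frac_H0s s \<Omega>" for u
    using integral_nonneg_eq_0_iff_AE[OF H0s_product_integrable[OF u u]] by simp
  have eigen_iff: "frac_eigenfunction s \<Omega> lam u \<longleftrightarrow> eigen lam u" for lam u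
    unfolding frac_eigenfunction_def eigen_def
    using zero_iff H0s_set_integral[OF \<Omega>(1)] by (metis (lifting))
  have indep_iff: "ae_lin_indep F \<longleftrightarrow> indep F" if F: "\<And>f. f \<in> F \<Longrightarrow> f \<in> frac_H0s s \<Omega>" for F
  proof (cases "finite F")
    case True
    have "(\<lambda>x. \<Sum>f\<in>F. c f * f x) \<in> frac_H0s s \<Omega>" for c by (rule G.sum_mem) (use True F in auto)
    from zero_iff[OF this] show ?thesis unfolding ae_lin_indep_def indep_def by simp
  qed (simp add: ae_lin_indep_def indep_def)
  have "(frac_eigenvalue s \<Omega> lam \<and> (\<exists>F. card F = k \<and> ae_lin_indep F \<and> (\<forall>f\<in>F. \<exists>\<mu>\<le>lam. frac_eigenfunction s \<Omega> \<mu> f)))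
      \<longleftrightarrow> kth k lam" for lam
  proof -
    have "ae_lin_indep F \<longleftrightarrow> indep F" if "\<forall>f\<in>F. \<exists>\<mu>\<le>lam. eigen \<mu> f" for F
      using that by (intro indep_iff) (auto simp: eigen_def)
    then show ?thesis unfolding kth_def frac_eigenvalue_def eigen_iff by blast
  qed
  then have "frac_kth_eigenvalue s \<Omega> k = (LEAST lam. kth k lam)" by (simp add: frac_kth_eigenvalue_def)
  also have "\<dots> \<le> X"
    by (rule kth_eigenvalue_le[OF k, of g]) (use g bound indep in \<open>simp_all add: power2_eq_square\<close>)
  finally show ?thesis .
qed

theorem theorem5p2:
  fixes \<Omega> :: "'a::euclidean_space set"
    and k :: nat
    and \<phi> :: "real \<Rightarrow> 'a \<Rightarrow> real"
  assumes "open \<Omega>" and "bounded \<Omega>"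
    and "lipschitz_boundary \<Omega>"
    and "uniform_exterior_sphere \<Omega>"
    and "k \<ge> 1"
    and "\<And>s. s \<in> {0<..1/4} \<Longrightarrow>
           frac_eigenfunction s \<Omega> (frac_kth_eigenvalue s \<Omega> k) (\<phi> s)"
    and "\<And>s. s \<in> {0<..1/4} \<Longrightarrow> (LINT x:\<Omega>|lebesgue. (\<phi> s x)\<^sup>2) = 1"
  shows "\<forall>\<epsilon>>0. \<exists>\<delta>>0. \<forall>s\<in>{0<..1/4}.
           AE x in lebesgue. x \<in> \<Omega> \<and> dist_compl \<Omega> x < \<delta> \<longrightarrow> \<bar>\<phi> s x\<bar> \<le> \<epsilon>"
proof (intro allI impI)
  fix \<epsilon> :: real assume \<epsilon>: "0 < \<epsilon>"
  note \<Omega> = assms(1,2)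
  \<comment> \<open>The geometric hypotheses hold vacuously for the empty set; normalisation at one
    value of s excludes it.\<close>
  have "(LINT x:\<Omega>|lebesgue. (\<phi> (1/4) x)\<^sup>2) = 1" using assms(7)[of "1/4"] by simp
  then have ne: "\<Omega> \<noteq> {}" by (auto simp: set_lebesgue_integral_def)
  obtain g :: "nat \<Rightarrow> 'a \<Rightarrow> real" and A where A: "0 \<le> A"
    and gH: "\<And>s i. 0 < s \<Longrightarrow> s \<le> 1/4 \<Longrightarrow> g i \<in> frac_Hs s"
    and gout: "\<And>i x. i < k \<Longrightarrow> x \<notin> \<Omega> \<Longrightarrow> g i x = 0"
    and gbound: "\<And>s c. 0 < s \<Longrightarrow> s \<le> 1/4 \<Longrightarrow> energy s (\<lambda>x. \<Sum>i<k. c i * g i x) (\<lambda>x. \<Sum>i<k. c i * g i x)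
        \<le> 2 * (tail TYPE('a) s 1 + A) * (\<integral>x. (\<Sum>i<k. c i * g i x)\<^sup>2 \<partial>lebesgue)"
    and gindep: "\<And>c. \<exists>i<k. c i \<noteq> 0 \<Longrightarrow> (\<integral>x. (\<Sum>i<k. c i * g i x)\<^sup>2 \<partial>lebesgue) \<noteq> 0"
  proof -
    obtain g :: "nat \<Rightarrow> 'a \<Rightarrow> real" and A where *: "0 \<le> A" "\<And>s. 0 < s \<and> s \<le> 1/4 \<Longrightarrow>
     (\<forall>i. g i \<in> frac_Hs s) \<and> (\<forall>i<k. \<forall>x. x \<notin> \<Omega> \<longrightarrow> g i x = 0) \<and>
     (\<forall>c. energy s (\<lambda>x. \<Sum>i<k. c i * g i x) (\<lambda>x. \<Sum>i<k. c i * g i x)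
        \<le> 2 * (tail TYPE('a) s 1 + A) * (\<integral>x. (\<Sum>i<k. c i * g i x)\<^sup>2 \<partial>lebesgue)) \<and>
     (\<forall>c. (\<exists>i<k. c i \<noteq> 0) \<longrightarrow> (\<integral>x. (\<Sum>i<k. c i * g i x)\<^sup>2 \<partial>lebesgue) \<noteq> 0)"
      using test_space[OF \<Omega>(1) ne assms(5)] by blast
    \<comment> \<open>Facts about \<open>g\<close> that do not mention s are read off at the
      admissible value 1/4.\<close>
    have "0 < (1/4::real) \<and> 1/4 \<le> (1/4::real)" by simp
    from that[OF *(1)] *(2) *(2)[OF this] show ?thesis by blast
  qed
  define v where "v = unit_ball_vol (real DIM('a)) / 8 ^ DIM('a)"
  have v: "0 < v" by (simp add: v_def)
  \<comment> \<open>\<open>p\<close> depends on \<open>A\<close> and on the dimension but not on s: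
    the linear gain in \<open>tail_dyadic\<close> absorbs \<open>A + 1\<close> for all s at
    once.\<close>
  obtain p where p: "A + 1 < real p * v" using reals_Archimedean3[OF v] by auto
  have adm: "admissible \<Omega> p s (frac_kth_eigenvalue s \<Omega> k / frac_const DIM('a) s) (\<phi> s)" if "s \<in> {0<..1/4}" for s
  proof -
    have s: "0 < s" "s \<le> 1/4" "s < 1" using that by auto
    define C where "C = frac_const DIM('a) s"
    define lam where "lam = frac_kth_eigenvalue s \<Omega> k"
    have C: "0 < C" unfolding C_def by (rule frac_const_pos[OF s(1,3)])
    have ef: "frac_eigenfunction s \<Omega> lam (\<phi> s)" unfolding lam_def by (rule assms(6)[OF that])
    then have \<phi>: "\<phi> s \<in> frac_H0s s \<Omega>" by (simp add: frac_eigenfunction_def)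
    have g: "g i \<in> frac_H0s s \<Omega>" if "i < k" for i using gH[OF s(1,2)] gout[OF that] by (simp add: frac_H0s_def)
    have "lam \<le> C * (tail TYPE('a) s 1 + A)"
      unfolding lam_def
    proof (rule frac_kth_eigenvalue_le[OF \<Omega> s(1,3) assms(5) g _ gindep])
      fix c
      show "frac_form s (\<lambda>x. \<Sum>i<k. c i * g i x) (\<lambda>x. \<Sum>i<k. c i * g i x) \<le> C * (tail TYPE('a) s 1 + A) * (\<integral>x. (\<Sum>i<k. c i * g i x)\<^sup>2 \<partial>lebesgue)"
      proof -
        have "C / 2 * x \<le> C * t * y" if "x \<le> 2 * t * y" for x t y :: real
          using mult_left_mono[OF that, of "C / 2"] C by simp
        then show ?thesis unfolding frac_form_eq C_def[symmetric] using gbound[OF s(1,2), of c] by blast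
      qed
    qed
    then have "lam / C \<le> tail TYPE('a) s 1 + A" using C by (simp add: divide_le_eq mult.commute)
    moreover have "tail TYPE('a) s 1 + A + 1 \<le> tail TYPE('a) s (1 / 2 ^ i)" if "p \<le> i" for i
    proof -
      have "real p * v \<le> real i * v" using that v by (intro mult_right_mono) auto
      then show ?thesis using tail_dyadic[OF s(1), of i, where ?'a = 'a] p unfolding v_def[symmetric] by linarith
    qed
    ultimately have "lam / C + 1 \<le> tail TYPE('a) s (1 / 2 ^ i)" if "p \<le> i" for i using that by fastforce
    moreover have "weak_solution s \<Omega> (lam / C) (\<phi> s)"
      unfolding weak_solution_def
    proof (intro conjI ballI)
      show "\<phi> s \<in> frac_H0s s \<Omega>" by (rule \<phi>)
      show "(\<integral>x. (\<phi> s x)\<^sup>2 \<partial>lebesgue) = 1"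
        using assms(7)[OF that] H0s_set_integral[OF \<Omega>(1) \<phi> \<phi>] by (simp add: power2_eq_square)
      fix w assume w: "w \<in> frac_H0s s \<Omega>"
      have "frac_form s (\<phi> s) w = lam * (\<integral>x. \<phi> s x * w x \<partial>lebesgue)"
        using ef w H0s_set_integral[OF \<Omega>(1) \<phi> w] by (simp add: frac_eigenfunction_def)
      then show "energy s (\<phi> s) w = 2 * (lam / C) * (\<integral>x. \<phi> s x * w x \<partial>lebesgue)"
        unfolding frac_form_eq C_def[symmetric] using C by (simp add: field_simps)
    qed
    ultimately show ?thesis using s by (simp add: admissible_def lam_def C_def)
  qed
  obtain \<delta> where "0 < \<delta>" "\<And>s \<mu> \<phi>. admissible \<Omega> p s \<mu> \<phi> \<Longrightarrow>
     AE x in lebesgue. x \<in> \<Omega> \<and> dist_compl \<Omega> x < \<delta> \<longrightarrow> \<bar>\<phi> x\<bar> \<le> \<epsilon>"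
    using admissible_boundary_decay[OF \<Omega> assms(4) \<epsilon>, of p] by blast
  then show "\<exists>\<delta>>0. \<forall>s\<in>{0<..1/4}. AE x in lebesgue. x \<in> \<Omega> \<and> dist_compl \<Omega> x < \<delta> \<longrightarrow> \<bar>\<phi> s x\<bar> \<le> \<epsilon>"
    using adm by blast
qed

end
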